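(* Let $\mathbb{H}^3$ be the hyperbolic space and $g_{\mathbb{H}}$ be the standard hyperbolic metric on $\mathbb{H}^3$. There exists a small constant $\delta>0$ such that if $B$ is a geodesic ball in $\mathbb{H}^3$ with geodesic radius less than $\delta$, then there is another Riemannian metric $g$ on $B$ such that $g$ induces the same boundary metric on $\partial B$ as $g_{\mathbb{H}}$ does, $R(g)=R(g_{\mathbb{H}})$ on $B$, and $V(g)<V(g_{\mathbb{H}})$ on $B$.
   Context: $g_{\mathbb{H}}$ has constant sectional curvature $-1$. $R(\cdot)$ denotes scalar curvature and $V(\cdot)$ denotes the volume of $B$ with respect to the given metric; metrics on $B$ are understood to be defined up to the boundary $\partial B$. *)

theory Defs
  imports "HOL-Analysis.Analysis"
begin

section \<open>Smooth functions and tangent vectors\<close>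

text \<open>For open \<open>U\<close>, \<open>smooth_on U f\<close> says that \<open>f\<close> is of class \<open>C\<^sup>\<infinity>\<close> on \<open>U\<close>.\<close>

primrec times_differentiable_on ::
    "nat \<Rightarrow> 'a::real_normed_vector set \<Rightarrow> ('a \<Rightarrow> 'b::real_normed_vector) \<Rightarrow> bool" where
  "times_differentiable_on 0 U f \<longleftrightarrow> continuous_on U f"
| "times_differentiable_on (Suc n) U f \<longleftrightarrow>
     (\<forall>x\<in>U. f differentiable (at x)) \<and>
     (\<forall>v. times_differentiable_on n U (\<lambda>x. frechet_derivative f (at x) v))"

definition smooth_on ::
    "'a::real_normed_vector set \<Rightarrow> ('a \<Rightarrow> 'b::real_normed_vector) \<Rightarrow> bool" where
  "smooth_on U f \<longleftrightarrow> (\<forall>n. times_differentiable_on n U f)"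

text \<open>Velocities of smooth curves in \<open>S\<close>; if \<open>S\<close> is an embedded submanifold, this is the tangent
  space of \<open>S\<close> at \<open>x\<close>.\<close>

definition tangent_vectors :: "'a::real_normed_vector set \<Rightarrow> 'a \<Rightarrow> 'a set" where
  "tangent_vectors S x = {v. \<exists>c e. 0 < e \<and> smooth_on {-e<..<e} c \<and> c ` {-e<..<e} \<subseteq> S \<and>
     c 0 = x \<and> (c has_vector_derivative v) (at (0::real))}"


section \<open>Riemannian metrics in a global chart\<close>

text \<open>A metric on a region of \<open>\<real>\<^sup>n\<close> is represented by the field of its Gram matrices
  \<open>g\<^sub>i\<^sub>j\<close> with respect to the coordinate vector fields.\<close>

type_synonym 'n metric_field = "real^'n \<Rightarrow> real^'n^'n"

definition metric_inner :: "'n::finite metric_field \<Rightarrow> real^'n \<Rightarrow> real^'n \<Rightarrow> real^'n \<Rightarrow> real" where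
  "metric_inner g x u v = u \<bullet> (g x *v v)"

text \<open>The set \<open>S\<close> need not be open: if it is the closure of a smooth domain, the condition is
  smoothness up to the boundary. In that case the derivatives of \<open>g\<close> at points
  of \<open>S\<close>, hence the curvatures below, are determined by the restriction of \<open>g\<close> to \<open>S\<close>.\<close>

definition riemannian_metric_on :: "(real^'n) set \<Rightarrow> 'n::finite metric_field \<Rightarrow> bool" where
  "riemannian_metric_on S g \<longleftrightarrow>
     (\<exists>U. open U \<and> S \<subseteq> U \<and> smooth_on U g) \<and>
     (\<forall>x\<in>S. \<forall>u v. metric_inner g x u v = metric_inner g x v u) \<and>
     (\<forall>x\<in>S. \<forall>v. v \<noteq> 0 \<longrightarrow> 0 < metric_inner g x v v)"

definition partial_deriv :: "'n::finite \<Rightarrow> (real^'n \<Rightarrow> real) \<Rightarrow> real^'n \<Rightarrow> real" where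
  "partial_deriv i f x = frechet_derivative f (at x) (axis i 1)"

text \<open>\<open>christoffel g k i j\<close> is \<open>\<Gamma>\<^sup>k\<^sub>i\<^sub>j\<close>.\<close>

definition christoffel :: "'n::finite metric_field \<Rightarrow> 'n \<Rightarrow> 'n \<Rightarrow> 'n \<Rightarrow> real^'n \<Rightarrow> real" where
  "christoffel g k i j x = (1/2) * (\<Sum>l\<in>UNIV. matrix_inv (g x) $ k $ l *
     (partial_deriv i (\<lambda>y. g y $ j $ l) x + partial_deriv j (\<lambda>y. g y $ i $ l) x
      - partial_deriv l (\<lambda>y. g y $ i $ j) x))"

text \<open>\<open>riemann g l i j k\<close> is the component \<open>R\<^sup>l\<^sub>i\<^sub>j\<^sub>k\<close> given by
  \<open>R(\<partial>\<^sub>i, \<partial>\<^sub>j) \<partial>\<^sub>k = R\<^sup>l\<^sub>i\<^sub>j\<^sub>k \<partial>\<^sub>l\<close> with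
  \<open>R(X, Y) = [\<nabla>\<^sub>X, \<nabla>\<^sub>Y] - \<nabla>\<^bsub>[X,Y]\<^esub>\<close>; round spheres have positive scalar curvature.\<close>

definition riemann :: "'n::finite metric_field \<Rightarrow> 'n \<Rightarrow> 'n \<Rightarrow> 'n \<Rightarrow> 'n \<Rightarrow> real^'n \<Rightarrow> real" where
  "riemann g l i j k x =
     partial_deriv i (christoffel g l j k) x - partial_deriv j (christoffel g l i k) x
     + (\<Sum>m\<in>UNIV. christoffel g l i m x * christoffel g m j k x
                  - christoffel g l j m x * christoffel g m i k x)"

definition ricci :: "'n::finite metric_field \<Rightarrow> 'n \<Rightarrow> 'n \<Rightarrow> real^'n \<Rightarrow> real" where
  "ricci g j k x = (\<Sum>i\<in>UNIV. riemann g i i j k x)"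

definition scalar_curvature :: "'n::finite metric_field \<Rightarrow> real^'n \<Rightarrow> real" where
  "scalar_curvature g x =
     (\<Sum>j\<in>UNIV. \<Sum>k\<in>UNIV. matrix_inv (g x) $ j $ k * ricci g j k x)"

definition riemannian_volume :: "'n::finite metric_field \<Rightarrow> (real^'n) set \<Rightarrow> real" where
  "riemannian_volume g S = integral S (\<lambda>x. sqrt (det (g x)))"

text \<open>The infimum of the lengths of piecewise \<open>C\<^sup>1\<close> curves in \<open>M\<close>. The predicate \<open>valid_path\<close> allows
  unbounded velocity near the break points, so that a curve may have infinite length; stating the
  length with \<open>has_integral\<close> excludes such curves.\<close>

definition riemannian_dist ::
    "(real^'n) set \<Rightarrow> 'n::finite metric_field \<Rightarrow> real^'n \<Rightarrow> real^'n \<Rightarrow> real" where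
  "riemannian_dist M g p q = Inf {L. \<exists>\<gamma>. valid_path \<gamma> \<and> path_image \<gamma> \<subseteq> M \<and>
     pathstart \<gamma> = p \<and> pathfinish \<gamma> = q \<and>
     ((\<lambda>t. sqrt (metric_inner g (\<gamma> t) (vector_derivative \<gamma> (at t)) (vector_derivative \<gamma> (at t))))
        has_integral L) {0..1}}"


section \<open>Hyperbolic space\<close>

text \<open>The upper half-space model, with metric \<open>(dx\<^sub>1\<^sup>2 + dx\<^sub>2\<^sup>2 + dx\<^sub>3\<^sup>2) / x\<^sub>3\<^sup>2\<close>.\<close>

definition hyp_space :: "(real^3) set" where
  "hyp_space = {x. 0 < x $ 3}"

definition hyp_metric :: "3 metric_field" where
  "hyp_metric x = mat (1 / (x $ 3)\<^sup>2)"

text \<open>Geodesic balls are taken closed, so that they contain their boundary sphere. Being compact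
  in the open set \<open>hyp_space\<close>, their boundary is their frontier in \<open>\<real>\<^sup>3\<close>.\<close>

definition hyp_geodesic_ball :: "real^3 \<Rightarrow> real \<Rightarrow> (real^3) set" where
  "hyp_geodesic_ball p r = {x \<in> hyp_space. riemannian_dist hyp_space hyp_metric p x \<le> r}"

definition same_boundary_metric :: "(real^'n) set \<Rightarrow> 'n::finite metric_field \<Rightarrow> 'n metric_field \<Rightarrow> bool" where
  "same_boundary_metric B g h \<longleftrightarrow> (\<forall>x\<in>frontier B. \<forall>u\<in>tangent_vectors (frontier B) x.
     \<forall>v\<in>tangent_vectors (frontier B) x. metric_inner g x u v = metric_inner h x u v)"

end

theory Submission
  imports Defs
begin

text \<open>
  Let \<open>a = sinh r\<close>. A projective map carries the geodesic ball to the closed unit ball of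
  \<open>\<real>\<^sup>3\<close> and the boundary metric to \<open>a\<^sup>2\<close> times the round one, so a metric with this boundary
  metric is wanted on the unit ball. Candidates are the metrics
  \<open>a\<^sup>2 (dx\<^sub>1\<^sup>2 + dx\<^sub>2\<^sup>2 + m (x\<^sub>1 dx\<^sub>1 + x\<^sub>2 dx\<^sub>2)\<^sup>2 + G\<^sup>2 L dz\<^sup>2)\<close> with \<open>m\<close> and \<open>G\<close> functions of \<open>u = x\<^sub>1\<^sup>2 + x\<^sub>2\<^sup>2\<close> and
  \<open>L\<close> a function of \<open>z\<close>. Both constraints can be solved explicitly in this family.
  The scalar curvature is independent of \<open>L\<close> and, for given \<open>G\<close>, of first order and linear in
  \<open>Q = 1 / (1 + u m)\<close> (\<open>scalar_curvature_metric\<close>); the value \<open>-6\<close> is thus obtained by solving a linear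
  differential equation for \<open>Q\<close> (\<open>curvature_ode\<close>). On the unit sphere \<open>x\<^sub>1 dx\<^sub>1 + x\<^sub>2 dx\<^sub>2 = - z dz\<close> and
  \<open>u = 1 - z\<^sup>2\<close>, so that the boundary metric is round if \<open>L\<close> is chosen with \<open>G\<^sup>2 L = 1 - z\<^sup>2 m\<close> there
  (\<open>boundary_g\<close>). The function \<open>G\<close> remains free; it is \<open>1 + c u\<close> here.

  As \<open>a\<close> tends to 0, the rescaled metric tends to a scalar-flat metric on the unit ball with round boundary, whose
  volume is \<open>4 \<pi> / 3 (1 - 18 / 35 c\<^sup>2)\<close> up to terms of order \<open>c\<^sup>3\<close>: the Euclidean ball is a critical
  point, but the second variation in this direction is negative. With \<open>c = - 1 / 1000\<close> the volume is smaller than the Euclidean one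
  (\<open>flat_density_upper\<close>, \<open>density_bound_integral\<close>, with the moments of the ball from \<open>ball_moments\<close>).
  The rescaled hyperbolic balls tend to the Euclidean ball. The two densities depend continuously on \<open>a\<close>, so
  the strict inequality persists for small \<open>a\<close> (\<open>ball_integral_density_difference_neg\<close>).

  Two general facts link this to the statement. Geodesic balls of the half-space are
  Euclidean balls (\<open>hyp_geodesic_ball_eq_cball\<close>): lengths are bounded below by a calibration, and an explicit
  geodesic attains the bound. The scalar curvature computed from coordinates is invariant
  under changes of coordinates (\<open>scalar_curvature_pullback\<close>), so the metric may be pulled back to the
  half-space.\<close>

section \<open>Calculus of smooth functions\<close>

lemma times_differentiable_on_continuous:
  "times_differentiable_on n U f \<Longrightarrow> continuous_on U f"
  by (cases n) (auto intro!: differentiable_imp_continuous_on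
      simp: differentiable_on_def differentiable_at_withinI)

lemma times_differentiable_on_Suc_D:
  "times_differentiable_on (Suc n) U f \<Longrightarrow> times_differentiable_on n U f"
proof (induction n arbitrary: f)
  case 0
  then show ?case using times_differentiable_on_continuous[of "Suc 0" U f] by simp
next
  case (Suc n)
  then show ?case unfolding times_differentiable_on.simps(2)[of _ U f] by blast
qed

text \<open>The derivatives in \<open>times_differentiable_on\<close> are taken at a point of the full space, so that functions that agree
  on \<open>U\<close> are interchangeable only because \<open>U\<close> is open.\<close>

lemma times_differentiable_on_cong:
  assumes "open U" "times_differentiable_on n U f" "\<And>x. x \<in> U \<Longrightarrow> f x = g x"
  shows "times_differentiable_on n U g"
  using assms(2,3)
proof (induction n arbitrary: f g)
  case 0
  then show ?case by (simp cong: continuous_on_cong)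
next
  case (Suc n)
  have D: "(g has_derivative frechet_derivative f (at x)) (at x)" if "x \<in> U" for x
    using Suc.prems that assms(1)
    by (intro has_derivative_transform_within_open[of f _ x UNIV U g])
      (auto simp: frechet_derivative_works[symmetric])
  have "times_differentiable_on n U (\<lambda>x. frechet_derivative g (at x) v)" for v
  proof (rule Suc.IH[of "\<lambda>x. frechet_derivative f (at x) v"])
    show "times_differentiable_on n U (\<lambda>x. frechet_derivative f (at x) v)"
      using Suc.prems(1) by simp
    show "frechet_derivative f (at x) v = frechet_derivative g (at x) v" if "x \<in> U" for x
      by (rule fun_cong[OF frechet_derivative_at[OF D[OF that]]])
  qed
  moreover have "\<forall>x\<in>U. g differentiable (at x)"
    using D by (blast intro: differentiableI)
  ultimately show ?case by simp
qed

text \<open>The introduction rule that the inductions below use: it suffices to exhibit some derivative,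
  and to know that its values in each fixed direction are \<open>n\<close> times differentiable.\<close>

lemma times_differentiable_on_SucI:
  assumes "open U" "\<And>x. x \<in> U \<Longrightarrow> (f has_derivative D x) (at x)"
    and "\<And>v. times_differentiable_on n U (\<lambda>x. D x v)"
  shows "times_differentiable_on (Suc n) U f"
proof -
  have "times_differentiable_on n U (\<lambda>x. frechet_derivative f (at x) v)" for v
    by (intro times_differentiable_on_cong[OF assms(1) assms(3)[of v]] fun_cong[OF frechet_derivative_at] assms(2))
  moreover have "\<forall>x\<in>U. f differentiable (at x)"
    using assms(2) by (blast intro: differentiableI)
  ultimately show ?thesis by simp
qed

lemma times_differentiable_on_const: "times_differentiable_on n U (\<lambda>_. c)"
  by (induction n arbitrary: c) (auto simp: frechet_derivative_const)

lemma smooth_on_const [intro]: "smooth_on U (\<lambda>_. c)"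
  by (simp add: smooth_on_def times_differentiable_on_const)

lemma smooth_on_bounded_linear:
  assumes "bounded_linear f"
  shows "smooth_on U f"
proof -
  have "frechet_derivative f (at x) = f" for x
    using frechet_derivative_at[OF bounded_linear_imp_has_derivative[OF assms], of x] by simp
  then have "times_differentiable_on (Suc n) U f" for n
    using assms by (simp add: times_differentiable_on_const bounded_linear_imp_differentiable)
  then have "times_differentiable_on n U f" for n
    by (rule times_differentiable_on_Suc_D)
  then show ?thesis by (simp add: smooth_on_def)
qed

lemma times_differentiable_on_add:
  assumes "open U" "times_differentiable_on n U f" "times_differentiable_on n U g"
  shows "times_differentiable_on n U (\<lambda>x. f x + g x)"
  using assms(2,3)
proof (induction n arbitrary: f g)
  case 0
  then show ?case by (simp add: continuous_on_add)
next
  case (Suc n)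
  show ?case
    by (rule times_differentiable_on_SucI[OF assms(1),
          where D = "\<lambda>x v. frechet_derivative f (at x) v + frechet_derivative g (at x) v"])
      (use Suc in \<open>auto intro!: has_derivative_add simp: frechet_derivative_works[symmetric]\<close>)
qed

lemma times_differentiable_on_mult:
  fixes f g :: "'a::real_normed_vector \<Rightarrow> real"
  assumes "open U" "times_differentiable_on n U f" "times_differentiable_on n U g"
  shows "times_differentiable_on n U (\<lambda>x. f x * g x)"
  using assms(2,3)
proof (induction n arbitrary: f g)
  case 0
  then show ?case by (simp add: continuous_on_mult)
next
  case (Suc n)
  let ?D = "\<lambda>x v. f x * frechet_derivative g (at x) v + frechet_derivative f (at x) v * g x"
  show ?case
  proof (rule times_differentiable_on_SucI[OF assms(1), where D = ?D])
    show "((\<lambda>x. f x * g x) has_derivative ?D x) (at x)" if "x \<in> U" for x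
      using Suc.prems that
      by (intro has_derivative_mult) (auto simp: frechet_derivative_works[symmetric])
    have "times_differentiable_on n U f" "times_differentiable_on n U g"
      using Suc.prems by (blast intro: times_differentiable_on_Suc_D)+
    then show "times_differentiable_on n U (\<lambda>x. ?D x v)" for v
      using Suc.prems by (intro times_differentiable_on_add assms(1) Suc.IH) auto
  qed
qed

text \<open>In the chain rule \<open>D(f \<circ> h) v = f'(h) \<cdot> Dh v\<close> the first factor is again a composition, of a
  function that is differentiable once less often, which is what the induction needs.\<close>

lemma times_differentiable_on_compose_real:
  fixes f :: "real \<Rightarrow> real" and h :: "'a::real_normed_vector \<Rightarrow> real"
  assumes "open U" "times_differentiable_on n I f" "times_differentiable_on n U h" "h ` U \<subseteq> I"
  shows "times_differentiable_on n U (\<lambda>x. f (h x))"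
  using assms(2,3)
proof (induction n arbitrary: f)
  case 0
  then show ?case using assms(4) by (auto intro: continuous_on_compose2)
next
  case (Suc n)
  have hf: "(f has_derivative frechet_derivative f (at (h x))) (at (h x))"
    "(h has_derivative frechet_derivative h (at x)) (at x)" if "x \<in> U" for x
    using Suc.prems assms(4) that by (auto simp: frechet_derivative_works[symmetric])
  have 1: "((\<lambda>x. f (h x)) has_derivative
      (\<lambda>v. frechet_derivative f (at (h x)) 1 * frechet_derivative h (at x) v)) (at x)"
    if "x \<in> U" for x
  proof -
    have "linear (frechet_derivative f (at (h x)))"
      using Suc.prems assms(4) that by (auto intro: linear_frechet_derivative)
    then have "frechet_derivative f (at (h x)) t = frechet_derivative f (at (h x)) 1 * t" for t
      using linear_scale[of "frechet_derivative f (at (h x))" t 1] by (simp add: mult.commute)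
    then have "(\<lambda>v. frechet_derivative f (at (h x)) (frechet_derivative h (at x) v)) =
        (\<lambda>v. frechet_derivative f (at (h x)) 1 * frechet_derivative h (at x) v)"
      by (intro ext)
    with has_derivative_compose[OF hf(2)[OF that] hf(1)[OF that]] show ?thesis by (simp only:)
  qed
  have "times_differentiable_on n U h"
    by (rule times_differentiable_on_Suc_D[OF Suc.prems(2)])
  then have "times_differentiable_on n U (\<lambda>x. frechet_derivative f (at (h x)) 1)"
    using Suc.IH[of "\<lambda>y. frechet_derivative f (at y) 1"] Suc.prems(1) by simp
  moreover have "times_differentiable_on n U (\<lambda>x. frechet_derivative h (at x) v)" for v
    using Suc.prems(2) by simp
  ultimately show ?case
    by (intro times_differentiable_on_SucI[OF assms(1) 1] times_differentiable_on_mult assms(1))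
qed

lemma smooth_on_add:
  "open U \<Longrightarrow> smooth_on U f \<Longrightarrow> smooth_on U g \<Longrightarrow> smooth_on U (\<lambda>x. f x + g x)"
  by (simp add: smooth_on_def times_differentiable_on_add)

lemma smooth_on_mult:
  fixes f g :: "'a::real_normed_vector \<Rightarrow> real"
  shows "open U \<Longrightarrow> smooth_on U f \<Longrightarrow> smooth_on U g \<Longrightarrow> smooth_on U (\<lambda>x. f x * g x)"
  by (simp add: smooth_on_def times_differentiable_on_mult)

lemma smooth_on_uminus:
  fixes f :: "'a::real_normed_vector \<Rightarrow> real"
  shows "open U \<Longrightarrow> smooth_on U f \<Longrightarrow> smooth_on U (\<lambda>x. - f x)"
  using smooth_on_mult[of U "\<lambda>_. -1" f] by (simp add: smooth_on_const)

lemma smooth_on_diff: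
  fixes f g :: "'a::real_normed_vector \<Rightarrow> real"
  shows "open U \<Longrightarrow> smooth_on U f \<Longrightarrow> smooth_on U g \<Longrightarrow> smooth_on U (\<lambda>x. f x - g x)"
  using smooth_on_add[of U f "\<lambda>x. - g x"] by (simp add: smooth_on_uminus)

lemma smooth_on_power:
  fixes f :: "'a::real_normed_vector \<Rightarrow> real"
  shows "open U \<Longrightarrow> smooth_on U f \<Longrightarrow> smooth_on U (\<lambda>x. f x ^ k)"
  by (induction k) (auto intro: smooth_on_mult)

lemma smooth_on_compose_real:
  fixes f :: "real \<Rightarrow> real" and h :: "'a::real_normed_vector \<Rightarrow> real"
  shows "open U \<Longrightarrow> smooth_on I f \<Longrightarrow> smooth_on U h \<Longrightarrow> h ` U \<subseteq> I \<Longrightarrow> smooth_on U (\<lambda>x. f (h x))"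
  unfolding smooth_on_def by (auto intro!: times_differentiable_on_compose_real[of U _ I f h])

lemma smooth_on_inverse_real: "smooth_on (- {0}) (inverse :: real \<Rightarrow> real)"
proof -
  have "times_differentiable_on n (- {0}) (inverse :: real \<Rightarrow> real)" for n
  proof (induction n)
    case 0
    show ?case by (auto intro!: continuous_intros)
  next
    case (Suc n)
    have "times_differentiable_on n (- {0}) (\<lambda>x::real. (- v) * (inverse x * inverse x))" for v
      by (intro times_differentiable_on_mult times_differentiable_on_const Suc) auto
    then show ?case
      by (intro times_differentiable_on_SucI[where D = "\<lambda>x v. (- v) * (inverse x * inverse x)"])
        (auto intro!: derivative_eq_intros)
  qed
  then show ?thesis by (simp add: smooth_on_def)
qed

lemma smooth_on_divide:
  fixes f g :: "'a::real_normed_vector \<Rightarrow> real"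
  assumes "open U" "smooth_on U f" "smooth_on U g" "\<And>x. x \<in> U \<Longrightarrow> g x \<noteq> 0"
  shows "smooth_on U (\<lambda>x. f x / g x)"
  unfolding divide_inverse
  using assms by (intro smooth_on_mult smooth_on_compose_real[OF _ smooth_on_inverse_real]) auto

text \<open>The derivative \<open>root k x / (k x)\<close> contains the root itself, so the induction closes.\<close>

lemma smooth_on_root: "smooth_on {0<..} (root (Suc k))"
proof -
  have "times_differentiable_on n {0<..} (root (Suc k))" for n
  proof (induction n)
    case 0
    show ?case by (auto intro!: continuous_intros)
  next
    case (Suc n)
    have "times_differentiable_on n {0<..} (inverse::real \<Rightarrow> real)"
      using times_differentiable_on_compose_real[of "{0<..}" n "-{0}" inverse "\<lambda>x. x"]
        smooth_on_inverse_real smooth_on_bounded_linear[OF bounded_linear_ident, of "{0<..}"]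
      by (auto simp: smooth_on_def)
    moreover have "(root (Suc k) has_derivative
        (\<lambda>v. inverse (real (Suc k)) * (root (Suc k) x * inverse x) * v)) (at x)" if "0 < x" for x
    proof -
      have "root (Suc k) x ^ k * root (Suc k) x = x"
        using that real_root_pow_pos2[of "Suc k" x] by (simp add: mult.commute)
      then have "inverse (real (Suc k) * root (Suc k) x ^ k) = root (Suc k) x * inverse x / real (Suc k)"
        using that by (simp add: field_simps del: of_nat_Suc)
      moreover have "DERIV (root (Suc k)) x :> inverse (real (Suc k) * root (Suc k) x ^ (Suc k - Suc 0))"
        using that by (intro DERIV_real_root) auto
      ultimately have "DERIV (root (Suc k)) x :> inverse (real (Suc k)) * (root (Suc k) x * inverse x)"
        by (simp add: divide_inverse mult_ac)
      then show ?thesis by (simp only: has_field_derivative_def)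
    qed
    ultimately show ?case
      by (intro times_differentiable_on_SucI[where D =
            "\<lambda>x v. inverse (real (Suc k)) * (root (Suc k) x * inverse x) * v"]
          times_differentiable_on_mult times_differentiable_on_const Suc) auto
  qed
  then show ?thesis by (simp add: smooth_on_def)
qed

lemma smooth_on_component:
  "smooth_on U (\<lambda>x::real^'n. x $ i)"
  by (rule smooth_on_bounded_linear) (simp add: bounded_linear_vec_nth)

lemma has_derivative_matrix:
  fixes F :: "'a::real_normed_vector \<Rightarrow> real^'n::finite^'m::finite"
  assumes "\<And>i j. ((\<lambda>x. F x $ i $ j) has_derivative (\<lambda>v. D v $ i $ j)) (at x)"
  shows "(F has_derivative D) (at x)"
proof -
  have "((\<lambda>x. F x \<bullet> b) has_derivative (\<lambda>v. D v \<bullet> b)) (at x)" if "b \<in> Basis" for b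
    using that assms by (auto simp: Basis_vec_def inner_axis)
  then show ?thesis
    by (subst has_derivative_componentwise_within) auto
qed

lemma smooth_on_matrix:
  fixes F :: "'a::real_normed_vector \<Rightarrow> real^'n::finite^'m::finite"
  assumes "open U" "\<And>i j. smooth_on U (\<lambda>x. F x $ i $ j)"
  shows "smooth_on U F"
proof -
  have "times_differentiable_on n U F" if "\<And>i j. times_differentiable_on n U (\<lambda>x. F x $ i $ j)" for n
    using that
  proof (induction n arbitrary: F)
    case 0
    then have "continuous_on U (\<lambda>x. \<chi> i j. F x $ i $ j)"
      by (intro continuous_on_vec_lambda) auto
    then show ?case by simp
  next
    case (Suc n)
    let ?D = "\<lambda>x v. \<chi> i j. frechet_derivative (\<lambda>x. F x $ i $ j) (at x) v"
    show ?case
    proof (rule times_differentiable_on_SucI[OF assms(1), where D = ?D])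
      show "(F has_derivative ?D x) (at x)" if "x \<in> U" for x
        using Suc.prems that by (intro has_derivative_matrix) (auto simp: frechet_derivative_works[symmetric])
      show "times_differentiable_on n U (\<lambda>x. ?D x v)" for v
        using Suc.prems by (intro Suc.IH) auto
    qed
  qed
  then show ?thesis using assms(2) by (auto simp: smooth_on_def)
qed

section \<open>Hyperbolic distance and geodesic balls\<close>

lemma has_derivative_vec:
  fixes F :: "'a::real_normed_vector \<Rightarrow> real^'n::finite"
  assumes "\<And>i. ((\<lambda>x. F x $ i) has_derivative (\<lambda>v. D v $ i)) (at x)"
  shows "(F has_derivative D) (at x)"
proof -
  have "((\<lambda>x. F x \<bullet> b) has_derivative (\<lambda>v. D v \<bullet> b)) (at x)" if "b \<in> Basis" for b
    using that assms by (auto simp: Basis_vec_def inner_axis)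
  then show ?thesis
    by (subst has_derivative_componentwise_within) auto
qed

lemma has_derivative_vec_nth [derivative_intros]:
  "(f has_derivative D) F \<Longrightarrow> ((\<lambda>x. f x $ i) has_derivative (\<lambda>v. D v $ i)) F"
  by (rule bounded_linear.has_derivative[OF bounded_linear_vec_nth])

lemma norm_sq_3: "(norm (x::real^3))^2 = (x$1)^2 + (x$2)^2 + (x$3)^2"
  unfolding power2_norm_eq_inner by (simp add: inner_vec_def sum_3 power2_eq_square)

lemma metric_inner_hyp: "metric_inner hyp_metric x u v = (u \<bullet> v) / (x$3)^2"
proof -
  have "mat c *v v = c *\<^sub>R v" for c :: real
    by (vector mat_def matrix_vector_mult_def) (simp add: if_distrib if_distribR cong: if_cong)
  then show ?thesis by (simp add: metric_inner_def hyp_metric_def)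
qed

text \<open>The hyperbolic cosine of the hyperbolic distance in the upper half-space; that it is one is
  the content of \<open>hyp_dist_eq\<close> below.\<close>

definition hyp_cosh_dist :: "real^3 \<Rightarrow> real^3 \<Rightarrow> real" where
  "hyp_cosh_dist p x = 1 + (norm (x - p))^2 / (2 * p$3 * x$3)"

lemma hyp_cosh_dist_alt:
  assumes "0 < p$3" "0 < x$3"
  shows "2 * p$3 * x$3 * hyp_cosh_dist p x =
    (p$1)^2 + (p$2)^2 + (p$3)^2 + (x$1)^2 + (x$2)^2 + (x$3)^2 - 2 * (p$1 * x$1 + p$2 * x$2)"
  using assms unfolding hyp_cosh_dist_def norm_sq_3
  by (simp add: field_simps) (simp add: power2_eq_square algebra_simps)

lemma hyp_cosh_dist_gt_1:
  assumes "0 < p$3" "0 < x$3" "p \<noteq> x"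
  shows "1 < hyp_cosh_dist p x"
  using assms by (simp add: hyp_cosh_dist_def)

abbreviation hyp_speed :: "(real \<Rightarrow> real^3) \<Rightarrow> real \<Rightarrow> real" where
  "hyp_speed \<gamma> t \<equiv> sqrt (metric_inner hyp_metric (\<gamma> t)
    (vector_derivative \<gamma> (at t)) (vector_derivative \<gamma> (at t)))"

text \<open>A function whose gradient has hyperbolic length at most 1 changes along a curve by at most the
  length of the curve. The functions used here are \<open>arsinh \<circ> f\<close>, the signed distances from
  totally geodesic surfaces. In the hyperboloid model \<open>f\<close> is linear, with a spacelike normal of length 1 (this
  is the hypothesis on \<open>A\<close>, \<open>b\<^sub>1\<close>, \<open>b\<^sub>2\<close>, \<open>E\<close>), and the squared gradient of \<open>f\<close> is
  \<open>1 + f\<^sup>2\<close>. Unlike the distance from a point, these functions are smooth everywhere.\<close>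

lemma calibration_bound:
  fixes A E b1 b2 :: real and \<gamma> :: "real \<Rightarrow> real^3"
  defines "f \<equiv> \<lambda>y::real^3. (A * (norm y)^2 + b1 * y$1 + b2 * y$2 + E) / y$3"
  assumes disc: "b1^2 + b2^2 - 4 * A * E = 1"
    and \<gamma>: "valid_path \<gamma>" "path_image \<gamma> \<subseteq> hyp_space"
    and L: "(hyp_speed \<gamma> has_integral L) {0..1}"
  shows "arsinh (f (\<gamma> 1)) - arsinh (f (\<gamma> 0)) \<le> L"
proof -
  define df where "df = (\<lambda>y v::real^3. ((2 * A * y$1 + b1) * v$1 + (2 * A * y$2 + b2) * v$2
      + (2 * A * y$3 - f y) * v$3) / y$3)"
  have pos: "0 < \<gamma> t $ 3" if "t \<in> {0..1}" for t
    using \<gamma>(2) that by (fastforce simp: path_image_def hyp_space_def)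
  obtain S where S: "finite S" "\<gamma> C1_differentiable_on {0..1} - S"
    and cont: "continuous_on {0..1} \<gamma>"
    using \<gamma>(1) by (auto simp: valid_path_def piecewise_C1_differentiable_on_def)
  have fder: "(f has_derivative df y) (at y)" if "0 < y$3" for y
  proof -
    have n2: "(norm y)^2 = y \<bullet> y" for y :: "real^3" by (rule power2_norm_eq_inner)
    have "(f has_derivative (\<lambda>v. ((2 * A * (y \<bullet> v) + b1 * v$1 + b2 * v$2) * y$3
        - (A * (norm y)^2 + b1 * y$1 + b2 * y$2 + E) * v$3) / (y$3 * y$3))) (at y)"
      unfolding f_def n2 using that
      by (auto intro!: derivative_eq_intros simp: inner_commute fun_eq_iff algebra_simps)
    moreover have "((2 * A * (y \<bullet> v) + b1 * v$1 + b2 * v$2) * y$3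
        - (A * (norm y)^2 + b1 * y$1 + b2 * y$2 + E) * v$3) / (y$3 * y$3) = df y v" for v
      using that unfolding df_def f_def inner_vec_def sum_3 by (simp add: field_simps)
    ultimately show ?thesis by simp
  qed
  have bound: "\<bar>df y v\<bar> \<le> sqrt (1 + (f y)^2) * sqrt (metric_inner hyp_metric y v v)" if "0 < y$3" for y v
  proof -
    have y3: "y$3 * f y = A * ((y$1)^2 + (y$2)^2 + (y$3)^2) + b1 * y$1 + b2 * y$2 + E"
      using that by (simp add: f_def norm_sq_3)
    define w where "w = (vector [2 * A * y$1 + b1, 2 * A * y$2 + b2, 2 * A * y$3 - f y] :: real^3)"
    have "(norm w)^2 = 4 * A * (A * ((y$1)^2 + (y$2)^2 + (y$3)^2) + b1 * y$1 + b2 * y$2 - y$3 * f y)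
        + b1^2 + b2^2 + (f y)^2"
      unfolding norm_sq_3 w_def by (simp add: power2_eq_square algebra_simps)
    also have "\<dots> = 1 + (f y)^2" using disc unfolding y3 by (simp add: algebra_simps)
    finally have w: "norm w = sqrt (1 + (f y)^2)" by (metis norm_ge_zero real_sqrt_unique)
    have "df y v = (w \<bullet> v) / y$3"
      unfolding df_def w_def inner_vec_def sum_3 by simp
    then have "\<bar>df y v\<bar> \<le> norm w * norm v / y$3"
      using that Cauchy_Schwarz_ineq2[of w v] by (simp add: divide_right_mono)
    also have "norm w * norm v / y$3 = norm w * sqrt (metric_inner hyp_metric y v v)"
      using that by (simp add: metric_inner_hyp real_sqrt_divide norm_eq_sqrt_inner)
    finally show ?thesis using w by simp
  qed
  let ?h' = "\<lambda>t. df (\<gamma> t) (vector_derivative \<gamma> (at t)) / sqrt ((f (\<gamma> t))^2 + 1)"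
  have "(?h' has_integral (arsinh (f (\<gamma> 1)) - arsinh (f (\<gamma> 0)))) {0..1}"
  proof (rule fundamental_theorem_of_calculus_interior_strong[OF S(1)])
    show "continuous_on {0..1} (\<lambda>t. arsinh (f (\<gamma> t)))"
      unfolding f_def using pos
      by (intro continuous_intros cont) force
    fix t assume t: "t \<in> {0<..<1::real} - S"
    then have "\<gamma> differentiable (at t)"
      using S(2) by (auto simp: C1_differentiable_on_eq)
    then have "(\<gamma> has_vector_derivative vector_derivative \<gamma> (at t)) (at t)"
      using vector_derivative_works by blast
    then have 1: "(\<gamma> has_derivative (\<lambda>h. h *\<^sub>R vector_derivative \<gamma> (at t))) (at t)"
      by (simp add: has_vector_derivative_def)
    have "((\<lambda>t. f (\<gamma> t)) has_derivative (\<lambda>h. df (\<gamma> t) (h *\<^sub>R vector_derivative \<gamma> (at t)))) (at t)"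
      using t pos[of t] by (intro has_derivative_compose[OF 1] fder) auto
    moreover have "df y (h *\<^sub>R v) = df y v * h" for y h v
      unfolding df_def by (simp add: algebra_simps add_divide_distrib)
    ultimately have "((\<lambda>t. f (\<gamma> t)) has_real_derivative df (\<gamma> t) (vector_derivative \<gamma> (at t))) (at t)"
      by (simp add: has_field_derivative_def)
    from DERIV_chain2[OF arsinh_real_has_field_derivative this]
    show "((\<lambda>t. arsinh (f (\<gamma> t))) has_vector_derivative ?h' t) (at t)"
      by (simp add: has_real_derivative_iff_has_vector_derivative[symmetric])
  qed auto
  from this L show ?thesis
  proof (rule has_integral_le)
    fix t :: real assume "t \<in> {0..1}"
    then have "df (\<gamma> t) (vector_derivative \<gamma> (at t)) \<le> sqrt (1 + (f (\<gamma> t))^2) *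
       sqrt (metric_inner hyp_metric (\<gamma> t) (vector_derivative \<gamma> (at t)) (vector_derivative \<gamma> (at t)))"
      using bound pos by (meson abs_le_D1)
    moreover have "0 < sqrt ((f (\<gamma> t))^2 + 1)" by (smt (verit) real_sqrt_gt_zero zero_le_power2)
    ultimately show "?h' t \<le> sqrt (metric_inner hyp_metric (\<gamma> t)
        (vector_derivative \<gamma> (at t)) (vector_derivative \<gamma> (at t)))"
      by (simp add: pos_divide_le_eq mult.commute add.commute)
  qed
qed

text \<open>The calibration is the signed distance from the totally geodesic surface through \<open>p\<close>
  orthogonal to the geodesic from \<open>p\<close> to \<open>x\<close>: it vanishes at \<open>p\<close>, and at \<open>x\<close> it is
  the distance from \<open>p\<close> to \<open>x\<close>.\<close>

lemma hyp_length_ge: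
  assumes "0 < p$3" "0 < x$3" "p \<noteq> x"
    and \<gamma>: "valid_path \<gamma>" "path_image \<gamma> \<subseteq> hyp_space" "pathstart \<gamma> = p" "pathfinish \<gamma> = x"
    and L: "(hyp_speed \<gamma> has_integral L) {0..1}"
  shows "arcosh (hyp_cosh_dist p x) \<le> L"
proof -
  define D where "D = hyp_cosh_dist p x"
  define S where "S = sqrt (D^2 - 1)"
  have D: "1 < D" using assms hyp_cosh_dist_gt_1 by (simp add: D_def)
  then have "1 < D^2" by (simp add: one_less_power)
  then have S: "0 < S" "S^2 = D^2 - 1" by (auto simp: S_def)
  have Dalt: "2 * p$3 * x$3 * D = (p$1)^2 + (p$2)^2 + (p$3)^2 + (x$1)^2 + (x$2)^2 + (x$3)^2
      - 2 * (p$1 * x$1 + p$2 * x$2)"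
    unfolding D_def by (rule hyp_cosh_dist_alt[OF assms(1,2)])
  define A where "A = (D / (2 * p$3) - 1 / (2 * x$3)) / S"
  define b1 where "b1 = (x$1 / x$3 - D * p$1 / p$3) / S"
  define b2 where "b2 = (x$2 / x$3 - D * p$2 / p$3) / S"
  define E where "E = (D * (norm p)^2 / (2 * p$3) - (norm x)^2 / (2 * x$3)) / S"
  define P X where "P = p$3" and "X = x$3"
  have PX: "0 < P" "0 < X" using assms by (auto simp: P_def X_def)
  have "(S * b1)^2 + (S * b2)^2 - 4 * (S * A) * (S * E) = S^2"
  proof -
    have 1: "S * b1 = (x$1 * P - D * p$1 * X) / (P * X)" "S * b2 = (x$2 * P - D * p$2 * X) / (P * X)"
      "S * A = (D * X - P) / (2 * (P * X))"
      "S * E = (D * (norm p)^2 * X - (norm x)^2 * P) / (2 * (P * X))"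
      using S(1) PX unfolding A_def b1_def b2_def E_def P_def[symmetric] X_def[symmetric]
      by (simp_all add: field_simps)
    have "(S * b1)^2 + (S * b2)^2 - 4 * (S * A) * (S * E) =
      ((x$1 * P - D * p$1 * X)^2 + (x$2 * P - D * p$2 * X)^2
       - (D * X - P) * (D * (norm p)^2 * X - (norm x)^2 * P)) / (P * X)^2"
    proof -
      have "(a / n)^2 + (b / n)^2 - 4 * (c / (2 * n)) * (d / (2 * n)) = (a^2 + b^2 - c * d) / n^2"
        for a b c d n :: real
        by (simp add: power_divide diff_divide_distrib add_divide_distrib power2_eq_square)
      then show ?thesis unfolding 1 .
    qed
    also have "(x$1 * P - D * p$1 * X)^2 + (x$2 * P - D * p$2 * X)^2
       - (D * X - P) * (D * (norm p)^2 * X - (norm x)^2 * P)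
       = D * P * X * ((p$1)^2 + (p$2)^2 + P^2 + (x$1)^2 + (x$2)^2 + X^2
         - 2 * (p$1 * x$1 + p$2 * x$2)) - (D^2 + 1) * (P * X)^2"
      unfolding norm_sq_3 P_def[symmetric] X_def[symmetric]
      by (simp add: power2_eq_square algebra_simps)
    also have "\<dots> = (D^2 - 1) * (P * X)^2"
      unfolding Dalt[folded P_def X_def, symmetric] by (simp add: power2_eq_square algebra_simps)
    also have "\<dots> / (P * X)^2 = S^2" using S(2) PX by simp
    finally show ?thesis .
  qed
  then have "S^2 * (b1^2 + b2^2 - 4 * A * E) = S^2 * 1"
    by (simp add: power2_eq_square algebra_simps)
  then have disc: "b1^2 + b2^2 - 4 * A * E = 1" using S(1) by simp
  let ?f = "\<lambda>y::real^3. (A * (norm y)^2 + b1 * y$1 + b2 * y$2 + E) / y$3"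
  have "?f p = 0"
  proof -
    have "S * (A * (norm p)^2 + b1 * p$1 + b2 * p$2 + E)
        = (D / P - 1 / X) / 2 * (norm p)^2 + (x$1 / X - D * p$1 / P) * p$1 + (x$2 / X - D * p$2 / P) * p$2
          + (D * (norm p)^2 / P - (norm x)^2 / X) / 2"
      using S(1) unfolding A_def b1_def b2_def E_def P_def[symmetric] X_def[symmetric]
      by (simp add: field_simps)
    also have "\<dots> = (D * X * (2 * ((norm p)^2 - (p$1)^2 - (p$2)^2))
        - P * ((norm p)^2 + (norm x)^2 - 2 * (p$1 * x$1 + p$2 * x$2))) / (2 * P * X)"
      using PX by (simp add: field_simps power2_eq_square)
    also have "(norm p)^2 + (norm x)^2 - 2 * (p$1 * x$1 + p$2 * x$2) = 2 * P * X * D"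
      using Dalt unfolding norm_sq_3 P_def[symmetric] X_def[symmetric] by simp
    also have "(D * X * (2 * ((norm p)^2 - (p$1)^2 - (p$2)^2)) - P * (2 * P * X * D)) / (2 * P * X) = 0"
      unfolding norm_sq_3 P_def[symmetric] by (simp add: power2_eq_square)
    finally show ?thesis using S(1) by simp
  qed
  moreover have "?f x = S"
  proof -
    have "S * (A * (norm x)^2 + b1 * x$1 + b2 * x$2 + E)
        = (D / P - 1 / X) / 2 * (norm x)^2 + (x$1 / X - D * p$1 / P) * x$1 + (x$2 / X - D * p$2 / P) * x$2
          + (D * (norm p)^2 / P - (norm x)^2 / X) / 2"
      using S(1) unfolding A_def b1_def b2_def E_def P_def[symmetric] X_def[symmetric]
      by (simp add: field_simps)
    also have "\<dots> = (D * X * ((norm p)^2 + (norm x)^2 - 2 * (p$1 * x$1 + p$2 * x$2))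
        - P * (2 * ((norm x)^2 - (x$1)^2 - (x$2)^2))) / (2 * P * X)"
      using PX by (simp add: field_simps power2_eq_square)
    also have "(norm p)^2 + (norm x)^2 - 2 * (p$1 * x$1 + p$2 * x$2) = 2 * P * X * D"
      using Dalt unfolding norm_sq_3 P_def[symmetric] X_def[symmetric] by simp
    also have "(D * X * (2 * P * X * D) - P * (2 * ((norm x)^2 - (x$1)^2 - (x$2)^2))) / (2 * P * X) = (D^2 - 1) * X"
      unfolding norm_sq_3 P_def[symmetric] X_def[symmetric] using PX
      by (simp add: field_simps power2_eq_square)
    also have "\<dots> = S * (S * X)" using S(2) by (simp add: power2_eq_square)
    finally have "A * (norm x)^2 + b1 * x$1 + b2 * x$2 + E = S * X" using S(1) by simp
    then show ?thesis using PX by (simp add: X_def)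
  qed
  ultimately have "arsinh S \<le> L"
    using calibration_bound[OF disc \<gamma>(1,2) L] \<gamma>(3,4) by (simp add: pathstart_def pathfinish_def del: divide_eq_0_iff)
  moreover have "arsinh S = arcosh D"
  proof -
    have "sinh (arcosh D) = S"
      using D S_def sinh_arcosh_real by simp
    then show ?thesis by (metis arsinh_sinh_real)
  qed
  ultimately show ?thesis by (simp add: D_def)
qed

text \<open>In the hyperboloid model the geodesic of speed \<open>d\<close> from \<open>P\<close> to \<open>X\<close> is
  \<open>(sinh (d (1 - t)) P + sinh (d t) X) / sinh d\<close>. The quotients \<open>1 / x\<^sub>3\<close>, \<open>x\<^sub>1 / x\<^sub>3\<close> and
  \<open>x\<^sub>2 / x\<^sub>3\<close> are linear coordinates of that model; below, \<open>W / sinh d\<close> and \<open>N i / sinh d\<close> are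
  their values along the geodesic.\<close>

lemma hyp_geodesic:
  assumes p: "0 < p$3" and x: "0 < x$3" and "p \<noteq> x"
  obtains \<gamma> where "valid_path \<gamma>" "path_image \<gamma> \<subseteq> hyp_space" "pathstart \<gamma> = p" "pathfinish \<gamma> = x"
    "(hyp_speed \<gamma> has_integral arcosh (hyp_cosh_dist p x)) {0..1}"
proof -
  define d where "d = arcosh (hyp_cosh_dist p x)"
  have "1 < hyp_cosh_dist p x" by (rule hyp_cosh_dist_gt_1[OF assms])
  then have d: "0 < d" "cosh d = hyp_cosh_dist p x"
    by (auto simp: d_def )
  define P X where "P = p$3" and "X = x$3"
  have PX: "0 < P" "0 < X" using assms by (auto simp: P_def X_def)
  define W where "W = (\<lambda>t. sinh (d * (1 - t)) / P + sinh (d * t) / X)"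
  define W' where "W' = (\<lambda>t. d * (cosh (d * t) / X - cosh (d * (1 - t)) / P))"
  define N where "N = (\<lambda>i t. sinh (d * (1 - t)) / P * p$i + sinh (d * t) / X * x$i)"
  define N' where "N' = (\<lambda>i t. d * (cosh (d * t) / X * x$i - cosh (d * (1 - t)) / P * p$i))"
  define \<gamma> where "\<gamma> = (\<lambda>t. \<chi> i::3. if i = 3 then sinh d / W t else N i t / W t)"
  define \<gamma>' where "\<gamma>' = (\<lambda>t. \<chi> i::3. if i = 3 then - sinh d * W' t / (W t)^2
      else (N' i t * W t - N i t * W' t) / (W t)^2)"
  have sd: "0 < sinh d" using d(1) by simp
  have Wpos: "0 < W t" if "t \<in> {0..1}" for t
  proof (cases "t = 0")
    case False
    then have "0 < sinh (d * t) / X" "0 \<le> sinh (d * (1 - t)) / P"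
      using that d(1) PX by (auto simp: sinh_real_nonneg_iff)
    then show ?thesis unfolding W_def by linarith
  qed (use sd PX in \<open>simp add: W_def\<close>)
  have derW: "(W has_real_derivative W' t) (at t)" for t
    unfolding W_def W'_def using PX by (auto intro!: derivative_eq_intros simp: field_simps)
  have derN: "(N i has_real_derivative N' i t) (at t)" for i t
    unfolding N_def N'_def using PX by (auto intro!: derivative_eq_intros simp: field_simps)
  have der: "(\<gamma> has_vector_derivative \<gamma>' t) (at t)" if t: "t \<in> {0..1}" for t
    unfolding has_vector_derivative_def
  proof (rule has_derivative_vec)
    fix i :: 3
    have "((\<lambda>t. N i t / W t) has_real_derivative (N' i t * W t - N i t * W' t) / (W t)^2) (at t)"
      using DERIV_divide[OF derN[of i t] derW[of t]] Wpos[OF t] by (simp add: power2_eq_square)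
    moreover have "((\<lambda>t. sinh d / W t) has_real_derivative - sinh d * W' t / (W t)^2) (at t)"
      using DERIV_divide[OF DERIV_const derW[of t], of "sinh d"] Wpos[OF t]
      by (simp add: power2_eq_square)
    ultimately show "((\<lambda>t. \<gamma> t $ i) has_derivative (\<lambda>h. (h *\<^sub>R \<gamma>' t) $ i)) (at t)"
      unfolding \<gamma>_def \<gamma>'_def
      by (auto simp: has_real_derivative_iff_has_vector_derivative has_vector_derivative_def)
  qed
  have contW: "continuous_on {0..1} W" "continuous_on {0..1} W'" for t
    unfolding W_def W'_def using PX by (auto intro!: continuous_intros)
  have contN: "continuous_on {0..1} (N i)" "continuous_on {0..1} (N' i)" for i
    unfolding N_def N'_def using PX by (auto intro!: continuous_intros)
  have "continuous_on {0..1} \<gamma>'"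
  proof -
    have "continuous_on {0..1} (\<lambda>t. if i = 3 then - sinh d * W' t / (W t)^2
      else (N' i t * W t - N i t * W' t) / (W t)^2)" for i :: 3
      using Wpos by (cases "i = 3") (fastforce intro!: continuous_intros contW contN)+
    then show ?thesis unfolding \<gamma>'_def by (rule continuous_on_vec_lambda)
  qed
  then have "\<gamma> C1_differentiable_on {0..1}"
    unfolding C1_differentiable_on_def using der by blast
  then have 1: "valid_path \<gamma>"
    by (simp add: valid_path_def C1_differentiable_imp_piecewise)
  have 2: "path_image \<gamma> \<subseteq> hyp_space"
    using Wpos sd by (auto simp: path_image_def hyp_space_def \<gamma>_def)
  have 3: "pathstart \<gamma> = p" "pathfinish \<gamma> = x"
    using sd PX by (auto simp: pathstart_def pathfinish_def \<gamma>_def W_def N_def vec_eq_iff P_def X_def)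
  have speed: "sqrt (metric_inner hyp_metric (\<gamma> t) (vector_derivative \<gamma> (at t))
      (vector_derivative \<gamma> (at t))) = d" if t: "t \<in> {0..1}" for t
  proof -
    define a b a' b' where "a = sinh (d * (1 - t))" and "b = sinh (d * t)"
      and "a' = cosh (d * (1 - t))" and "b' = cosh (d * t)"
    have dt: "d = d * (1 - t) + d * t" by (simp add: algebra_simps)
    have add: "sinh d = a * b' + a' * b" "cosh d = a' * b' + a * b"
      unfolding a_def b_def a'_def b'_def
      by (subst dt, rule sinh_add cosh_add)+
    have sq: "a'^2 = a^2 + 1" "b'^2 = b^2 + 1"
      unfolding a_def b_def a'_def b'_def by (auto simp: cosh_square_eq)
    have W: "W t = (a * X + b * P) / (P * X)" "W' t = d * (b' * P - a' * X) / (P * X)"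
      unfolding W_def W'_def a_def b_def a'_def b'_def using PX by (auto simp: field_simps)
    have N: "N' i t * W t - N i t * W' t = d * sinh d * (x$i - p$i) / (P * X)" for i
    proof -
      have "N i t = (a * X * p$i + b * P * x$i) / (P * X)"
        "N' i t = d * (b' * P * x$i - a' * X * p$i) / (P * X)"
        unfolding N_def N'_def a_def b_def a'_def b'_def using PX by (auto simp: field_simps)
      then have "N' i t * W t - N i t * W' t =
        (d * (b' * P * x$i - a' * X * p$i) * (a * X + b * P)
          - (a * X * p$i + b * P * x$i) * (d * (b' * P - a' * X))) / ((P * X) * (P * X))"
        unfolding W by (simp add: diff_divide_distrib)
      also have "\<dots> = (d * (a * b' + a' * b) * (x$i - p$i) * (P * X)) / ((P * X) * (P * X))"
        by (simp add: algebra_simps)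
      finally show ?thesis using PX add(1) by simp
    qed
    define q where "q = a * X + b * P"
    have q: "0 < q"
      using Wpos[OF t] mult_pos_pos[OF PX] unfolding W q_def by (simp only: zero_less_divide_iff) auto
    have 4: "\<gamma>' t $ i / \<gamma> t $ 3 = d * (x$i - p$i) / q" if "i \<noteq> 3" for i
    proof -
      have g: "\<gamma>' t $ i = (N' i t * W t - N i t * W' t) / (W t)^2" "\<gamma> t $ 3 = sinh d / W t"
        using that by (simp_all add: \<gamma>'_def \<gamma>_def)
      show ?thesis
        unfolding g unfolding N unfolding W q_def[symmetric] using q PX sd by (simp add: power2_eq_square field_simps)
    qed
    have 5: "\<gamma>' t $ 3 / \<gamma> t $ 3 = d * (a' * X - b' * P) / q"
      unfolding \<gamma>'_def \<gamma>_def using q PX sd unfolding vec_lambda_beta W q_def[symmetric]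
      by (simp add: power2_eq_square field_simps)
    have "metric_inner hyp_metric (\<gamma> t) (\<gamma>' t) (\<gamma>' t)
       = (\<gamma>' t $ 1 / \<gamma> t $ 3)^2 + (\<gamma>' t $ 2 / \<gamma> t $ 3)^2 + (\<gamma>' t $ 3 / \<gamma> t $ 3)^2"
      unfolding metric_inner_hyp inner_vec_def sum_3
      by (simp add: power2_eq_square add_divide_distrib)
    also have "\<dots> = d^2 * ((x$1 - p$1)^2 + (x$2 - p$2)^2 + (a' * X - b' * P)^2) / q^2"
      using 4[of 1] 4[of 2] 5
      by (simp add: power_divide power_mult_distrib add_divide_distrib[symmetric] distrib_left)
    also have "(x$1 - p$1)^2 + (x$2 - p$2)^2 + (a' * X - b' * P)^2
      = (x$1 - p$1)^2 + (x$2 - p$2)^2 + (a^2 + 1) * X^2 + (b^2 + 1) * P^2 - 2 * (a' * b') * P * X"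
      unfolding sq[symmetric] by (simp add: power2_eq_square algebra_simps)
    also have "2 * (a' * b') * P * X = 2 * P * X * hyp_cosh_dist p x - 2 * a * b * P * X"
      using add(2) d(2) by (simp add: algebra_simps)
    also have "2 * P * X * hyp_cosh_dist p x = (p$1)^2 + (p$2)^2 + P^2 + (x$1)^2 + (x$2)^2 + X^2
        - 2 * (p$1 * x$1 + p$2 * x$2)"
      unfolding P_def X_def by (rule hyp_cosh_dist_alt[OF p x])
    also have "(x$1 - p$1)^2 + (x$2 - p$2)^2 + (a^2 + 1) * X^2 + (b^2 + 1) * P^2 -
      ((p$1)^2 + (p$2)^2 + P^2 + (x$1)^2 + (x$2)^2 + X^2 - 2 * (p$1 * x$1 + p$2 * x$2)
        - 2 * a * b * P * X) = q^2"
      unfolding q_def by (simp add: power2_eq_square algebra_simps)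
    finally have "metric_inner hyp_metric (\<gamma> t) (\<gamma>' t) (\<gamma>' t) = d^2" using q by simp
    moreover have "vector_derivative \<gamma> (at t) = \<gamma>' t"
      using der[OF t] by (rule vector_derivative_at)
    ultimately show ?thesis using d(1) by simp
  qed
  have "(hyp_speed \<gamma> has_integral d) {0..1}"
    using speed has_integral_const_real[of d 0 1]
    by (subst has_integral_cong[where g = "\<lambda>_. d"]) auto
  then show ?thesis using 1 2 3 that unfolding d_def by blast
qed

lemma hyp_dist_eq:
  assumes "0 < p$3" "0 < x$3"
  shows "riemannian_dist hyp_space hyp_metric p x = arcosh (hyp_cosh_dist p x)"
proof (cases "p = x")
  case False
  then obtain \<gamma> where g: "valid_path \<gamma>" "path_image \<gamma> \<subseteq> hyp_space" "pathstart \<gamma> = p" "pathfinish \<gamma> = x"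
    "(hyp_speed \<gamma> has_integral arcosh (hyp_cosh_dist p x)) {0..1}"
    using hyp_geodesic[OF assms] by blast
  show ?thesis unfolding riemannian_dist_def
    by (rule cInf_eq_minimum) (use g hyp_length_ge[OF assms False] in blast)+
next
  case True
  have "valid_path (\<lambda>_. p)"
    unfolding valid_path_def
    by (intro C1_differentiable_imp_piecewise) (simp add: C1_differentiable_on_const)
  moreover have "((\<lambda>t. sqrt (metric_inner hyp_metric p (vector_derivative (\<lambda>_. p) (at t))
      (vector_derivative (\<lambda>_. p) (at t)))) has_integral 0) {0..1}"
    by (simp add: metric_inner_hyp)
  ultimately have "\<exists>\<gamma>. valid_path \<gamma> \<and> path_image \<gamma> \<subseteq> hyp_space \<and>
     pathstart \<gamma> = p \<and> pathfinish \<gamma> = x \<and>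
     ((\<lambda>t. sqrt (metric_inner hyp_metric (\<gamma> t) (vector_derivative \<gamma> (at t)) (vector_derivative \<gamma> (at t))))
        has_integral 0) {0..1}"
    using True assms
    by (intro exI[of _ "\<lambda>_. p"]) (auto simp: path_image_def hyp_space_def pathstart_def pathfinish_def)
  moreover have "0 \<le> sqrt (metric_inner hyp_metric y v v)" for y v
    by (simp add: metric_inner_hyp)
  ultimately have "riemannian_dist hyp_space hyp_metric p x = 0"
    unfolding riemannian_dist_def
    by (intro cInf_eq_minimum) (auto intro: has_integral_nonneg)
  then show ?thesis using True by (simp add: hyp_cosh_dist_def)
qed

definition ball_center :: "real^3 \<Rightarrow> real \<Rightarrow> real^3" where
  "ball_center p r = (\<chi> i. if i = 3 then p$3 * cosh r else p$i)"

text \<open>Multiplied by \<open>2 p\<^sub>3 x\<^sub>3\<close>, the condition \<open>hyp_cosh_dist p x \<le> cosh r\<close> is a quadratic inequality with leading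
  part \<open>norm x\<close> squared, hence describes a Euclidean ball; its center lies above the hyperbolic one.\<close>

lemma hyp_geodesic_ball_eq_cball:
  assumes p: "0 < p$3" and r: "0 < r"
  shows "hyp_geodesic_ball p r = cball (ball_center p r) (p$3 * sinh r)"
proof -
  have ps: "0 \<le> p$3 * sinh r" using assms by simp
  have "riemannian_dist hyp_space hyp_metric p x \<le> r \<longleftrightarrow> x \<in> cball (ball_center p r) (p$3 * sinh r)"
    if x: "0 < x$3" for x
  proof -
    have "hyp_cosh_dist p x \<ge> 1" using p x by (simp add: hyp_cosh_dist_def)
    then have "arcosh (hyp_cosh_dist p x) \<le> r \<longleftrightarrow> hyp_cosh_dist p x \<le> cosh r"
      using r arcosh_less_iff_real[of "cosh r" "hyp_cosh_dist p x"]
        \<open>hyp_cosh_dist p x \<ge> 1\<close> cosh_real_ge_1[of r]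
      by (simp add: arcosh_cosh_real not_less[symmetric] del: arcosh_less_iff_real)
    also have "\<dots> \<longleftrightarrow> 2 * p$3 * x$3 * hyp_cosh_dist p x \<le> 2 * p$3 * x$3 * cosh r"
      using p x by simp
    also have "\<dots> \<longleftrightarrow> (norm (x - ball_center p r))^2 \<le> (p$3 * sinh r)^2"
      unfolding hyp_cosh_dist_alt[OF p x] norm_sq_3 power_mult_distrib sinh_square_eq
      by (simp add: ball_center_def power2_eq_square algebra_simps)
    also have "\<dots> \<longleftrightarrow> x \<in> cball (ball_center p r) (p$3 * sinh r)"
      using ps by (simp add: mem_cball dist_norm norm_minus_commute abs_le_square_iff[symmetric])
    finally show ?thesis using hyp_dist_eq[OF p x] by simp
  qed
  moreover have "0 < x$3" if "x \<in> cball (ball_center p r) (p$3 * sinh r)" for x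
  proof -
    have "\<bar>(x - ball_center p r) $ 3\<bar> \<le> p$3 * sinh r"
      using that component_le_norm_cart[of "x - ball_center p r" 3]
      by (simp add: dist_norm norm_minus_commute)
    then have "p$3 * (cosh r - sinh r) \<le> x$3"
      by (auto simp: ball_center_def abs_le_iff algebra_simps)
    moreover have "0 < p$3 * (cosh r - sinh r)"
      using p sinh_less_cosh_real[of r] by simp
    ultimately show ?thesis by linarith
  qed
  ultimately show ?thesis by (auto simp: hyp_geodesic_ball_def hyp_space_def)
qed

section \<open>Invariance of the scalar curvature under coordinate changes\<close>

abbreviation contraction :: "('i::finite \<Rightarrow> 'a::comm_monoid_add) \<Rightarrow> 'a" (binder "\<Oplus>" 10) where
  "contraction f \<equiv> sum f UNIV"

lemma partial_deriv_eqI: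
  "(f has_derivative D) (at x) \<Longrightarrow> partial_deriv i f x = D (axis i 1)"
  unfolding partial_deriv_def using frechet_derivative_at by metis

lemma has_derivative_partial_deriv:
  fixes f :: "real^'n::finite \<Rightarrow> real"
  assumes "f differentiable (at x)"
  shows "(f has_derivative (\<lambda>v. \<Oplus>i. partial_deriv i f x * v$i)) (at x)"
proof -
  have f: "(f has_derivative frechet_derivative f (at x)) (at x)"
    using assms by (simp add: frechet_derivative_works[symmetric])
  interpret linear "frechet_derivative f (at x)"
    by (rule linear_frechet_derivative[OF assms])
  have "frechet_derivative f (at x) v = (\<Oplus>i. partial_deriv i f x * v$i)" for v
  proof -
    have "frechet_derivative f (at x) (\<Oplus>i. v$i *\<^sub>R axis i 1) = (\<Oplus>i. partial_deriv i f x * v$i)"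
      unfolding sum scale partial_deriv_def by (simp add: mult.commute)
    then show ?thesis by (simp only: basis_expansion scalar_mult_eq_scaleR[symmetric])
  qed
  with f show ?thesis by (metis (no_types, lifting) ext)
qed

lemma partial_deriv_cong:
  assumes "open U" "x \<in> U" "\<And>y. y \<in> U \<Longrightarrow> f y = g y"
  shows "partial_deriv i f x = partial_deriv i g x"
proof -
  have "(f has_derivative D) (at x) \<longleftrightarrow> (g has_derivative D) (at x)" for D
    using assms has_derivative_transform_within_open[of f D x UNIV U g]
      has_derivative_transform_within_open[of g D x UNIV U f] by auto
  then show ?thesis by (simp add: partial_deriv_def frechet_derivative_def)
qed

lemma differentiable_cong:
  assumes "open U" "x \<in> U" "\<And>y. y \<in> U \<Longrightarrow> f y = g y" "f differentiable (at x)"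
  shows "g differentiable (at x)"
  using assms has_derivative_transform_within_open[of f _ x UNIV U g]
  unfolding differentiable_def by auto

lemma partial_deriv_add:
  fixes f g :: "real^'n::finite \<Rightarrow> real"
  assumes "f differentiable (at x)" "g differentiable (at x)"
  shows "partial_deriv i (\<lambda>y. f y + g y) x = partial_deriv i f x + partial_deriv i g x"
proof -
  have "((\<lambda>y. f y + g y) has_derivative (\<lambda>v. frechet_derivative f (at x) v +
      frechet_derivative g (at x) v)) (at x)"
    using assms by (intro has_derivative_add) (auto simp: frechet_derivative_works[symmetric])
  from partial_deriv_eqI[OF this] show ?thesis by (simp add: partial_deriv_def)
qed

lemma partial_deriv_mult:
  fixes f g :: "real^'n::finite \<Rightarrow> real"
  assumes "f differentiable (at x)" "g differentiable (at x)"
  shows "partial_deriv i (\<lambda>y. f y * g y) x = partial_deriv i f x * g x + f x * partial_deriv i g x"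
proof -
  have "((\<lambda>y. f y * g y) has_derivative (\<lambda>v. f x * frechet_derivative g (at x) v +
      frechet_derivative f (at x) v * g x)) (at x)"
    using assms by (intro has_derivative_mult) (auto simp: frechet_derivative_works[symmetric])
  from partial_deriv_eqI[OF this] show ?thesis by (simp add: partial_deriv_def)
qed

lemma partial_deriv_sum:
  fixes f :: "'a \<Rightarrow> real^'n::finite \<Rightarrow> real"
  assumes "finite A" "\<And>a. a \<in> A \<Longrightarrow> f a differentiable (at x)"
  shows "partial_deriv i (\<lambda>y. \<Sum>a\<in>A. f a y) x = (\<Sum>a\<in>A. partial_deriv i (f a) x)"
proof -
  have "((\<lambda>y. \<Sum>a\<in>A. f a y) has_derivative (\<lambda>v. \<Sum>a\<in>A. frechet_derivative (f a) (at x) v)) (at x)"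
    using assms by (intro has_derivative_sum) (auto simp: frechet_derivative_works[symmetric])
  from partial_deriv_eqI[OF this] show ?thesis by (simp add: partial_deriv_def)
qed

lemma differentiable_sum_UNIV:
  fixes f :: "'a::finite \<Rightarrow> 'b::real_normed_vector \<Rightarrow> real"
  assumes "\<And>a. f a differentiable (at x)"
  shows "(\<lambda>y. \<Oplus>a. f a y) differentiable (at x)"
  using assms by (intro differentiable_sum) auto

lemma matrix_inv_right_left:
  fixes A :: "real^'n::finite^'n"
  shows "invertible A \<Longrightarrow> A ** matrix_inv A = mat 1 \<and> matrix_inv A ** A = mat 1"
proof -
  assume "invertible A"
  then have "\<exists>A'. A ** A' = mat 1 \<and> A' ** A = mat 1" by (simp add: invertible_def)
  from someI_ex[OF this] show "A ** matrix_inv A = mat 1 \<and> matrix_inv A ** A = mat 1"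
    by (simp add: matrix_inv_def)
qed

lemmas matrix_inv_right = matrix_inv_right_left[THEN conjunct1]
  and matrix_inv_left = matrix_inv_right_left[THEN conjunct2]

lemma matrix_inv_unique:
  fixes A B :: "real^'n::finite^'n"
  assumes "A ** B = mat 1" "B ** A = mat 1"
  shows "matrix_inv A = B"
proof -
  have "invertible A" using assms by (auto simp: invertible_def)
  then have "matrix_inv A ** (A ** B) = B"
    by (simp add: matrix_mul_assoc matrix_inv_left)
  then show ?thesis by (simp add: assms)
qed

definition christoffel_first :: "'n::finite metric_field \<Rightarrow> 'n \<Rightarrow> 'n \<Rightarrow> 'n \<Rightarrow> real^'n \<Rightarrow> real" where
  "christoffel_first g l i j x = (1/2) * (partial_deriv i (\<lambda>y. g y $ j $ l) x
     + partial_deriv j (\<lambda>y. g y $ i $ l) x - partial_deriv l (\<lambda>y. g y $ i $ j) x)"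

lemma christoffel_eq_raise:
  "christoffel g k i j x = (\<Oplus>l. matrix_inv (g x) $ k $ l * christoffel_first g l i j x)"
  unfolding christoffel_def christoffel_first_def by (simp add: sum_distrib_left algebra_simps)

lemma sum3_rotate:
  fixes f :: "'a::finite \<Rightarrow> 'a \<Rightarrow> 'a \<Rightarrow> 'b::comm_monoid_add"
  shows "(\<Oplus>a b c. f a b c) = (\<Oplus>a b c. f c a b)"
proof -
  have "(\<Oplus>a b c. f c a b) = (\<Oplus>a c b. f c a b)"
    by (intro sum.cong refl sum.swap)
  also have "\<dots> = (\<Oplus>c a b. f c a b)"
    by (rule sum.swap)
  finally show ?thesis by simp
qed

text \<open>A local diffeomorphism together with its Jacobian \<open>J\<close>, the inverse Jacobian \<open>K\<close> and its
  second and third derivatives \<open>H\<close> and \<open>T\<close>: \<open>H a i j\<close> is \<open>\<partial>\<^sub>i\<partial>\<^sub>j \<Phi>\<^sup>a\<close>. The symmetry of mixed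
  derivatives is part of the data; for an explicit map it is visible from the formulas.\<close>

locale coordinate_change =
  fixes U :: "(real^'n::finite) set" and \<Phi> :: "real^'n \<Rightarrow> real^'n"
    and J K :: "real^'n \<Rightarrow> real^'n^'n"
    and H :: "'n \<Rightarrow> 'n \<Rightarrow> 'n \<Rightarrow> real^'n \<Rightarrow> real"
    and T :: "'n \<Rightarrow> 'n \<Rightarrow> 'n \<Rightarrow> 'n \<Rightarrow> real^'n \<Rightarrow> real"
  assumes open_U: "open U"
    and deriv_\<Phi>: "x \<in> U \<Longrightarrow> (\<Phi> has_derivative (*v) (J x)) (at x)"
    and deriv_J: "x \<in> U \<Longrightarrow> ((\<lambda>y. J y $ a $ i) has_derivative (\<lambda>v. \<Oplus>j. H a i j x * v$j)) (at x)"
    and deriv_H: "x \<in> U \<Longrightarrow> (H a i j has_derivative (\<lambda>v. \<Oplus>k. T a i j k x * v$k)) (at x)"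
    and H_sym: "x \<in> U \<Longrightarrow> H a i j x = H a j i x"
    and T_sym: "x \<in> U \<Longrightarrow> T a j k i x = T a i k j x"
    and K_J: "x \<in> U \<Longrightarrow> K x ** J x = mat 1"
    and diff_K: "x \<in> U \<Longrightarrow> (\<lambda>y. K y $ i $ a) differentiable (at x)"
begin

definition pullback :: "'n metric_field \<Rightarrow> 'n metric_field" where
  "pullback g x = transpose (J x) ** g (\<Phi> x) ** J x"

lemma sum_axis: "(\<Oplus>j. f j * axis i 1 $ j) = (f i :: real)"
  by (simp add: axis_def if_distrib cong: if_cong)

lemma partial_J: "x \<in> U \<Longrightarrow> partial_deriv j (\<lambda>y. J y $ a $ i) x = H a i j x"
  using partial_deriv_eqI[OF deriv_J] by (simp add: sum_axis)

lemma partial_H: "x \<in> U \<Longrightarrow> partial_deriv k (H a i j) x = T a i j k x"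
  using partial_deriv_eqI[OF deriv_H] by (simp add: sum_axis)

lemma diff_J: "x \<in> U \<Longrightarrow> (\<lambda>y. J y $ a $ i) differentiable (at x)"
  and diff_H: "x \<in> U \<Longrightarrow> H a i j differentiable (at x)"
  using deriv_J deriv_H by (blast intro: differentiableI)+

lemma J_K: "x \<in> U \<Longrightarrow> J x ** K x = mat 1"
  using K_J matrix_left_right_inverse by blast

lemma chain_rule:
  assumes "x \<in> U" "f differentiable (at (\<Phi> x))"
  shows "partial_deriv i (\<lambda>y. f (\<Phi> y)) x = (\<Oplus>a. partial_deriv a f (\<Phi> x) * J x $ a $ i)"
    and "(\<lambda>y. f (\<Phi> y)) differentiable (at x)"
proof -
  have d: "((\<lambda>y. f (\<Phi> y)) has_derivative (\<lambda>v. \<Oplus>a. partial_deriv a f (\<Phi> x) * (J x *v v)$a)) (at x)"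
    by (rule has_derivative_compose[OF deriv_\<Phi>[OF assms(1)] has_derivative_partial_deriv[OF assms(2)]])
  then show "(\<lambda>y. f (\<Phi> y)) differentiable (at x)" by (rule differentiableI)
  show "partial_deriv i (\<lambda>y. f (\<Phi> y)) x = (\<Oplus>a. partial_deriv a f (\<Phi> x) * J x $ a $ i)"
    unfolding partial_deriv_eqI[OF d] by (simp add: matrix_vector_mult_def sum_axis)
qed

lemma pullback_component:
  "pullback g x $ i $ j = (\<Oplus>a b. g (\<Phi> x) $ a $ b * (J x $ a $ i * J x $ b $ j))"
  unfolding pullback_def matrix_matrix_mult_def transpose_def
  by (simp add: sum_distrib_right) (subst sum.swap, simp add: mult_ac)

context
  fixes g :: "'n metric_field"
  assumes g_diff: "y \<in> \<Phi> ` U \<Longrightarrow> (\<lambda>y. g y $ a $ b) differentiable (at y)"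
    and g_sym: "y \<in> \<Phi> ` U \<Longrightarrow> g y $ a $ b = g y $ b $ a"
    and g_inv: "y \<in> \<Phi> ` U \<Longrightarrow> invertible (g y)"
    and chr_diff: "y \<in> \<Phi> ` U \<Longrightarrow> christoffel g c a b differentiable (at y)"
begin

lemma partial_pullback:
  assumes x: "x \<in> U"
  shows "partial_deriv k (\<lambda>y. pullback g y $ i $ j) x =
    (\<Oplus>a b c. partial_deriv c (\<lambda>y. g y $ a $ b) (\<Phi> x) * (J x $ a $ i * J x $ b $ j * J x $ c $ k))
    + (\<Oplus>a b. g (\<Phi> x) $ a $ b * (H a i k x * J x $ b $ j))
    + (\<Oplus>a b. g (\<Phi> x) $ a $ b * (J x $ a $ i * H b j k x))"
proof -
  have gd: "(\<lambda>y. g y $ a $ b) differentiable (at (\<Phi> x))" for a b using x g_diff by blast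
  note d = diff_J[OF x] chain_rule(2)[OF x gd]
  have "partial_deriv k (\<lambda>y. g (\<Phi> y) $ a $ b * (J y $ a $ i * J y $ b $ j)) x =
     (\<Oplus>c. partial_deriv c (\<lambda>y. g y $ a $ b) (\<Phi> x) * (J x $ a $ i * J x $ b $ j * J x $ c $ k))
     + g (\<Phi> x) $ a $ b * (H a i k x * J x $ b $ j) + g (\<Phi> x) $ a $ b * (J x $ a $ i * H b j k x)" for a b
    by (simp add: partial_deriv_mult d differentiable_mult chain_rule(1)[OF x gd] partial_J[OF x]
        sum_distrib_left distrib_left mult_ac)
  then show ?thesis
    unfolding pullback_component
    by (simp add: partial_deriv_sum differentiable_sum_UNIV d differentiable_mult sum.distrib)
qed

text \<open>Of the six terms in which a derivative falls on the Jacobian, four cancel because \<open>H\<close>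
  is symmetric, and the two others are equal.\<close>

lemma christoffel_first_pullback:
  assumes x: "x \<in> U"
  shows "christoffel_first (pullback g) l i j x =
    (\<Oplus>a. J x $ a $ l * ((\<Oplus>b d. christoffel_first g a b d (\<Phi> x) * (J x $ b $ i * J x $ d $ j))
      + (\<Oplus>b. g (\<Phi> x) $ a $ b * H b i j x)))"
proof -
  define D where "D = (\<lambda>i j k. \<Oplus>a b c. partial_deriv c (\<lambda>y. g y $ a $ b) (\<Phi> x)
    * (J x $ a $ i * J x $ b $ j * J x $ c $ k))"
  define E where "E = (\<lambda>i j k. \<Oplus>a b. g (\<Phi> x) $ a $ b * (J x $ a $ i * H b j k x))"
  have gs: "g (\<Phi> x) $ a $ b = g (\<Phi> x) $ b $ a" for a b using x g_sym by blast
  have E': "(\<Oplus>a b. g (\<Phi> x) $ a $ b * (H a i k x * J x $ b $ j)) = E j i k" for i j k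
    unfolding E_def by (subst sum.swap) (intro sum.cong refl, subst gs, simp add: mult.commute)
  have P: "partial_deriv k (\<lambda>y. pullback g y $ i $ j) x = D i j k + E j i k + E i j k" for i j k
    unfolding partial_pullback[OF x] E' by (simp add: D_def E_def)
  have E_sym: "E i j k = E i k j" for i j k
    unfolding E_def using H_sym[OF x] by simp
  have "christoffel_first (pullback g) l i j x = (1/2) * (D j l i + D i l j - D i j l) + E l i j"
    unfolding christoffel_first_def P using E_sym by (simp add: field_simps)
  also have "D j l i = (\<Oplus>a b d. partial_deriv b (\<lambda>y. g y $ d $ a) (\<Phi> x)
    * (J x $ a $ l * J x $ b $ i * J x $ d $ j))"
    unfolding D_def by (subst sum3_rotate) (simp add: mult_ac)
  also have "D i l j = (\<Oplus>a b d. partial_deriv d (\<lambda>y. g y $ b $ a) (\<Phi> x)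
    * (J x $ a $ l * J x $ b $ i * J x $ d $ j))"
    unfolding D_def by (subst sum.swap) (simp add: mult_ac)
  also have "D i j l = (\<Oplus>a b d. partial_deriv a (\<lambda>y. g y $ b $ d) (\<Phi> x)
    * (J x $ a $ l * J x $ b $ i * J x $ d $ j))"
    unfolding D_def by (subst (2) sum3_rotate, subst sum3_rotate, subst sum3_rotate, subst sum3_rotate) (simp add: mult_ac)
  also have "E l i j = (\<Oplus>a. J x $ a $ l * (\<Oplus>b. g (\<Phi> x) $ a $ b * H b i j x))"
    unfolding E_def by (simp add: sum_distrib_left mult_ac)
  finally show ?thesis
    unfolding christoffel_first_def
    by (simp add: sum_distrib_left sum.distrib[symmetric] sum_subtractf[symmetric] algebra_simps)
qed

lemma pullback_inv:
  assumes x: "x \<in> U"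
  shows "matrix_inv (pullback g x) = K x ** matrix_inv (g (\<Phi> x)) ** transpose (K x)"
proof (rule matrix_inv_unique)
  have gi: "g (\<Phi> x) ** matrix_inv (g (\<Phi> x)) = mat 1" "matrix_inv (g (\<Phi> x)) ** g (\<Phi> x) = mat 1"
    using g_inv x by (auto simp: matrix_inv_right matrix_inv_left)
  have t: "transpose (J x) ** transpose (K x) = mat 1" "transpose (K x) ** transpose (J x) = mat 1"
    using K_J[OF x] J_K[OF x] by (metis matrix_transpose_mul transpose_mat)+
  have "pullback g x ** (K x ** matrix_inv (g (\<Phi> x)) ** transpose (K x))
     = transpose (J x) ** (g (\<Phi> x) ** ((J x ** K x) ** matrix_inv (g (\<Phi> x)))) ** transpose (K x)"
    unfolding pullback_def by (simp add: matrix_mul_assoc)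
  then show "pullback g x ** (K x ** matrix_inv (g (\<Phi> x)) ** transpose (K x)) = mat 1"
    by (simp add: J_K[OF x] gi t)
  have "K x ** matrix_inv (g (\<Phi> x)) ** transpose (K x) ** pullback g x
     = K x ** (matrix_inv (g (\<Phi> x)) ** ((transpose (K x) ** transpose (J x)) ** g (\<Phi> x))) ** J x"
    unfolding pullback_def by (simp add: matrix_mul_assoc)
  then show "K x ** matrix_inv (g (\<Phi> x)) ** transpose (K x) ** pullback g x = mat 1"
    by (simp add: K_J[OF x] gi t)
qed

text \<open>The transformation law of a connection. It has the Jacobian on the left-hand side, so that
  it can be differentiated without differentiating an inverse matrix.\<close>

lemma christoffel_pullback:
  assumes x: "x \<in> U"
  shows "(\<Oplus>k. J x $ c $ k * christoffel (pullback g) k i j x) =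
    (\<Oplus>b d. christoffel g c b d (\<Phi> x) * (J x $ b $ i * J x $ d $ j)) + H c i j x"
proof -
  define w where "w = (\<chi> a. (\<Oplus>b d. christoffel_first g a b d (\<Phi> x) * (J x $ b $ i * J x $ d $ j))
      + (\<Oplus>b. g (\<Phi> x) $ a $ b * H b i j x))"
  define h where "h = (\<chi> b. H b i j x)"
  have t: "transpose (K x) ** transpose (J x) = mat 1"
    using J_K[OF x] by (metis matrix_transpose_mul transpose_mat)
  have "(\<chi> l. christoffel_first (pullback g) l i j x) = transpose (J x) *v w"
    unfolding christoffel_first_pullback[OF x] w_def matrix_vector_mult_def transpose_def
    by (simp add: vec_eq_iff)
  moreover have "(\<chi> k. christoffel (pullback g) k i j x) =
      matrix_inv (pullback g x) *v (\<chi> l. christoffel_first (pullback g) l i j x)"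
    unfolding christoffel_eq_raise matrix_vector_mult_def by (simp add: vec_eq_iff)
  ultimately have "J x *v (\<chi> k. christoffel (pullback g) k i j x) =
      J x *v ((K x ** matrix_inv (g (\<Phi> x)) ** transpose (K x)) *v (transpose (J x) *v w))"
    by (simp add: pullback_inv[OF x])
  also have "\<dots> = ((J x ** K x) ** matrix_inv (g (\<Phi> x)) ** (transpose (K x) ** transpose (J x))) *v w"
    by (simp only: matrix_vector_mul_assoc matrix_mul_assoc)
  also have "\<dots> = matrix_inv (g (\<Phi> x)) *v w"
    by (simp add: J_K[OF x] t)
  also have "w = (\<chi> a. \<Oplus>b d. christoffel_first g a b d (\<Phi> x) * (J x $ b $ i * J x $ d $ j))
      + g (\<Phi> x) *v h"
    unfolding w_def h_def matrix_vector_mult_def by (simp add: vec_eq_iff)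
  also have "matrix_inv (g (\<Phi> x)) *v \<dots> = matrix_inv (g (\<Phi> x)) *v (\<chi> a. \<Oplus>b d. 
      christoffel_first g a b d (\<Phi> x) * (J x $ b $ i * J x $ d $ j)) + h"
    using g_inv x by (simp add: matrix_vector_right_distrib matrix_vector_mul_assoc matrix_inv_left)
  finally have "(J x *v (\<chi> k. christoffel (pullback g) k i j x)) $ c = (matrix_inv (g (\<Phi> x)) *v
     (\<chi> a. \<Oplus>b d. christoffel_first g a b d (\<Phi> x) * (J x $ b $ i * J x $ d $ j)) + h) $ c"
    by (rule arg_cong)
  moreover have "(\<Oplus>a. matrix_inv (g (\<Phi> x)) $ c $ a * (\<Oplus>b d. 
        christoffel_first g a b d (\<Phi> x) * (J x $ b $ i * J x $ d $ j)))
    = (\<Oplus>b d. christoffel g c b d (\<Phi> x) * (J x $ b $ i * J x $ d $ j))"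
    unfolding christoffel_eq_raise sum_distrib_left sum_distrib_right
    by (subst sum3_rotate) (simp add: mult_ac)
  ultimately show ?thesis
    by (simp add: matrix_vector_mult_def h_def)
qed

lemma christoffel_pullback_diff:
  assumes x: "x \<in> U"
  shows "christoffel (pullback g) m i j differentiable (at x)"
proof -
  define w where "w = (\<lambda>c y. (\<Oplus>b d. christoffel g c b d (\<Phi> y) * (J y $ b $ i * J y $ d $ j)) + H c i j y)"
  have eq: "christoffel (pullback g) m i j y = (\<Oplus>c. K y $ m $ c * w c y)" if y: "y \<in> U" for y
  proof -
    have "(\<chi> k. christoffel (pullback g) k i j y) = K y *v (J y *v (\<chi> k. christoffel (pullback g) k i j y))"
      by (simp add: matrix_vector_mul_assoc K_J[OF y])
    also have "J y *v (\<chi> k. christoffel (pullback g) k i j y) = (\<chi> c. w c y)"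
      unfolding matrix_vector_mult_def w_def using christoffel_pullback[OF y] by (simp add: vec_eq_iff)
    finally show ?thesis by (simp add: vec_eq_iff matrix_vector_mult_def)
  qed
  have d: "(\<lambda>y. \<Oplus>c. K y $ m $ c * w c y) differentiable (at x)"
    unfolding w_def using x
    by (intro differentiable_sum_UNIV differentiable_mult differentiable_add diff_K diff_J diff_H
        chain_rule(2) chr_diff) auto
  show ?thesis
    by (rule differentiable_cong[OF open_U x _ d]) (rule eq[symmetric])
qed

text \<open>Differentiate the transformation law of the Christoffel symbols. Every term that contains
  \<open>H\<close> or \<open>T\<close> is symmetric in \<open>i\<close> and \<open>j\<close> or cancels against the quadratic terms of the curvature;
  the symmetric rest is collected in \<open>S\<close>, and only the tensorial part survives
  antisymmetrization.\<close>

lemma riemann_pullback: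
  assumes x: "x \<in> U"
  shows "(\<Oplus>m. J x $ c $ m * riemann (pullback g) m i j k x) =
    (\<Oplus>a b d. riemann g c a b d (\<Phi> x) * (J x $ a $ i * J x $ b $ j * J x $ d $ k))"
proof -
  define G where "G = (\<lambda>c b d. christoffel g c b d (\<Phi> x))"
  define dG where "dG = (\<lambda>a c b d. partial_deriv a (christoffel g c b d) (\<Phi> x))"
  define G' where "G' = (\<lambda>m i j. christoffel (pullback g) m i j x)"
  define dG' where "dG' = (\<lambda>l m i j. partial_deriv l (christoffel (pullback g) m i j) x)"
  define P where "P = (\<lambda>a b d. dG a c b d + (\<Oplus>e. G c a e * G e b d))"
  define Jx where "Jx = J x"
  have chr: "christoffel g c b d differentiable (at (\<Phi> x))" for c b d using x chr_diff by blast
  note d = diff_J[OF x] chain_rule(2)[OF x chr] diff_H[OF x] christoffel_pullback_diff[OF x]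
  have J_G': "(\<Oplus>m. Jx $ e $ m * G' m j k) =
     (\<Oplus>b d. G e b d * (Jx $ b $ j * Jx $ d $ k)) + H e j k x" for e j k
    using christoffel_pullback[OF x] by (simp add: G_def G'_def Jx_def)
  \<comment> \<open>\<open>A i j - A j i\<close> is the curvature of the pullback, pushed forward by the Jacobian.\<close>
  define A where "A = (\<lambda>i j. \<Oplus>m. Jx $ c $ m * (dG' i m j k + (\<Oplus>n. G' m i n * G' n j k)))"
  define S where "S = (\<lambda>i j. (\<Oplus>b d. G c b d * (H b j i x * Jx $ d $ k))
      + (\<Oplus>b d. G c b d * (Jx $ b $ j * H d k i x))
      + (\<Oplus>b d. G c b d * (Jx $ b $ i * H d k j x)) + T c j k i x)"
  have A: "A i j = (\<Oplus>a b d. P a b d * (Jx $ a $ i * Jx $ b $ j * Jx $ d $ k)) + S i j" for i j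
  proof -
    have "partial_deriv i (\<lambda>y. \<Oplus>m. J y $ c $ m * christoffel (pullback g) m j k y) x =
       partial_deriv i (\<lambda>y. (\<Oplus>b d. christoffel g c b d (\<Phi> y) * (J y $ b $ j * J y $ d $ k)) + H c j k y) x"
      by (rule partial_deriv_cong[OF open_U x christoffel_pullback])
    moreover have "partial_deriv i (\<lambda>y. \<Oplus>m. J y $ c $ m * christoffel (pullback g) m j k y) x =
       (\<Oplus>m. H c m i x * G' m j k) + (\<Oplus>m. Jx $ c $ m * dG' i m j k)"
      by (simp add: partial_deriv_sum partial_deriv_mult d differentiable_mult partial_J[OF x] sum.distrib
          G'_def dG'_def Jx_def)
    moreover have "partial_deriv i (\<lambda>y. (\<Oplus>b d. christoffel g c b d (\<Phi> y) * (J y $ b $ j * J y $ d $ k)) + H c j k y) x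
      = (\<Oplus>b d. (\<Oplus>a. dG a c b d * Jx $ a $ i) * (Jx $ b $ j * Jx $ d $ k))
        + (\<Oplus>b d. G c b d * (H b j i x * Jx $ d $ k))
        + (\<Oplus>b d. G c b d * (Jx $ b $ j * H d k i x)) + T c j k i x"
      by (simp add: partial_deriv_add partial_deriv_sum partial_deriv_mult d differentiable_mult differentiable_sum_UNIV
          partial_J[OF x] partial_H[OF x] chain_rule(1)[OF x chr] sum.distrib distrib_left G_def dG_def Jx_def add.assoc)
    ultimately have 1: "(\<Oplus>m. Jx $ c $ m * dG' i m j k) =
      (\<Oplus>b d. (\<Oplus>a. dG a c b d * Jx $ a $ i) * (Jx $ b $ j * Jx $ d $ k))
        + (\<Oplus>b d. G c b d * (H b j i x * Jx $ d $ k))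
        + (\<Oplus>b d. G c b d * (Jx $ b $ j * H d k i x)) + T c j k i x
        - (\<Oplus>m. H c m i x * G' m j k)" by linarith
    have "(\<Oplus>m. Jx $ c $ m * (\<Oplus>n. G' m i n * G' n j k)) =
      (\<Oplus>n. (\<Oplus>m. Jx $ c $ m * G' m i n) * G' n j k)"
      unfolding sum_distrib_left sum_distrib_right by (subst sum.swap) (simp add: mult_ac)
    also have "\<dots> = (\<Oplus>n. (\<Oplus>a e. G c a e * (Jx $ a $ i * Jx $ e $ n)) * G' n j k)
       + (\<Oplus>n. H c i n x * G' n j k)"
      unfolding J_G' by (simp add: distrib_right sum.distrib)
    also have "(\<Oplus>n. (\<Oplus>a e. G c a e * (Jx $ a $ i * Jx $ e $ n)) * G' n j k)
       = (\<Oplus>a e. G c a e * Jx $ a $ i * (\<Oplus>n. Jx $ e $ n * G' n j k))"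
      unfolding sum_distrib_left sum_distrib_right
      by (subst sum3_rotate) (simp add: mult_ac)
    also have "\<dots> = (\<Oplus>a e. G c a e * Jx $ a $ i * (\<Oplus>b d. G e b d * (Jx $ b $ j * Jx $ d $ k)))
       + (\<Oplus>a e. G c a e * (Jx $ a $ i * H e j k x))"
      unfolding J_G' by (simp add: distrib_left sum.distrib mult.assoc)
    also have "(\<Oplus>a e. G c a e * Jx $ a $ i * (\<Oplus>b d. G e b d * (Jx $ b $ j * Jx $ d $ k)))
       = (\<Oplus>a b d. (\<Oplus>e. G c a e * G e b d) * (Jx $ a $ i * Jx $ b $ j * Jx $ d $ k))"
      unfolding sum_distrib_left sum_distrib_right
      by (rule sum.cong[OF refl], subst sum3_rotate) (simp add: mult_ac)
    finally have 2: "(\<Oplus>m. Jx $ c $ m * (\<Oplus>n. G' m i n * G' n j k)) =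
      (\<Oplus>a b d. (\<Oplus>e. G c a e * G e b d) * (Jx $ a $ i * Jx $ b $ j * Jx $ d $ k))
      + (\<Oplus>a e. G c a e * (Jx $ a $ i * H e j k x)) + (\<Oplus>n. H c i n x * G' n j k)" .
    have 3: "(\<Oplus>b d. (\<Oplus>a. dG a c b d * Jx $ a $ i) * (Jx $ b $ j * Jx $ d $ k))
       = (\<Oplus>a b d. dG a c b d * (Jx $ a $ i * Jx $ b $ j * Jx $ d $ k))"
      unfolding sum_distrib_right by (subst (2) sum3_rotate, subst sum3_rotate, subst sum3_rotate) (simp add: mult_ac)
    have 4: "(\<Oplus>a e. G c a e * (Jx $ a $ i * H e j k x)) = (\<Oplus>b d. G c b d * (Jx $ b $ i * H d k j x))"
      using H_sym[OF x, of _ j k] by simp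
    have 5: "(\<Oplus>n. H c i n x * G' n j k) = (\<Oplus>m. H c m i x * G' m j k)"
      using H_sym[OF x, of c i] by simp
    show ?thesis
      unfolding A_def S_def P_def distrib_left distrib_right sum.distrib 1 2 3 4 5 by simp
  qed
  have S_sym: "S i j = S j i"
    unfolding S_def using H_sym[OF x, of _ i j] T_sym[OF x, of c j k i] by simp
  have "(\<Oplus>m. J x $ c $ m * riemann (pullback g) m i j k x) = A i j - A j i"
    unfolding riemann_def A_def G'_def dG'_def Jx_def
    by (simp add: sum_subtractf sum.distrib algebra_simps)
  also have "\<dots> = (\<Oplus>a b d. P a b d * (Jx $ a $ i * Jx $ b $ j * Jx $ d $ k))
     - (\<Oplus>a b d. P a b d * (Jx $ a $ j * Jx $ b $ i * Jx $ d $ k))"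
    unfolding A using S_sym by simp
  also have "(\<Oplus>a b d. P a b d * (Jx $ a $ j * Jx $ b $ i * Jx $ d $ k))
     = (\<Oplus>a b d. P b a d * (Jx $ a $ i * Jx $ b $ j * Jx $ d $ k))"
    by (subst sum.swap) (simp add: mult_ac)
  also have "(\<Oplus>a b d. P a b d * (Jx $ a $ i * Jx $ b $ j * Jx $ d $ k)) - \<dots>
     = (\<Oplus>a b d. (\<lambda>a b d. P a b d - P b a d) a b d * (Jx $ a $ i * Jx $ b $ j * Jx $ d $ k))"
    by (simp add: sum_subtractf left_diff_distrib)
  also have "(\<lambda>a b d. P a b d - P b a d) = (\<lambda>a b d. riemann g c a b d (\<Phi> x))"
    unfolding P_def riemann_def G_def dG_def by (simp add: sum_subtractf algebra_simps)
  finally show ?thesis by (simp add: Jx_def)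
qed

text \<open>The Ricci tensor is a trace, and the endomorphisms of which it is the trace are conjugate
  by the Jacobian.\<close>

lemma ricci_pullback:
  assumes x: "x \<in> U"
  shows "ricci (pullback g) j k x =
    (\<Oplus>b d. ricci g b d (\<Phi> x) * (J x $ b $ j * J x $ d $ k))"
proof -
  define M :: "real^'n^'n" where "M = (\<chi> m i. riemann (pullback g) m i j k x)"
  define N :: "real^'n^'n" where "N = (\<chi> c a. \<Oplus>b d. riemann g c a b d (\<Phi> x) * (J x $ b $ j * J x $ d $ k))"
  have "J x ** M = N ** J x"
    unfolding matrix_matrix_mult_def M_def N_def using riemann_pullback[OF x, of _ _ j k]
    by (simp add: vec_eq_iff sum_distrib_left sum_distrib_right mult_ac)
  then have "trace M = trace (K x ** (N ** J x))"
    by (metis K_J[OF x] matrix_mul_assoc matrix_mul_lid)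
  also have "\<dots> = trace (N ** (J x ** K x))"
    using trace_mul_sym[of "K x" "N ** J x"] by (simp add: matrix_mul_assoc)
  finally have "trace M = trace N" by (simp add: J_K[OF x])
  moreover have "trace M = ricci (pullback g) j k x" by (simp add: trace_def M_def ricci_def)
  moreover have "trace N = (\<Oplus>b d. ricci g b d (\<Phi> x) * (J x $ b $ j * J x $ d $ k))"
    unfolding trace_def N_def ricci_def sum_distrib_right
    by simp (rule sum3_rotate)
  ultimately show ?thesis by simp
qed

theorem scalar_curvature_pullback:
  assumes x: "x \<in> U"
  shows "scalar_curvature (pullback g) x = scalar_curvature g (\<Phi> x)"
proof -
  define R :: "real^'n^'n" where "R = (\<chi> d b. ricci g b d (\<Phi> x))"
  define R' :: "real^'n^'n" where "R' = (\<chi> k j. ricci (pullback g) j k x)"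
  have sc: "scalar_curvature h y = trace (matrix_inv (h y) ** (\<chi> k j. ricci h j k y))" for h y
    by (simp add: scalar_curvature_def trace_def matrix_matrix_mult_def)
  have R': "R' = transpose (J x) ** R ** J x"
    unfolding R'_def R_def ricci_pullback[OF x] matrix_matrix_mult_def transpose_def
    by (simp add: vec_eq_iff sum_distrib_left sum_distrib_right mult_ac)
  have t: "transpose (K x) ** transpose (J x) = mat 1"
    using J_K[OF x] by (metis matrix_transpose_mul transpose_mat)
  have "matrix_inv (pullback g x) ** R' =
     K x ** (matrix_inv (g (\<Phi> x)) ** ((transpose (K x) ** transpose (J x)) ** R) ** J x)"
    unfolding pullback_inv[OF x] R' by (simp add: matrix_mul_assoc)
  then have "trace (matrix_inv (pullback g x) ** R') = trace (matrix_inv (g (\<Phi> x)) ** R ** J x ** K x)"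
    using trace_mul_sym[of "K x" "matrix_inv (g (\<Phi> x)) ** R ** J x"] by (simp add: t)
  also have "\<dots> = trace (matrix_inv (g (\<Phi> x)) ** R)"
    by (simp add: J_K[OF x] matrix_mul_assoc[symmetric])
  finally show ?thesis by (simp add: sc R_def R'_def)
qed

end

end

section \<open>Curvature of rotationally symmetric metrics and of the hyperbolic metric\<close>

lemma differentiable_vec_nth [simp]: "(\<lambda>y::real^'n::finite. y $ i) differentiable (at x)"
  by (intro bounded_linear_imp_differentiable bounded_linear_vec_nth)

lemma partial_deriv_vec_nth [simp]: "partial_deriv l (\<lambda>y::real^'n::finite. y $ i) x = (if i = l then 1 else 0)"
  using partial_deriv_eqI[OF bounded_linear_imp_has_derivative[OF bounded_linear_vec_nth], of l i x]
  by (auto simp: axis_def)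

lemma partial_deriv_const [simp]: "partial_deriv l (\<lambda>y::real^'n::finite. c) x = 0"
  by (rule partial_deriv_eqI) simp

lemma partial_deriv_uminus:
  fixes f :: "real^'n::finite \<Rightarrow> real"
  shows "f differentiable (at x) \<Longrightarrow> partial_deriv l (\<lambda>y. - f y) x = - partial_deriv l f x"
  using partial_deriv_mult[of "\<lambda>_. -1" x f l] by simp

definition axis_dist2 :: "real^3 \<Rightarrow> real" where
  "axis_dist2 x = (x$1)^2 + (x$2)^2"

lemma has_derivative_axis_dist2:
  "(axis_dist2 has_derivative (\<lambda>v. 2 * (x$1 * v$1 + x$2 * v$2))) (at x)"
  unfolding axis_dist2_def[abs_def]
  by (auto intro!: derivative_eq_intros simp: fun_eq_iff algebra_simps power2_eq_square)

lemma radial_deriv: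
  assumes "(h has_real_derivative h') (at (axis_dist2 x))"
  shows "(\<lambda>y. h (axis_dist2 y)) differentiable (at x)"
    and "partial_deriv l (\<lambda>y. h (axis_dist2 y)) x = (if l = 3 then 0 else 2 * x$l * h')"
proof -
  have d: "((\<lambda>y. h (axis_dist2 y)) has_derivative (\<lambda>v. h' * (2 * (x$1 * v$1 + x$2 * v$2)))) (at x)"
    using has_derivative_compose[OF has_derivative_axis_dist2 assms[unfolded has_field_derivative_def]] .
  then show "(\<lambda>y. h (axis_dist2 y)) differentiable (at x)" by (rule differentiableI)
  show "partial_deriv l (\<lambda>y. h (axis_dist2 y)) x = (if l = 3 then 0 else 2 * x$l * h')"
    unfolding partial_deriv_eqI[OF d] using exhaust_3[of l] by (auto simp: axis_def)
qed

lemma axial_deriv: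
  fixes x :: "real^3"
  assumes "(h has_real_derivative h') (at (x$3))"
  shows "(\<lambda>y. h (y$3)) differentiable (at x)"
    and "partial_deriv l (\<lambda>y. h (y$3)) x = (if l = 3 then h' else 0)"
proof -
  have d: "((\<lambda>y::real^3. h (y$3)) has_derivative (\<lambda>v. h' * v$3)) (at x)"
    using has_derivative_compose[OF bounded_linear_imp_has_derivative[OF bounded_linear_vec_nth] assms[unfolded has_field_derivative_def]] .
  then show "(\<lambda>y. h (y$3)) differentiable (at x)" by (rule differentiableI)
  show "partial_deriv l (\<lambda>y. h (y$3)) x = (if l = 3 then h' else 0)"
    unfolding partial_deriv_eqI[OF d] by (auto simp: axis_def)
qed

text \<open>The metrics \<open>A (dx\<^sub>1\<^sup>2 + dx\<^sub>2\<^sup>2 + m (x\<^sub>1 dx\<^sub>1 + x\<^sub>2 dx\<^sub>2)\<^sup>2 + G\<^sup>2 L dx\<^sub>3\<^sup>2)\<close>, where \<open>m\<close> and \<open>G\<close> are functions of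
  \<open>u = x\<^sub>1\<^sup>2 + x\<^sub>2\<^sup>2\<close> and \<open>L\<close> is a function of \<open>x\<^sub>3\<close>. In polar coordinates the planar part is
  \<open>d\<rho>\<^sup>2 / Q + \<rho>\<^sup>2 d\<theta>\<^sup>2\<close> with \<open>1 / Q = 1 + u m\<close>. The parameter is not \<open>m\<close> but
  \<open>n = (1 - Q) / u = m Q\<close>: then the inverse of the planar part has the entries
  \<open>\<delta>\<^sub>i\<^sub>j - n x\<^sub>i x\<^sub>j\<close>, and nothing is singular on the axis \<open>u = 0\<close>.\<close>

locale rotational_metric =
  fixes A :: real and I Z :: "real set" and n n' n'' G G' G'' L L' L'' :: "real \<Rightarrow> real"
  assumes A_pos: "0 < A" and open_I: "open I" and open_Z: "open Z"
    and n: "t \<in> I \<Longrightarrow> (n has_real_derivative n' t) (at t)"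
    and n': "t \<in> I \<Longrightarrow> (n' has_real_derivative n'' t) (at t)"
    and G: "t \<in> I \<Longrightarrow> (G has_real_derivative G' t) (at t)"
    and G': "t \<in> I \<Longrightarrow> (G' has_real_derivative G'' t) (at t)"
    and L: "z \<in> Z \<Longrightarrow> (L has_real_derivative L' z) (at z)"
    and L': "z \<in> Z \<Longrightarrow> (L' has_real_derivative L'' z) (at z)"
    and Q_pos: "t \<in> I \<Longrightarrow> 0 < 1 - t * n t"
    and G_pos: "t \<in> I \<Longrightarrow> 0 < G t"
    and L_nz: "z \<in> Z \<Longrightarrow> L z \<noteq> 0"
begin

definition Q :: "real \<Rightarrow> real" where "Q t = 1 - t * n t"
definition Q' :: "real \<Rightarrow> real" where "Q' t = - n t - t * n' t"
definition m :: "real \<Rightarrow> real" where "m t = n t / Q t"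
definition q :: "real \<Rightarrow> real" where "q t = (n' t + (n t)^2) / Q t"
definition q' :: "real \<Rightarrow> real" where
  "q' t = ((n'' t + 2 * n t * n' t) * Q t - (n' t + (n t)^2) * Q' t) / (Q t)^2"
definition e :: "real \<Rightarrow> real" where "e t = 2 * G t * G' t * Q t"
definition e' :: "real \<Rightarrow> real" where
  "e' t = 2 * ((G' t)^2 + G t * G'' t) * Q t + 2 * G t * G' t * Q' t"
definition f :: "real \<Rightarrow> real" where "f t = 2 * G' t / G t"
definition f' :: "real \<Rightarrow> real" where "f' t = 2 * (G'' t * G t - (G' t)^2) / (G t)^2"
definition l :: "real \<Rightarrow> real" where "l z = L' z / (2 * L z)"
definition l' :: "real \<Rightarrow> real" where "l' z = (L'' z * L z - (L' z)^2) / (2 * (L z)^2)"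

definition W :: "(real^3) set" where "W = {x. axis_dist2 x \<in> I \<and> x$3 \<in> Z}"

definition metric :: "3 metric_field" where
  "metric x = (\<chi> i j. if i = 3 \<and> j = 3 then A * ((G (axis_dist2 x))^2 * L (x$3))
     else if i = 3 \<or> j = 3 then 0
     else A * ((if i = j then 1 else 0) + m (axis_dist2 x) * (x$i * x$j)))"

lemma Q_pos': "t \<in> I \<Longrightarrow> 0 < Q t" using Q_pos by (simp add: Q_def)

lemma open_W: "open W"
proof -
  have "continuous_on UNIV axis_dist2"
    unfolding axis_dist2_def[abs_def] by (intro continuous_intros)
  moreover have "continuous_on UNIV (\<lambda>x::real^3. x$3)" by (intro continuous_intros)
  moreover have "W = axis_dist2 -` I \<inter> (\<lambda>x. x$3) -` Z" by (auto simp: W_def)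
  ultimately show ?thesis using open_I open_Z by (auto intro!: open_Int open_vimage)
qed

lemma Q: "t \<in> I \<Longrightarrow> (Q has_real_derivative Q' t) (at t)"
  unfolding Q_def[abs_def] Q'_def by (auto intro!: derivative_eq_intros n)

lemma m: "t \<in> I \<Longrightarrow> (m has_real_derivative q t / Q t) (at t)"
  unfolding m_def[abs_def] using Q_pos'[of t]
  by (auto intro!: derivative_eq_intros n Q)
    (simp add: q_def Q'_def field_simps power2_eq_square, simp add: Q_def algebra_simps)

lemma q: "t \<in> I \<Longrightarrow> (q has_real_derivative q' t) (at t)"
  unfolding q_def[abs_def] q'_def using Q_pos'[of t]
  by (auto intro!: derivative_eq_intros n n' Q simp: power2_eq_square)

lemma e: "t \<in> I \<Longrightarrow> (e has_real_derivative e' t) (at t)"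
  unfolding e_def[abs_def] e'_def
  by (auto intro!: derivative_eq_intros G G' Q simp: power2_eq_square algebra_simps)

lemma f: "t \<in> I \<Longrightarrow> (f has_real_derivative f' t) (at t)"
  unfolding f_def[abs_def] f'_def using G_pos[of t]
  by (auto intro!: derivative_eq_intros G G' simp: power2_eq_square algebra_simps)

lemma l: "z \<in> Z \<Longrightarrow> (l has_real_derivative l' z) (at z)"
  unfolding l_def[abs_def] l'_def using L_nz[of z]
  by (auto intro!: derivative_eq_intros L L' simp: power2_eq_square field_simps)

lemma G_sq: "t \<in> I \<Longrightarrow> ((\<lambda>t. (G t)^2) has_real_derivative 2 * G t * G' t) (at t)"
  by (auto intro!: derivative_eq_intros G)

text \<open>The Christoffel symbols. The constant factor \<open>A\<close> drops out of them; \<open>n\<close>, \<open>q\<close>, \<open>e\<close>, \<open>f\<close> and \<open>l\<close> are the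
  coefficient functions that occur, and primes denote their derivatives.\<close>

definition \<Gamma> :: "3 \<Rightarrow> 3 \<Rightarrow> 3 \<Rightarrow> real^3 \<Rightarrow> real" where
  "\<Gamma> k i j = (if k = 3 then
       (if i = 3 \<and> j = 3 then (\<lambda>x. l (x$3))
       else if i = 3 then (\<lambda>x. f (axis_dist2 x) * x$j)
       else if j = 3 then (\<lambda>x. f (axis_dist2 x) * x$i) else (\<lambda>x. 0))
     else if i = 3 \<and> j = 3 then (\<lambda>x. - (e (axis_dist2 x) * L (x$3) * x$k))
     else if i = 3 \<or> j = 3 then (\<lambda>x. 0)
     else if i = j then (\<lambda>x. x$k * (n (axis_dist2 x) + q (axis_dist2 x) * (x$i * x$j)))
     else (\<lambda>x. x$k * (q (axis_dist2 x) * (x$i * x$j))))"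

context
  fixes x :: "real^3"
  assumes x: "x \<in> W"
begin

lemma x': "axis_dist2 x \<in> I" "x$3 \<in> Z" using x by (auto simp: W_def)

lemmas radial_derivs = radial_deriv[OF n[OF x'(1)]] radial_deriv[OF q[OF x'(1)]]
  radial_deriv[OF e[OF x'(1)]] radial_deriv[OF f[OF x'(1)]] radial_deriv[OF m[OF x'(1)]]
  radial_deriv[OF G_sq[OF x'(1)]] axial_deriv[OF l[OF x'(2)]] axial_deriv[OF L[OF x'(2)]]

lemmas pd_simps = radial_derivs partial_deriv_mult partial_deriv_add partial_deriv_uminus
  differentiable_mult differentiable_add

lemma nQ: "m (axis_dist2 x) * Q (axis_dist2 x) = n (axis_dist2 x)"
  using Q_pos'[OF x'(1)] by (simp add: m_def)

lemma metric_inv: "matrix_inv (metric x) = (\<chi> i j. if i = 3 \<and> j = 3 then 1 / (A * ((G (axis_dist2 x))^2 * L (x$3)))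
     else if i = 3 \<or> j = 3 then 0
     else ((if i = j then 1 else 0) - n (axis_dist2 x) * (x$i * x$j)) / A)" (is "_ = ?M")
proof -
  have e: "m (axis_dist2 x) - n (axis_dist2 x) - m (axis_dist2 x) * n (axis_dist2 x) * ((x$1)^2 + (x$2)^2) = 0"
    using nQ by (simp add: Q_def axis_dist2_def algebra_simps)
  have "metric x ** ?M = mat 1"
    using A_pos G_pos[OF x'(1)] L_nz[OF x'(2)]
    unfolding metric_def matrix_matrix_mult_def mat_def vec_eq_iff forall_3 sum_3
    apply (simp add: field_simps power2_eq_square)
    using e by (auto simp: power2_eq_square) algebra+
  then show ?thesis
    by (intro matrix_inv_unique) (use matrix_left_right_inverse in blast)+
qed

text \<open>The Christoffel symbols with lowered upper index, which do not involve the inverse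
  matrix.\<close>

definition low :: "3 \<Rightarrow> 3 \<Rightarrow> 3 \<Rightarrow> real" where
  "low k i j = A * (if k = 3 then
       (if i = 3 \<and> j = 3 then (G (axis_dist2 x))^2 * L' (x$3) / 2
       else if i = 3 then 2 * G (axis_dist2 x) * G' (axis_dist2 x) * L (x$3) * x$j
       else if j = 3 then 2 * G (axis_dist2 x) * G' (axis_dist2 x) * L (x$3) * x$i else 0)
     else if i = 3 \<and> j = 3 then - (2 * G (axis_dist2 x) * G' (axis_dist2 x) * L (x$3) * x$k)
     else if i = 3 \<or> j = 3 then 0
     else x$k * (m (axis_dist2 x) * (if i = j then 1 else 0)
       + q (axis_dist2 x) / Q (axis_dist2 x) * (x$i * x$j)))"

lemma christoffel_first_metric: "christoffel_first metric k i j x = low k i j"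
proof -
  have "\<forall>k i j. christoffel_first metric k i j x = low k i j"
    unfolding forall_3 christoffel_first_def metric_def low_def
    by (simp add: pd_simps algebra_simps)
  then show ?thesis by blast
qed

lemma christoffel_metric: "christoffel metric k i j x = \<Gamma> k i j x"
proof -
  define u nu qu where "u = axis_dist2 x" and "nu = n u" and "qu = q u"
  have Qu: "0 < Q u" "Q u = 1 - ((x$1)^2 + (x$2)^2) * nu" "m u = nu / Q u"
    using Q_pos'[OF x'(1)] by (auto simp: u_def nu_def Q_def m_def axis_dist2_def)
  have "\<forall>k i j. christoffel metric k i j x = \<Gamma> k i j x"
    unfolding forall_3 christoffel_eq_raise christoffel_first_metric sum_3 metric_inv
    using A_pos G_pos[OF x'(1)] L_nz[OF x'(2)] Qu(1)
    by (simp add: low_def \<Gamma>_def e_def f_def l_def u_def[symmetric] nu_def[symmetric] qu_def[symmetric] Qu(3) field_simps power2_eq_square)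
      (simp add: Qu(2) power2_eq_square algebra_simps)
  then show ?thesis by blast
qed

end

lemma partial_christoffel_metric:
  "x \<in> W \<Longrightarrow> partial_deriv h (christoffel metric k i j) x = partial_deriv h (\<Gamma> k i j) x"
  by (rule partial_deriv_cong[OF open_W _ christoffel_metric])

lemma christoffel_metric_differentiable:
  assumes "x \<in> W"
  shows "christoffel metric k i j differentiable (at x)"
proof (rule differentiable_cong[OF open_W assms christoffel_metric[symmetric]])
  show "\<Gamma> k i j differentiable (at x)"
    unfolding \<Gamma>_def by (simp add: pd_simps[OF assms] differentiable_minus)
qed

lemma ricci_metric_planar:
  assumes x: "x \<in> W"
  defines "u \<equiv> axis_dist2 x"
  assumes ij: "i \<noteq> 3" "j \<noteq> 3"
  shows "ricci metric i j x =
      (n u + 2 * u * n' u - q u * u - f u + u * n u * (n u + q u * u + f u)) * (if i = j then 1 else 0)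
      + (2 * q u - 2 * n' u - 2 * f' u + u * q u * (n u + q u * u + f u) - (n u + q u * u)^2 - (f u)^2) * (x$i * x$j)"
    (is "_ = ?R i j")
proof -
  have "\<forall>i j. i \<noteq> 3 \<longrightarrow> j \<noteq> 3 \<longrightarrow> ricci metric i j x = ?R i j"
    unfolding forall_3 ricci_def riemann_def sum_3 christoffel_metric[OF x] partial_christoffel_metric[OF x]
    by (simp add: \<Gamma>_def pd_simps[OF x] u_def[symmetric])
      (simp add: u_def[unfolded axis_dist2_def] power2_eq_square algebra_simps)
  then show ?thesis using ij by blast
qed

lemma ricci_metric_axial:
  assumes x: "x \<in> W"
  defines "u \<equiv> axis_dist2 x"
  shows "ricci metric 3 3 x = L (x$3) * (e u * f u * u - 2 * e u - 2 * u * e' u - e u * u * (n u + q u * u))"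
  unfolding ricci_def riemann_def sum_3 christoffel_metric[OF x] partial_christoffel_metric[OF x]
  using L_nz[of "x$3"] x
  by (simp add: \<Gamma>_def pd_simps[OF x] u_def[symmetric] W_def l_def)
    (simp add: u_def[unfolded axis_dist2_def] power2_eq_square field_simps)

text \<open>The factor \<open>L\<close> only reparametrizes the axis, hence does not affect the curvature. What remains is,
  up to the factor \<open>1 / A\<close>, \<open>2 K - 2 \<Delta>G / G\<close> for the surface of revolution \<open>d\<rho>\<^sup>2 / Q + \<rho>\<^sup>2 d\<theta>\<^sup>2\<close> of Gauss curvature
  \<open>K = - Q'\<close>. The expression is linear in \<open>Q\<close> and of first order, so that for given \<open>G\<close> a prescribed constant
  scalar curvature is a linear ordinary differential equation for \<open>Q\<close>.\<close>

theorem scalar_curvature_metric: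
  assumes x: "x \<in> W"
  defines "u \<equiv> axis_dist2 x"
  shows "scalar_curvature metric x =
    - 2 / A * (Q' u + (4 * Q u * (u * G'' u + G' u) + 2 * u * Q' u * G' u) / G u)"
proof -
  have u: "u \<in> I" "x$3 \<in> Z" using x by (auto simp: W_def u_def)
  have n'u: "n' u = q u * Q u - (n u)^2" using Q_pos'[OF u(1)] by (simp add: q_def)
  define S where "S = (n u + 2 * u * n' u - q u * u - f u + u * n u * (n u + q u * u + f u))"
  define T where "T = (2 * q u - 2 * n' u - 2 * f' u + u * q u * (n u + q u * u + f u) - (n u + q u * u)^2 - (f u)^2)"
  have "scalar_curvature metric x = ((2 - n u * u) * S + (u - n u * u^2) * T) / A
     + (e u * f u * u - 2 * e u - 2 * u * e' u - e u * u * (n u + q u * u)) / (A * (G u)^2)"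
    unfolding scalar_curvature_def sum_3 metric_inv[OF x]
    using A_pos G_pos[OF u(1)] L_nz[OF u(2)]
    by (simp add: ricci_metric_planar[OF x] ricci_metric_axial[OF x] u_def[symmetric] S_def[symmetric] T_def[symmetric])
      (simp add: u_def[unfolded axis_dist2_def] power2_eq_square field_simps)
  also have "\<dots> = - 2 / A * (Q' u + (4 * Q u * (u * G'' u + G' u) + 2 * u * Q' u * G' u) / G u)"
    using A_pos G_pos[OF u(1)] unfolding S_def T_def e_def e'_def f_def f'_def Q'_def n'u
    by (simp add: field_simps power2_eq_square)
      (simp add: Q_def algebra_simps power2_eq_square)
  finally show ?thesis .
qed

end

text \<open>The metric is conformally flat with a factor that depends on \<open>x\<^sub>3\<close> alone, so all Christoffel
  symbols are \<open>0\<close> or \<open>\<plusminus> 1 / x\<^sub>3\<close>.\<close>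

lemma scalar_curvature_hyp_metric:
  assumes x: "x \<in> hyp_space"
  shows "scalar_curvature hyp_metric x = - 6"
proof -
  define ch where "ch = (\<lambda>k i j. \<lambda>y::real^3. - (1 / y$3) *
    ((if i = 3 \<and> k = j then 1 else 0) + (if j = 3 \<and> k = i then 1 else 0) - (if k = 3 \<and> i = (j::3) then 1 else 0)))"
  have inv: "matrix_inv (hyp_metric y) = mat ((y$3)^2)" if "y \<in> hyp_space" for y
  proof (rule matrix_inv_unique)
    have "mat a ** mat b = (mat (a * b) :: real^3^3)" for a b :: real
      unfolding matrix_matrix_mult_def mat_def vec_eq_iff forall_3 sum_3 by simp
    then show "hyp_metric y ** mat ((y$3)^2) = mat 1" "mat ((y$3)^2) ** hyp_metric y = mat 1"
      using that by (simp_all add: hyp_metric_def hyp_space_def)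
  qed
  have comp: "(\<lambda>y. hyp_metric y $ i $ j) = (if i = j then (\<lambda>y. 1 / (y$3)^2) else (\<lambda>y. 0))" for i j
    by (auto simp: hyp_metric_def mat_def fun_eq_iff)
  have ch: "christoffel hyp_metric k i j y = ch k i j y" if y: "y \<in> hyp_space" for k i j y
  proof -
    have y3: "0 < y$3" using y by (simp add: hyp_space_def)
    have d: "((\<lambda>z. 1 / z^2) has_real_derivative - 2 / (y$3)^3) (at (y$3))"
      using y3 by (auto intro!: derivative_eq_intros simp: power2_eq_square power3_eq_cube field_simps)
    have "\<forall>k i j. christoffel hyp_metric k i j y = ch k i j y"
      unfolding forall_3 christoffel_def inv[OF y] comp sum_3 mat_def
      using y3 by (simp add: axial_deriv[OF d] ch_def) (simp add: field_simps power2_eq_square power3_eq_cube)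
    then show ?thesis by blast
  qed
  have op: "open hyp_space"
    unfolding hyp_space_def by (intro open_Collect_less continuous_intros)
  have pch: "partial_deriv l (christoffel hyp_metric k i j) x = partial_deriv l (ch k i j) x" for l k i j
    by (rule partial_deriv_cong[OF op x ch])
  have x3: "0 < x$3" using x by (simp add: hyp_space_def)
  have d: "((\<lambda>z. 1 / z) has_real_derivative - 1 / (x$3)^2) (at (x$3))"
    using x3 by (auto intro!: derivative_eq_intros simp: power2_eq_square field_simps)
  have pd: "partial_deriv l (ch k i j) x = (if l = 3 then 1 / (x$3)^2 else 0) *
    ((if i = 3 \<and> k = j then 1 else 0) + (if j = 3 \<and> k = i then 1 else 0) - (if k = 3 \<and> i = j then 1 else 0))" for l k i j
    unfolding ch_def
    by (subst partial_deriv_mult)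
      (simp_all add: axial_deriv[OF d] partial_deriv_uminus differentiable_minus)
  show ?thesis
    unfolding scalar_curvature_def inv[OF x] ricci_def riemann_def pch pd ch[OF x] sum_3
    using x3 by (simp add: mat_def ch_def field_simps power2_eq_square)
qed

section \<open>A family of metrics of scalar curvature -6\<close>

lemma smooth_on_deriv:
  fixes f :: "real \<Rightarrow> real"
  assumes "open I" "smooth_on I f"
  shows "t \<in> I \<Longrightarrow> (f has_real_derivative deriv f t) (at t)" "smooth_on I (deriv f)"
proof -
  have td: "times_differentiable_on (Suc n) I f" for n using assms(2) by (simp add: smooth_on_def)
  have 1: "(f has_real_derivative frechet_derivative f (at t) 1) (at t)" if "t \<in> I" for t
  proof -
    have f: "f differentiable (at t)" using td that by simp
    then have "(f has_derivative frechet_derivative f (at t)) (at t)"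
      by (simp add: frechet_derivative_works[symmetric])
    moreover have "frechet_derivative f (at t) = (*) (frechet_derivative f (at t) 1)"
    proof
      fix v show "frechet_derivative f (at t) v = frechet_derivative f (at t) 1 * v"
        using linear_scale[OF linear_frechet_derivative[OF f], of v 1] by (simp add: mult.commute)
    qed
    ultimately show ?thesis by (simp add: has_field_derivative_def)
  qed
  then show "t \<in> I \<Longrightarrow> (f has_real_derivative deriv f t) (at t)"
    using DERIV_imp_deriv by metis
  have "times_differentiable_on n I (deriv f)" for n
  proof (rule times_differentiable_on_cong[OF assms(1)])
    show "times_differentiable_on n I (\<lambda>t. frechet_derivative f (at t) 1)"
      using td[of n] by simp
    show "frechet_derivative f (at t) 1 = deriv f t" if "t \<in> I" for t
      using DERIV_imp_deriv[OF 1[OF that]] by simp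
  qed
  then show "smooth_on I (deriv f)" by (simp add: smooth_on_def)
qed

text \<open>The chosen model has \<open>G = 1 + c u\<close> with \<open>c = - 1 / 1000\<close>, and \<open>A = k\<close>. For scalar curvature \<open>-6\<close> the
  differential equation for \<open>Q\<close>, with the condition \<open>Q 0 = 1\<close> of smoothness on the axis, has the solution
  \<open>Q = (1 - 9 k / (14 c)) / \<tau>\<^sup>4 + (k / c) (1 / 2 + \<tau>\<^sup>3 / 7)\<close> with \<open>\<tau>\<^sup>3 = 1 + 3 c u\<close>. The doubled
  letters are the values of the parameters \<open>n\<close>, \<open>m\<close>, \<open>G\<close>, \<open>L\<close>, \<open>I\<close>, \<open>Z\<close> of the general family. Both \<open>u\<close> and
  \<open>1 - z\<^sup>2\<close> have to lie in \<open>II\<close>, which contains a neighbourhood of \<open>[0, 1]\<close>.\<close>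

definition \<tau> :: "real \<Rightarrow> real" where "\<tau> t = root 3 (1 - 3 * t / 1000)"

text \<open>This is \<open>(1 - Q) / u\<close>, with the factor \<open>u\<close> cancelled by means of
  \<open>1 - \<tau>\<^sup>4 = (1 - \<tau>) (1 + \<tau>) (1 + \<tau>\<^sup>2)\<close> and \<open>1 - \<tau>\<^sup>3 = (1 - \<tau>) (1 + \<tau> + \<tau>\<^sup>2)\<close>.\<close>

definition nn :: "real \<Rightarrow> real \<Rightarrow> real" where
  "nn k t = - (3 / 1000 + 27 * k / 14) * ((1 + \<tau> t) * (1 + (\<tau> t)^2) / ((\<tau> t)^4 * (1 + \<tau> t + (\<tau> t)^2))) - 3 * k / 7"

definition GG :: "real \<Rightarrow> real" where "GG t = 1 - t / 1000"

definition mm :: "real \<Rightarrow> real \<Rightarrow> real" where "mm k t = nn k t / (1 - t * nn k t)"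

text \<open>Determined by the boundary condition. On the unit sphere \<open>u = 1 - z\<^sup>2\<close>, and
  \<open>x\<^sub>1 dx\<^sub>1 + x\<^sub>2 dx\<^sub>2 = - z dz\<close> on its tangent vectors; so the coefficient of \<open>dz\<^sup>2\<close> in the induced metric becomes 1
  exactly if \<open>G\<^sup>2 L + z\<^sup>2 m = 1\<close>.\<close>

definition LL :: "real \<Rightarrow> real \<Rightarrow> real" where
  "LL k z = (1 - z^2 * mm k (1 - z^2)) / (GG (1 - z^2))^2"

definition II :: "real set" where "II = {-1<..<2}"
definition ZZ :: "real set" where "ZZ = {z. z^2 < 2}"

lemma open_II: "open II" by (simp add: II_def)
lemma open_ZZ: "open ZZ" unfolding ZZ_def by (intro open_Collect_less continuous_intros)

lemma ZZ_II: "z \<in> ZZ \<Longrightarrow> 1 - z^2 \<in> II"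
  by (auto simp: ZZ_def II_def) (smt (verit) zero_le_power2)

lemma tau_cube: "(\<tau> t)^3 = 1 - 3 * t / 1000"
  unfolding \<tau>_def by (rule odd_real_root_pow) simp

lemma tau_bounds:
  assumes "t \<in> II"
  shows "9/10 \<le> \<tau> t" "\<tau> t \<le> 11/10"
proof -
  have t: "-1 < t" "t < 2" using assms by (auto simp: II_def)
  show "9/10 \<le> \<tau> t"
  proof (rule ccontr)
    assume "\<not> 9/10 \<le> \<tau> t"
    then have "(\<tau> t)^3 < (9/10)^3" using t
      by (intro power_strict_mono) (auto simp: \<tau>_def)
    then show False using t unfolding tau_cube by (simp add: power3_eq_cube)
  qed
  show "\<tau> t \<le> 11/10"
  proof (rule ccontr)
    assume "\<not> \<tau> t \<le> 11/10"
    then have "(11/10)^3 < (\<tau> t)^3" by (intro power_strict_mono) auto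
    then show False using t unfolding tau_cube by (simp add: power3_eq_cube)
  qed
qed

lemma nn_bound:
  assumes t: "t \<in> II" and k: "0 \<le> k" "k \<le> 1/1000"
  shows "\<bar>nn k t\<bar> \<le> 1/10"
proof -
  let ?T = "\<tau> t"
  let ?b = "(1 + ?T) * (1 + ?T^2) / (?T^4 * (1 + ?T + ?T^2))"
  note b = tau_bounds[OF t]
  have T2: "?T^2 \<le> (11/10)^2" "(9/10)^2 \<le> ?T^2" "(9/10)^4 \<le> ?T^4"
    using b by (auto intro!: power_mono)
  have "(1 + ?T) * (1 + ?T^2) \<le> (1 + 11/10) * (1 + (11/10)^2)"
    using b T2 by (intro mult_mono add_mono) (auto intro: order_trans)
  moreover have "(9/10)^4 * (1 + 9/10 + (9/10)^2) \<le> ?T^4 * (1 + ?T + ?T^2)"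
    using b T2 by (intro mult_mono add_mono) (auto intro: order_trans)
  ultimately have 1: "(1 + ?T) * (1 + ?T^2) \<le> 3 * (?T^4 * (1 + ?T + ?T^2))"
    by (simp add: power2_eq_square power4_eq_xxxx)
  have p: "0 < ?T^4 * (1 + ?T + ?T^2)" using b by (intro mult_pos_pos add_pos_pos) auto
  have b3: "?b \<le> 3" using 1 p by (simp add: pos_divide_le_eq)
  have b0: "0 \<le> ?b" using p b by (intro divide_nonneg_pos mult_nonneg_nonneg) auto
  define X where "X = (3 / 1000 + 27 * k / 14) * ?b"
  have "X \<le> (3 / 1000 + 27 * (1/1000) / 14) * 3"
    unfolding X_def using k b3 b0 by (intro mult_mono) auto
  moreover have "0 \<le> X"
    unfolding X_def using k b0 by (intro mult_nonneg_nonneg) auto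
  moreover have "nn k t = - X - 3 * k / 7"
    by (simp only: nn_def X_def mult_minus_left)
  ultimately show ?thesis using k by (simp add: abs_le_iff)
qed

lemma QQ_bound:
  assumes t: "t \<in> II" and k: "0 \<le> k" "k \<le> 1/1000"
  shows "4/5 \<le> 1 - t * nn k t"
proof -
  have "\<bar>t * nn k t\<bar> \<le> 2 * (1/10)"
    unfolding abs_mult using t nn_bound[OF assms] by (intro mult_mono) (auto simp: II_def)
  then show ?thesis by linarith
qed

lemma mm_bound:
  assumes t: "t \<in> II" and k: "0 \<le> k" "k \<le> 1/1000"
  shows "\<bar>mm k t\<bar> \<le> 1/8"
proof -
  have "\<bar>nn k t\<bar> / (1 - t * nn k t) \<le> (1/10) / (4/5)"
    using nn_bound[OF assms] QQ_bound[OF assms] by (intro frac_le) auto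
  then show ?thesis
    unfolding mm_def abs_divide using QQ_bound[OF assms] by simp
qed

lemma GG_pos: "t \<in> II \<Longrightarrow> 0 < GG t" by (auto simp: GG_def II_def)

lemma LL_pos:
  assumes z: "z \<in> ZZ" and k: "0 \<le> k" "k \<le> 1/1000"
  shows "0 < LL k z"
proof -
  have "\<bar>z^2 * mm k (1 - z^2)\<bar> \<le> 2 * (1/8)"
    unfolding abs_mult using z mm_bound[OF ZZ_II[OF z] k] by (intro mult_mono) (auto simp: ZZ_def)
  then have "z^2 * mm k (1 - z^2) < 1" by linarith
  then show ?thesis using GG_pos[OF ZZ_II[OF z]] by (simp add: LL_def)
qed

lemma smooth_id_real: "smooth_on U (\<lambda>x::real. x)"
  by (rule smooth_on_bounded_linear) simp

lemmas smooth_rules = smooth_on_add smooth_on_mult smooth_on_uminus smooth_on_diff smooth_on_power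
  smooth_on_divide smooth_on_const smooth_id_real smooth_on_component

lemma smooth_tau: "smooth_on II \<tau>"
proof -
  have "smooth_on II (\<lambda>t. root (Suc 2) (1 - 3 * t / 1000))"
    by (rule smooth_on_compose_real[OF open_II smooth_on_root])
      (auto intro!: smooth_rules open_II simp: II_def)
  then show ?thesis by (simp add: \<tau>_def[abs_def])
qed

lemma smooth_nn: "smooth_on II (nn k)"
proof -
  have "(\<tau> t)^4 * (1 + \<tau> t + (\<tau> t)^2) \<noteq> 0" if "t \<in> II" for t
  proof -
    have "0 < (\<tau> t)^4 * (1 + \<tau> t + (\<tau> t)^2)"
      using tau_bounds[OF that] by (intro mult_pos_pos add_pos_pos) auto
    then show ?thesis by (metis less_irrefl)
  qed
  then show ?thesis unfolding nn_def[abs_def] by (intro smooth_rules open_II smooth_tau)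
qed

lemma smooth_mm: "0 \<le> k \<Longrightarrow> k \<le> 1/1000 \<Longrightarrow> smooth_on II (mm k)"
  unfolding mm_def[abs_def] using QQ_bound[of _ k] by (intro smooth_rules open_II smooth_nn) force

lemma smooth_GG: "smooth_on II GG"
  unfolding GG_def[abs_def] by (intro smooth_rules open_II) auto

lemma smooth_LL: "0 \<le> k \<Longrightarrow> k \<le> 1/1000 \<Longrightarrow> smooth_on ZZ (LL k)"
proof -
  assume k: "0 \<le> k" "k \<le> 1/1000"
  have u: "smooth_on ZZ (\<lambda>z. 1 - z^2)" "(\<lambda>z. 1 - z^2) ` ZZ \<subseteq> II"
    using ZZ_II by (auto intro!: smooth_rules open_ZZ)
  have "GG (1 - z^2) \<noteq> 0" if "z \<in> ZZ" for z using GG_pos[OF ZZ_II[OF that]] by simp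
  then show ?thesis
    unfolding LL_def[abs_def]
    by (intro smooth_rules open_ZZ smooth_on_compose_real[OF open_ZZ smooth_mm[OF k] u]
        smooth_on_compose_real[OF open_ZZ smooth_GG u]) auto
qed

text \<open>The form of \<open>Q\<close> in which the differential equation can be checked, whereas \<open>nn\<close> is the form
  that is visibly smooth on the axis.\<close>

lemma QQ_closed:
  assumes "t \<in> II"
  shows "1 - t * nn k t = (1 + 9000 * k / 14) / (\<tau> t)^4 - 1000 * k * (1/2 + (\<tau> t)^3 / 7)"
proof -
  let ?T = "\<tau> t"
  have T: "0 < ?T" using tau_bounds[OF assms] by simp
  then have p: "0 < 1 + ?T + ?T^2" by (simp add: add_pos_pos)
  have t: "t = (1000/3) * (1 - ?T^3)" by (simp add: tau_cube)
  have "(1 - ?T^3) * ((1 + ?T) * (1 + ?T^2) / (?T^4 * (1 + ?T + ?T^2))) = (1 - ?T^4) / ?T^4"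
  proof -
    have "(1 - ?T^3) * ((1 + ?T) * (1 + ?T^2)) = (1 - ?T^4) * (1 + ?T + ?T^2)"
      by (simp add: power2_eq_square power3_eq_cube power4_eq_xxxx algebra_simps)
    then have "(1 - ?T^3) * ((1 + ?T) * (1 + ?T^2) / (?T^4 * (1 + ?T + ?T^2)))
        = ((1 - ?T^4) * (1 + ?T + ?T^2)) / (?T^4 * (1 + ?T + ?T^2))"
      by (simp only: times_divide_eq_right)
    then show ?thesis using p by simp
  qed
  also have "(1 - ?T^4) / ?T^4 = 1 / ?T^4 - 1" using T by (simp add: field_simps)
  finally have b: "(1 - ?T^3) * ((1 + ?T) * (1 + ?T^2) / (?T^4 * (1 + ?T + ?T^2))) = 1 / ?T^4 - 1" .
  have "1 - s * (- N * b - c) = 1 + (1000/3) * (N * ((1 - X) * b) + (1 - X) * c)"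
    if "s = (1000/3) * (1 - X)" for s N b c X :: real
    by (simp add: that field_simps)
  from this[OF t] have "1 - t * nn k t = 1 + (1000/3) * ((3 / 1000 + 27 * k / 14)
      * ((1 - ?T^3) * ((1 + ?T) * (1 + ?T^2) / (?T^4 * (1 + ?T + ?T^2)))) + (1 - ?T^3) * (3 * k / 7))"
    unfolding nn_def .
  also have "\<dots> = (1 + 9000 * k / 14) / ?T^4 - 1000 * k * (1/2 + ?T^3 / 7)"
  proof -
    have "1 + (1000/3) * ((3 / 1000 + 27 * k / 14) * (w - 1) + (1 - X) * (3 * k / 7))
        = (1 + 9000 * k / 14) * w - 1000 * k * (1/2 + X / 7)" for w X :: real
      by (simp add: field_simps)
    from this[of "1 / ?T^4" "?T^3"] show ?thesis unfolding b by simp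
  qed
  finally show ?thesis .
qed

lemma rotational_metric_k:
  assumes k: "0 < k" "k \<le> 1/1000"
  shows "rotational_metric k II ZZ (nn k) (deriv (nn k)) (deriv (deriv (nn k)))
    GG (\<lambda>_. - (1/1000)) (\<lambda>_. 0) (LL k) (deriv (LL k)) (deriv (deriv (LL k)))"
proof
  note n = smooth_on_deriv[OF open_II smooth_nn[of k]]
  have k': "0 \<le> k" using k by simp
  note L = smooth_on_deriv[OF open_ZZ smooth_LL[OF k' k(2)]]
  show "0 < k" "open II" "open ZZ" by (fact k open_II open_ZZ)+
  show "(nn k has_real_derivative deriv (nn k) t) (at t)"
    "(deriv (nn k) has_real_derivative deriv (deriv (nn k)) t) (at t)" if "t \<in> II" for t
    using n(1)[OF that] smooth_on_deriv(1)[OF open_II n(2)] that by auto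
  show "(LL k has_real_derivative deriv (LL k) z) (at z)"
    "(deriv (LL k) has_real_derivative deriv (deriv (LL k)) z) (at z)" if "z \<in> ZZ" for z
    using L(1)[OF that] smooth_on_deriv(1)[OF open_ZZ L(2)] that by auto
  show "(GG has_real_derivative - (1/1000)) (at t)" for t
    unfolding GG_def[abs_def] by (auto intro!: derivative_eq_intros)
  show "((\<lambda>_. - (1/1000)) has_real_derivative 0) (at t)" for t :: real by simp
  show "0 < 1 - t * nn k t" "0 < GG t" if "t \<in> II" for t
    using QQ_bound[OF that k' k(2)] GG_pos[OF that] by auto
  show "LL k z \<noteq> 0" if "z \<in> ZZ" for z using LL_pos[OF that k' k(2)] by simp
qed

context
  fixes k :: real
  assumes k: "0 < k" "k \<le> 1/1000"
begin

interpretation rotational_metric k II ZZ "nn k" "deriv (nn k)" "deriv (deriv (nn k))"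
    GG "\<lambda>_. - (1/1000)" "\<lambda>_. 0" "LL k" "deriv (LL k)" "deriv (deriv (LL k))"
  by (rule rotational_metric_k[OF k])

text \<open>With \<open>G = 1 + c u\<close> the coefficient of \<open>Q'\<close> is \<open>1 + 3 c u = \<tau>\<^sup>3\<close>, and the homogeneous equation
  \<open>\<tau>\<^sup>3 Q' + 4 c Q = 0\<close> is solved by \<open>\<tau>\<close> to the power \<open>-4\<close>, since \<open>\<tau>' = c / \<tau>\<^sup>2\<close>.\<close>

lemma curvature_ode:
  assumes t: "t \<in> II"
  shows "Q' t * GG t + 4 * Q t * (- (1/1000)) + 2 * t * Q' t * (- (1/1000)) = 3 * k * GG t"
proof -
  let ?T = "\<tau> t"
  have T: "0 < ?T" using tau_bounds[OF t] by simp
  have arg: "0 < 1 - 3 * t / 1000" using t by (auto simp: II_def)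
  have dT: "(\<tau> has_real_derivative - (1/1000) / ?T^2) (at t)"
  proof -
    have "((\<lambda>t. 1 - 3 * t / 1000) has_real_derivative - (3/1000)) (at t)"
      by (auto intro!: derivative_eq_intros)
    from DERIV_chain2[OF DERIV_real_root[of 3, OF _ arg] this]
    show ?thesis using T unfolding \<tau>_def[abs_def] by (simp add: field_simps)
  qed
  define D where "D = - (1/1000) / ?T^2 * (- 4 * (1 + 9000 * k / 14) / ?T^5 - 1000 * k * (3 * ?T^2 / 7))"
  have "((\<lambda>t. (1 + 9000 * k / 14) / (\<tau> t)^4 - 1000 * k * (1/2 + (\<tau> t)^3 / 7)) has_real_derivative D) (at t)"
    unfolding D_def using T
    by (auto intro!: derivative_eq_intros dT simp: field_simps)
  then have "(Q has_real_derivative D) (at t)"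
    by (rule has_field_derivative_transform_within_open[OF _ open_II t]) (simp add: Q_def QQ_closed)
  then have Q': "Q' t = D" using Q[OF t] DERIV_unique by blast
  have G: "GG t + 2 * t * (- (1/1000)) = ?T^3" by (simp add: tau_cube GG_def)
  have "Q' t * GG t + 4 * Q t * (- (1/1000)) + 2 * t * Q' t * (- (1/1000))
      = Q' t * (GG t + 2 * t * (- (1/1000))) - (4/1000) * Q t"
    by (simp add: algebra_simps)
  also have "\<dots> = D * ?T^3 - (4/1000) * ((1 + 9000 * k / 14) / ?T^4 - 1000 * k * (1/2 + ?T^3 / 7))"
    unfolding G Q' Q_def QQ_closed[OF t] ..
  also have "\<dots> = k * (?T^3 + 2)"
    unfolding D_def using T by (simp add: field_simps)
  also have "\<dots> = 3 * k * GG t" by (simp add: tau_cube GG_def algebra_simps)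
  finally show ?thesis .
qed

lemma scalar_curvature_model:
  assumes "x \<in> W"
  shows "scalar_curvature metric x = - 6"
proof -
  have u: "axis_dist2 x \<in> II" using assms by (simp add: W_def)
  show ?thesis
    unfolding scalar_curvature_metric[OF assms] using curvature_ode[OF u] GG_pos[OF u] k
    by (simp add: field_simps)
qed

end

section \<open>A chart that maps geodesic balls to the unit ball\<close>

text \<open>With \<open>a = sinh r\<close> and \<open>C = cosh r\<close>, the projective map \<open>chart\<close> takes the geodesic ball of radius \<open>r\<close>
  about \<open>p\<close> onto the unit ball. On the boundary sphere it agrees, up to the scale \<open>a\<close> and a
  reflection and translation, with the inversion that makes the induced hyperbolic metric round, because both
  the map and the inversion are there affine functions divided by \<open>x\<^sub>3\<close>. Hence it carries the
  boundary metric to \<open>a\<^sup>2\<close> times that of the unit sphere. In the interior it is not an isometry.\<close>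

locale ball_chart =
  fixes p :: "real^3" and a :: real
  assumes p3: "0 < p$3" and a: "0 < a"
begin

definition C :: real where "C = sqrt (1 + a^2)"

definition chart :: "real^3 \<Rightarrow> real^3" where
  "chart x = (\<chi> c. if c = 3 then (C - p$3 / x$3) / a else (x$c - p$c) / (a * x$3))"

definition chart_U :: "(real^3) set" where
  "chart_U = {x. 0 < x$3 \<and> axis_dist2 (chart x) \<in> II \<and> chart x $ 3 \<in> ZZ}"

text \<open>Each component of \<open>chart\<close> is an affine function divided by \<open>x\<^sub>3\<close>, and \<open>lin\<close> is the linear part of the numerator.
  Differentiating \<open>x\<^sub>3 chart x = numerator\<close> repeatedly yields the recursive formulas for
  \<open>jac\<close>, \<open>hess\<close> and \<open>third\<close>, in which the symmetry in the lower indices is evident.\<close>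

definition lin :: "3 \<Rightarrow> 3 \<Rightarrow> real" where
  "lin c i = (if c = i then (if c = 3 then C / a else 1 / a) else 0)"

definition jac :: "real^3 \<Rightarrow> real^3^3" where
  "jac x = (\<chi> c i. (lin c i - (if i = 3 then chart x $ c else 0)) / x$3)"

definition hess :: "3 \<Rightarrow> 3 \<Rightarrow> 3 \<Rightarrow> real^3 \<Rightarrow> real" where
  "hess c i j x = - ((if i = 3 then jac x $ c $ j else 0) + (if j = 3 then jac x $ c $ i else 0)) / x$3"

definition third :: "3 \<Rightarrow> 3 \<Rightarrow> 3 \<Rightarrow> 3 \<Rightarrow> real^3 \<Rightarrow> real" where
  "third c i j k x = - ((if i = 3 then hess c j k x else 0) + (if j = 3 then hess c i k x else 0)
     + (if k = 3 then hess c i j x else 0)) / x$3"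

definition jac_inv :: "real^3 \<Rightarrow> real^3^3" where
  "jac_inv x = (\<chi> i c. if c = 3 then (if i = 3 then a * (x$3)^2 / p$3 else a * (x$i - p$i) * x$3 / p$3)
     else if i = c then a * x$3 else 0)"

lemma C_pos: "0 < C" and C_sq: "C^2 = 1 + a^2"
proof -
  have "0 < 1 + a^2" by (simp add: add_pos_nonneg)
  then show "0 < C" "C^2 = 1 + a^2" by (simp_all add: C_def)
qed

lemma chart_eq: "x$3 \<noteq> 0 \<Longrightarrow> chart x $ c = (if c = 3 then (C * x$3 - p$3) / a else (x$c - p$c) / a) / x$3"
  using a by (simp add: chart_def field_simps)

lemma open_chart_U: "open chart_U"
proof -
  have c: "continuous_on {x::real^3. 0 < x$3} (\<lambda>x. chart x $ c)" for c
    unfolding chart_def using a by (cases "c = 3") (auto intro!: continuous_intros)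
  have o: "open {x::real^3. 0 < x$3}" by (intro open_Collect_less continuous_intros)
  have "continuous_on {x::real^3. 0 < x$3} (\<lambda>x. axis_dist2 (chart x))"
    unfolding axis_dist2_def by (intro continuous_intros c)
  then have "open ((\<lambda>x. axis_dist2 (chart x)) -` II \<inter> {x. 0 < x$3})"
    by (simp add: continuous_on_open_vimage[OF o] open_II)
  moreover have "open ((\<lambda>x. chart x $ 3) -` ZZ \<inter> {x. 0 < x$3})"
    using c[of 3] by (simp add: continuous_on_open_vimage[OF o] open_ZZ)
  ultimately have "open (((\<lambda>x. axis_dist2 (chart x)) -` II \<inter> {x. 0 < x$3}) \<inter> ((\<lambda>x. chart x $ 3) -` ZZ \<inter> {x. 0 < x$3}))"
    by (rule open_Int)
  moreover have "chart_U = ((\<lambda>x. axis_dist2 (chart x)) -` II \<inter> {x. 0 < x$3}) \<inter> ((\<lambda>x. chart x $ 3) -` ZZ \<inter> {x. 0 < x$3})"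
    by (auto simp: chart_U_def)
  ultimately show ?thesis by simp
qed

lemma quotient_deriv:
  fixes f :: "real^3 \<Rightarrow> real"
  assumes "0 < x$3" and "(f has_derivative D) (at x)"
  shows "((\<lambda>y. f y / y$3) has_derivative (\<lambda>v. (D v - f x / x$3 * v$3) / x$3)) (at x)"
proof -
  have "((\<lambda>y. f y / y$3) has_derivative (\<lambda>v. (D v * x$3 - f x * v$3) / (x$3 * x$3))) (at x)"
    using assms by (auto intro!: derivative_eq_intros)
  moreover have "(D v * x$3 - f x * v$3) / (x$3 * x$3) = (D v - f x / x$3 * v$3) / x$3" for v
    using assms(1) by (simp add: field_simps)
  ultimately show ?thesis by simp
qed

lemma deriv_chart:
  assumes x: "0 < x$3"
  shows "((\<lambda>y. chart y $ c) has_derivative (\<lambda>v. \<Oplus>i. jac x $ c $ i * v$i)) (at x)"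
proof -
  let ?N = "\<lambda>y::real^3. if c = 3 then (C * y$3 - p$3) / a else (y$c - p$c) / a"
  have "(?N has_derivative (\<lambda>v. \<Oplus>i. lin c i * v$i)) (at x)"
  proof -
    have "(\<Oplus>i. lin c i * v$i) = (if c = 3 then C * v$3 / a else v$c / a)" for v :: "real^3"
      using exhaust_3[of c] unfolding sum_3 lin_def by auto
    then show ?thesis using a by (cases "c = 3") (auto intro!: derivative_eq_intros simp: fun_eq_iff field_simps)
  qed
  from quotient_deriv[OF x this]
  have "((\<lambda>y. ?N y / y$3) has_derivative (\<lambda>v. ((\<Oplus>i. lin c i * v$i) - ?N x / x$3 * v$3) / x$3)) (at x)" .
  moreover have "((\<Oplus>i. lin c i * v$i) - ?N x / x$3 * v$3) / x$3 = (\<Oplus>i. jac x $ c $ i * v$i)" for v :: "real^3"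
    using x unfolding sum_3 jac_def by (simp add: chart_eq field_simps)
  ultimately have "((\<lambda>y. ?N y / y$3) has_derivative (\<lambda>v. \<Oplus>i. jac x $ c $ i * v$i)) (at x)"
    by simp
  then show ?thesis
  proof (rule has_derivative_transform_within_open)
    show "open {y::real^3. 0 < y$3}" by (intro open_Collect_less continuous_intros)
    show "x \<in> {y. 0 < y$3}" using x by simp
    show "?N y / y$3 = chart y $ c" if "y \<in> {y. 0 < y$3}" for y using that chart_eq[of y c] by simp
  qed
qed

lemma deriv_jac:
  assumes x: "0 < x$3"
  shows "((\<lambda>y. jac y $ c $ i) has_derivative (\<lambda>v. \<Oplus>j. hess c i j x * v$j)) (at x)"
proof -
  have "((\<lambda>y. if i = 3 then chart y $ c else 0) has_derivative
      (\<lambda>v. if i = 3 then \<Oplus>j. jac x $ c $ j * v$j else 0)) (at x)"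
    using deriv_chart[OF x, of c] by (cases "i = 3") simp_all
  from has_derivative_diff[OF has_derivative_const this, of "lin c i"]
  have "((\<lambda>y. lin c i - (if i = 3 then chart y $ c else 0)) has_derivative
      (\<lambda>v. - (if i = 3 then \<Oplus>j. jac x $ c $ j * v$j else 0))) (at x)" by simp
  from quotient_deriv[OF x this]
  have "((\<lambda>y. jac y $ c $ i) has_derivative (\<lambda>v. (- (if i = 3 then \<Oplus>j. jac x $ c $ j * v$j else 0)
      - jac x $ c $ i * v$3) / x$3)) (at x)" by (simp add: jac_def)
  moreover have "(- (if i = 3 then \<Oplus>j. jac x $ c $ j * v$j else 0) - jac x $ c $ i * v$3) / x$3
      = (\<Oplus>j. hess c i j x * v$j)" for v
    unfolding sum_3 hess_def using x by (simp add: field_simps)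
  ultimately show ?thesis by simp
qed

lemma deriv_hess:
  assumes x: "0 < x$3"
  shows "(hess c i j has_derivative (\<lambda>v. \<Oplus>k. third c i j k x * v$k)) (at x)"
proof -
  have d: "((\<lambda>y. if b then jac y $ c $ l else 0) has_derivative
      (\<lambda>v. if b then \<Oplus>k. hess c l k x * v$k else 0)) (at x)" for b l
    using deriv_jac[OF x, of c l] by (cases b) simp_all
  have "((\<lambda>y. - ((if i = 3 then jac y $ c $ j else 0) + (if j = 3 then jac y $ c $ i else 0))) has_derivative
      (\<lambda>v. - ((if i = 3 then \<Oplus>k. hess c j k x * v$k else 0) + (if j = 3 then \<Oplus>k. hess c i k x * v$k else 0)))) (at x)"
    by (intro has_derivative_minus has_derivative_add d)
  from quotient_deriv[OF x this]
  have "(hess c i j has_derivative (\<lambda>v. (- ((if i = 3 then \<Oplus>k. hess c j k x * v$k else 0)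
      + (if j = 3 then \<Oplus>k. hess c i k x * v$k else 0)) - hess c i j x * v$3) / x$3)) (at x)"
    by (simp add: hess_def[abs_def])
  moreover have "(- ((if i = 3 then \<Oplus>k. hess c j k x * v$k else 0)
      + (if j = 3 then \<Oplus>k. hess c i k x * v$k else 0)) - hess c i j x * v$3) / x$3
      = (\<Oplus>k. third c i j k x * v$k)" for v
    unfolding sum_3 third_def using x by (simp add: field_simps)
  ultimately show ?thesis by simp
qed

sublocale coordinate_change chart_U chart jac jac_inv hess third
proof
  show "open chart_U" by (rule open_chart_U)
  fix x assume "x \<in> chart_U"
  then have x: "0 < x$3" by (simp add: chart_U_def)
  show "(chart has_derivative (*v) (jac x)) (at x)"
    by (rule has_derivative_vec) (use deriv_chart[OF x] in \<open>simp add: matrix_vector_mult_def\<close>)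
  show "((\<lambda>y. jac y $ c $ i) has_derivative (\<lambda>v. \<Oplus>j. hess c i j x * v$j)) (at x)" for c i
    by (rule deriv_jac[OF x])
  show "(hess c i j has_derivative (\<lambda>v. \<Oplus>k. third c i j k x * v$k)) (at x)" for c i j
    by (rule deriv_hess[OF x])
  show hs: "hess c i j x = hess c j i x" for c i j by (simp add: hess_def add.commute)
  show "third c j k i x = third c i k j x" for c i j k
    using hs[of c j i] by (simp add: third_def hs[of c k] add_ac)
  show "jac_inv x ** jac x = mat 1"
    unfolding matrix_matrix_mult_def mat_def vec_eq_iff forall_3 sum_3 jac_inv_def jac_def lin_def
    using x a p3 by (simp add: chart_eq field_simps power2_eq_square)
  show "(\<lambda>y. jac_inv y $ i $ c) differentiable (at x)" for i c
    unfolding jac_inv_def using p3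
    by (cases "c = 3"; cases "i = 3"; cases "i = c")
      (auto intro!: derivative_intros differentiable_divide)
qed

lemma chart_norm:
  assumes "0 < x$3"
  shows "(a * x$3)^2 * ((norm (chart x))^2 - 1) = (x$1 - p$1)^2 + (x$2 - p$2)^2 + (x$3 - p$3 * C)^2 - (p$3 * a)^2"
proof -
  have "(a * x$3)^2 * (norm (chart x))^2 = (x$1 - p$1)^2 + (x$2 - p$2)^2 + (C * x$3 - p$3)^2"
    unfolding norm_sq_3 using assms a by (simp add: chart_eq power_divide field_simps)
  moreover have "(C * x$3 - p$3)^2 = (1 + a^2) * (x$3)^2 - 2 * C * x$3 * p$3 + (p$3)^2"
    unfolding C_sq[symmetric] by (simp add: power2_eq_square algebra_simps)
  moreover have "(x$3 - p$3 * C)^2 = (x$3)^2 - 2 * C * x$3 * p$3 + (p$3)^2 * (1 + a^2)"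
    unfolding C_sq[symmetric] by (simp add: power2_eq_square algebra_simps)
  ultimately show ?thesis by (simp add: power2_eq_square algebra_simps)
qed

definition center :: "real^3" where "center = (\<chi> i. if i = 3 then p$3 * C else p$i)"

definition geo_ball :: "(real^3) set" where "geo_ball = cball center (p$3 * a)"

lemma geo_ball_pos: "x \<in> geo_ball \<Longrightarrow> 0 < x$3"
proof -
  assume "x \<in> geo_ball"
  then have "\<bar>(x - center) $ 3\<bar> \<le> p$3 * a"
    using component_le_norm_cart[of "x - center" 3]
    by (simp add: geo_ball_def dist_norm norm_minus_commute)
  then have "p$3 * (C - a) \<le> x$3" by (auto simp: center_def abs_le_iff algebra_simps)
  moreover have "a < C" using C_sq C_pos a by (intro power2_less_imp_less[of a C]) auto
  ultimately show ?thesis using p3 by (smt (verit) mult_pos_pos)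
qed

lemma center_dist: "(norm (x - center))^2 = (x$1 - p$1)^2 + (x$2 - p$2)^2 + (x$3 - p$3 * C)^2"
  by (simp add: norm_sq_3 center_def)

lemma chart_geo_ball:
  assumes x: "x \<in> geo_ball"
  shows "norm (chart x) \<le> 1"
proof -
  have "norm (x - center) \<le> p$3 * a" using x by (simp add: geo_ball_def dist_norm norm_minus_commute)
  then have "(norm (x - center))^2 \<le> (p$3 * a)^2" by (intro power_mono) auto
  then have "(a * x$3)^2 * ((norm (chart x))^2 - 1) \<le> 0"
    unfolding chart_norm[OF geo_ball_pos[OF x]] center_dist by simp
  then have "(norm (chart x))^2 \<le> 1^2"
    using a geo_ball_pos[OF x] by (simp add: mult_le_0_iff)
  then show ?thesis by (rule power2_le_imp_le) simp
qed

lemma chart_sphere: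
  assumes x: "x \<in> sphere center (p$3 * a)"
  shows "norm (chart x) = 1"
proof -
  have xB: "x \<in> geo_ball" using x by (simp add: geo_ball_def)
  have "norm (x - center) = p$3 * a" using x by (simp add: dist_norm norm_minus_commute)
  then have "(a * x$3)^2 * ((norm (chart x))^2 - 1) = 0"
    unfolding chart_norm[OF geo_ball_pos[OF xB]] center_dist[symmetric] by simp
  then have "(norm (chart x))^2 = 1" using a geo_ball_pos[OF xB] by simp
  then show ?thesis using norm_ge_zero[of "chart x"] unfolding power2_eq_1_iff by linarith
qed

lemma unit_ball_domain:
  assumes "norm y \<le> 1"
  shows "axis_dist2 y \<in> II" "y$3 \<in> ZZ" "axis_dist2 y \<le> 1 - (y$3)^2"
proof -
  have "(norm y)^2 \<le> 1" using assms by (simp add: power_le_one)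
  then have 1: "axis_dist2 y + (y$3)^2 \<le> 1" by (simp add: norm_sq_3 axis_dist2_def)
  have 2: "0 \<le> axis_dist2 y" "0 \<le> (y$3)^2" by (auto simp: axis_dist2_def)
  show "axis_dist2 y \<in> II" "y$3 \<in> ZZ" "axis_dist2 y \<le> 1 - (y$3)^2"
    using 1 2 unfolding II_def ZZ_def greaterThanLessThan_iff mem_Collect_eq by linarith+
qed

lemma geo_ball_subset: "geo_ball \<subseteq> chart_U"
  using chart_geo_ball geo_ball_pos unit_ball_domain by (auto simp: chart_U_def)

lemma det_jac:
  assumes "0 < x$3"
  shows "det (jac x) = p$3 / (a^3 * (x$3)^4)"
  unfolding det_3 jac_def lin_def using assms a
  by (simp add: chart_eq field_simps power2_eq_square power3_eq_cube power4_eq_xxxx)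

end

section \<open>The competing metric on a geodesic ball\<close>

lemma tangent_sphere:
  fixes c :: "'a::real_inner"
  assumes "v \<in> tangent_vectors (sphere c \<rho>) x"
  shows "(x - c) \<bullet> v = 0"
proof -
  obtain \<gamma> e where e: "0 < e" and \<gamma>: "\<gamma> ` {-e<..<e} \<subseteq> sphere c \<rho>" "\<gamma> 0 = x"
    "(\<gamma> has_vector_derivative v) (at (0::real))"
    using assms unfolding tangent_vectors_def by blast
  have "((\<lambda>t. (\<gamma> t - c) \<bullet> (\<gamma> t - c)) has_derivative (\<lambda>t. 2 * ((x - c) \<bullet> (t *\<^sub>R v)))) (at 0)"
    using \<gamma>(3) unfolding has_vector_derivative_def
    by (auto intro!: derivative_eq_intros simp: \<gamma>(2) inner_commute)
  moreover have "((\<lambda>t. (\<gamma> t - c) \<bullet> (\<gamma> t - c)) has_derivative (\<lambda>t. 0)) (at 0)"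
  proof (rule has_derivative_transform_within_open)
    show "((\<lambda>t::real. \<rho>^2) has_derivative (\<lambda>t. 0)) (at 0)" by simp
    show "open {-e<..<e}" "0 \<in> {-e<..<e}" using e by auto
    fix t assume "t \<in> {-e<..<e}"
    then have "\<gamma> t \<in> sphere c \<rho>" using \<gamma>(1) by blast
    then have "norm (\<gamma> t - c) = \<rho>" by (simp add: dist_norm norm_minus_commute)
    then show "\<rho>^2 = (\<gamma> t - c) \<bullet> (\<gamma> t - c)" by (simp add: power2_norm_eq_inner[symmetric])
  qed
  ultimately have "(\<lambda>t. 2 * ((x - c) \<bullet> (t *\<^sub>R v))) = (\<lambda>t. 0)" by (rule has_derivative_unique)
  from fun_cong[OF this, of 1] show ?thesis by simp
qed

context rotational_metric
begin

lemma metric_inner_metric: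
  "metric_inner metric x u v = A * (u$1 * v$1 + u$2 * v$2
     + m (axis_dist2 x) * (x$1 * u$1 + x$2 * u$2) * (x$1 * v$1 + x$2 * v$2)
     + (G (axis_dist2 x))^2 * L (x$3) * (u$3 * v$3))"
  unfolding metric_inner_def metric_def inner_vec_def matrix_vector_mult_def sum_3
  by (simp add: algebra_simps)

lemma det_metric:
  assumes "axis_dist2 x \<in> I"
  shows "det (metric x) = A^3 * ((G (axis_dist2 x))^2 * L (x$3) / Q (axis_dist2 x))"
proof -
  have "det (metric x) = A^3 * (1 + axis_dist2 x * m (axis_dist2 x)) * ((G (axis_dist2 x))^2 * L (x$3))"
    unfolding det_3 metric_def axis_dist2_def[of x]
    by (simp add: power2_eq_square power3_eq_cube algebra_simps)
  also have "1 + axis_dist2 x * m (axis_dist2 x) = 1 / Q (axis_dist2 x)"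
    using Q_pos'[OF assms] by (simp add: m_def Q_def field_simps)
  finally show ?thesis by simp
qed

text \<open>The eigenvalues of the planar part are 1 and \<open>1 + u m = 1 / Q\<close>.\<close>

lemma metric_pos:
  assumes "axis_dist2 x \<in> I" "0 < L (x$3)" "v \<noteq> 0"
  shows "0 < metric_inner metric x v v"
proof -
  define u where "u = axis_dist2 x"
  define r where "r = (v$1)^2 + (v$2)^2"
  define s where "s = (x$1 * v$1 + x$2 * v$2)^2"
  have rs: "0 \<le> r" "0 \<le> s" by (auto simp: r_def s_def)
  have s: "s \<le> u * r"
  proof -
    have "u * r - s = (x$1 * v$2 - x$2 * v$1)^2"
      unfolding u_def axis_dist2_def r_def s_def by (simp add: power2_eq_square algebra_simps)
    then show ?thesis by (smt (verit) zero_le_power2)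
  qed
  have Q: "0 < Q u" using Q_pos'[OF assms(1)] by (simp add: u_def)
  have Qm: "1 + u * m u = 1 / Q u" using Q by (simp add: m_def Q_def field_simps)
  have planar: "min 1 (1 / Q u) * r \<le> r + m u * s"
  proof (cases "0 \<le> m u")
    case True
    then have "r \<le> r + m u * s" using rs by simp
    moreover have "min 1 (1 / Q u) * r \<le> 1 * r" using rs by (intro mult_right_mono) auto
    ultimately show ?thesis by simp
  next
    case False
    then have "m u * (u * r) \<le> m u * s" using s by (intro mult_left_mono_neg) auto
    moreover have "min 1 (1 / Q u) * r \<le> (1 + u * m u) * r" unfolding Qm using rs by (intro mult_right_mono) auto
    ultimately show ?thesis by (simp add: algebra_simps)
  qed
  have gl: "0 < (G u)^2 * L (x$3)" using G_pos[OF assms(1)] assms(2) by (simp add: u_def)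
  have mi: "0 < min 1 (1 / Q u)" using Q by simp
  have "0 < r + m u * s + (G u)^2 * L (x$3) * (v$3)^2"
  proof (cases "r = 0")
    case True
    then have "v$1 = 0" "v$2 = 0" unfolding r_def by (auto simp: sum_power2_eq_zero_iff)
    then have "v$3 \<noteq> 0" using assms(3) by (auto simp: vec_eq_iff forall_3)
    then have "0 < (G u)^2 * L (x$3) * (v$3)^2" using gl by simp
    then show ?thesis using planar True by simp
  next
    case False
    then have "0 < min 1 (1 / Q u) * r" using mi rs by simp
    moreover have "0 \<le> (G u)^2 * L (x$3) * (v$3)^2" using gl by simp
    ultimately show ?thesis using planar by linarith
  qed
  moreover have "metric_inner metric x v v = A * (r + m u * s + (G u)^2 * L (x$3) * (v$3)^2)"
    unfolding metric_inner_metric r_def s_def u_def by (simp add: power2_eq_square algebra_simps)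
  ultimately show ?thesis using A_pos by simp
qed

lemma metric_differentiable:
  assumes x: "x \<in> W"
  shows "(\<lambda>y. metric y $ i $ j) differentiable (at x)"
proof -
  have "\<forall>i j. (\<lambda>y. metric y $ i $ j) differentiable (at x)"
    unfolding forall_3 metric_def by (simp add: pd_simps[OF x])
  then show ?thesis by blast
qed

end

text \<open>The bound on \<open>a\<close> makes the correction terms in \<open>nn\<close> small enough for the metric to be positive
  definite on a neighbourhood of the closed unit ball.\<close>

locale small_ball = ball_chart +
  assumes a_small: "a^2 \<le> 1/1000"
begin

lemma a2: "0 < a^2" "0 \<le> a^2" using a by auto

sublocale model: rotational_metric "a^2" II ZZ "nn (a^2)" "deriv (nn (a^2))" "deriv (deriv (nn (a^2)))"
    GG "\<lambda>_. - (1/1000)" "\<lambda>_. 0" "LL (a^2)" "deriv (LL (a^2))" "deriv (deriv (LL (a^2)))"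
  by (rule rotational_metric_k[OF a2(1) a_small])

definition g :: "3 metric_field" where "g = pullback model.metric"

lemma m_eq: "model.m = mm (a^2)"
  by (simp add: fun_eq_iff model.m_def mm_def model.Q_def)

lemma chart_W: "x \<in> chart_U \<Longrightarrow> chart x \<in> model.W"
  by (simp add: chart_U_def model.W_def)

lemma L_pos: "x \<in> model.W \<Longrightarrow> 0 < LL (a^2) (x$3)"
  using LL_pos[OF _ a2(2) a_small] by (simp add: model.W_def)

lemma metric_inner_pullback:
  "metric_inner (pullback h) x u v = metric_inner h (chart x) (jac x *v u) (jac x *v v)"
proof -
  have "u \<bullet> (transpose (jac x) *v w) = (jac x *v u) \<bullet> w" for w
    by (metis dot_lmul_matrix inner_commute transpose_matrix_vector)
  then show ?thesis
    unfolding metric_inner_def pullback_def by (simp add: matrix_vector_mul_assoc[symmetric])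
qed

lemma chart_U_nz: "x \<in> chart_U \<Longrightarrow> x$3 \<noteq> 0"
  by (simp add: chart_U_def)

lemma smooth_chart: "smooth_on chart_U (\<lambda>x. chart x $ c)"
  unfolding chart_def using a
  by (cases "c = 3") (auto intro!: smooth_rules open_chart_U dest: chart_U_nz)

lemma smooth_jac: "smooth_on chart_U (\<lambda>x. jac x $ c $ i)"
  unfolding jac_def
  by (cases "i = 3") (auto intro!: smooth_rules open_chart_U smooth_chart dest: chart_U_nz)

lemma smooth_metric_chart: "smooth_on chart_U (\<lambda>x. model.metric (chart x) $ i $ j)"
proof -
  have u: "smooth_on chart_U (\<lambda>x. axis_dist2 (chart x))" "(\<lambda>x. axis_dist2 (chart x)) ` chart_U \<subseteq> II"
    unfolding axis_dist2_def by (intro smooth_rules open_chart_U smooth_chart) (auto simp: chart_U_def axis_dist2_def)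
  have z: "(\<lambda>x. chart x $ 3) ` chart_U \<subseteq> ZZ" by (auto simp: chart_U_def)
  note s = smooth_on_compose_real[OF open_chart_U smooth_mm[OF a2(2) a_small] u]
    smooth_on_compose_real[OF open_chart_U smooth_GG u]
    smooth_on_compose_real[OF open_chart_U smooth_LL[OF a2(2) a_small] smooth_chart z]
  show ?thesis
    unfolding model.metric_def m_eq
    by (cases "i = 3"; cases "j = 3"; cases "i = j") (auto intro!: smooth_rules open_chart_U s smooth_chart)
qed

lemma smooth_g: "smooth_on chart_U g"
  unfolding g_def
  by (rule smooth_on_matrix[OF open_chart_U])
    (unfold pullback_component sum_3, intro smooth_rules open_chart_U smooth_metric_chart smooth_jac)

lemma jac_inj: "x \<in> chart_U \<Longrightarrow> v \<noteq> 0 \<Longrightarrow> jac x *v v \<noteq> 0"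
  using K_J[of x] by (metis matrix_vector_mul_assoc matrix_vector_mul_lid matrix_vector_mult_0_right)

lemma metric_sym: "model.metric y $ i $ j = model.metric y $ j $ i"
  by (simp add: model.metric_def mult.commute)

lemma riemannian_g: "riemannian_metric_on geo_ball g"
  unfolding riemannian_metric_on_def
proof (intro conjI ballI allI impI)
  show "\<exists>U. open U \<and> geo_ball \<subseteq> U \<and> smooth_on U g"
    using open_chart_U geo_ball_subset smooth_g by blast
  fix x u v assume "x \<in> geo_ball"
  then have x: "x \<in> chart_U" using geo_ball_subset by blast
  show "metric_inner g x u v = metric_inner g x v u"
    unfolding g_def metric_inner_pullback model.metric_inner_metric by (simp add: mult_ac)
  show "0 < metric_inner g x v v" if "v \<noteq> 0"
    unfolding g_def metric_inner_pullback
    using chart_W[OF x] L_pos jac_inj[OF x that]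
    by (intro model.metric_pos) (auto simp: model.W_def)
qed

lemma scalar_curvature_g:
  assumes "x \<in> geo_ball"
  shows "scalar_curvature g x = - 6"
proof -
  have x: "x \<in> chart_U" using assms geo_ball_subset by blast
  have W: "y \<in> model.W" if "y \<in> chart ` chart_U" for y using that chart_W by blast
  have "scalar_curvature g x = scalar_curvature model.metric (chart x)"
    unfolding g_def
  proof (rule scalar_curvature_pullback[OF _ _ _ _ x])
    fix y and i j c :: 3 assume y: "y \<in> chart ` chart_U"
    note yW = W[OF y]
    show "(\<lambda>y. model.metric y $ i $ j) differentiable (at y)" by (rule model.metric_differentiable[OF yW])
    show "model.metric y $ i $ j = model.metric y $ j $ i" by (rule metric_sym)
    show "christoffel model.metric c i j differentiable (at y)"
      by (rule model.christoffel_metric_differentiable[OF yW])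
    have u: "axis_dist2 y \<in> II" using yW by (simp add: model.W_def)
    have "0 < det (model.metric y)"
      unfolding model.det_metric[OF u]
      using a model.G_pos[OF u] L_pos[OF yW] model.Q_pos'[OF u] by simp
    then show "invertible (model.metric y)" by (simp add: invertible_det_nz)
  qed
  also have "\<dots> = - 6" by (rule scalar_curvature_model[OF a2(1) a_small chart_W[OF x]])
  finally show ?thesis .
qed

lemma jac_apply:
  "(jac x *v u) $ c = ((if c = 3 then C else 1) / a * u$c - chart x $ c * u$3) / x$3"
proof -
  have "\<forall>c. (jac x *v u) $ c = ((if c = 3 then C else 1) / a * u$c - chart x $ c * u$3) / x$3"
    unfolding forall_3 matrix_vector_mult_def sum_3 jac_def lin_def
    by (simp add: add_divide_distrib diff_divide_distrib algebra_simps)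
  then show ?thesis by blast
qed

text \<open>Tangency to the boundary sphere, expressed through the image point: it is
  \<open>(x - center) \<bullet> u = 0\<close> divided by \<open>a x\<^sub>3\<close>.\<close>

lemma tangent_chart:
  assumes x: "x \<in> sphere center (p$3 * a)" and u: "u \<in> tangent_vectors (sphere center (p$3 * a)) x"
  shows "chart x $ 1 * u$1 + chart x $ 2 * u$2 = (a - C * chart x $ 3) * u$3"
proof -
  have x3: "0 < x$3" using x by (intro geo_ball_pos) (simp add: geo_ball_def)
  have "(x - center) \<bullet> u = 0" by (rule tangent_sphere[OF u])
  then have t: "(x$1 - p$1) * u$1 + (x$2 - p$2) * u$2 + (x$3 - p$3 * C) * u$3 = 0"
    by (simp add: inner_vec_def sum_3 center_def)
  have "a - C * chart x $ 3 = (a * a * x$3 - C * (C * x$3 - p$3)) / (a * x$3)"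
    using x3 a by (simp add: chart_eq field_simps)
  also have "a * a * x$3 - C * (C * x$3 - p$3) = p$3 * C - x$3"
  proof -
    have "C * (C * x$3) = C^2 * x$3" by (simp add: power2_eq_square)
    also have "\<dots> = (1 + a^2) * x$3" by (simp only: C_sq)
    finally have "C * (C * x$3) = (1 + a^2) * x$3" .
    then show ?thesis by (simp add: power2_eq_square algebra_simps)
  qed
  finally have 1: "a - C * chart x $ 3 = (p$3 * C - x$3) / (a * x$3)" .
  have "chart x $ 1 * u$1 + chart x $ 2 * u$2 = ((x$1 - p$1) * u$1 + (x$2 - p$2) * u$2) / (a * x$3)"
    using x3 a by (simp add: chart_eq field_simps)
  also have "(x$1 - p$1) * u$1 + (x$2 - p$2) * u$2 = (p$3 * C - x$3) * u$3"
    using t by (simp add: algebra_simps)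
  finally show ?thesis unfolding 1 by simp
qed

text \<open>The choice of \<open>LL\<close> makes the model metric equal to \<open>a\<^sup>2\<close> times the Euclidean one on vectors tangent
  to the unit sphere. Pulled back by the chart, the latter is \<open>(u \<bullet> v) / x\<^sub>3\<^sup>2\<close> for vectors tangent to the boundary; this uses
  \<open>C\<^sup>2 - a\<^sup>2 = 1\<close>.\<close>

lemma boundary_g: "same_boundary_metric geo_ball g hyp_metric"
  unfolding same_boundary_metric_def
proof (intro ballI)
  have fr: "frontier geo_ball = sphere center (p$3 * a)" by (simp add: geo_ball_def)
  fix x u v assume x: "x \<in> frontier geo_ball"
    and uv: "u \<in> tangent_vectors (frontier geo_ball) x" "v \<in> tangent_vectors (frontier geo_ball) x"
  note xs = x[unfolded fr]
  have x3: "0 < x$3" using xs by (intro geo_ball_pos) (simp add: geo_ball_def)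
  define X where "X = chart x"
  define U V where "U = jac x *v u" and "V = jac x *v v"
  have X1: "(X$1)^2 + (X$2)^2 + (X$3)^2 = 1"
    using chart_sphere[OF xs] unfolding norm_sq_3[symmetric] X_def by simp
  then have ud: "axis_dist2 X = 1 - (X$3)^2" by (simp add: axis_dist2_def)
  have tu: "X$1 * u$1 + X$2 * u$2 = (a - C * X$3) * u$3"
    and tv: "X$1 * v$1 + X$2 * v$2 = (a - C * X$3) * v$3"
    unfolding X_def using uv by (auto intro!: tangent_chart[OF xs] simp: fr)
  have tangent: "X$1 * (jac x *v w)$1 + X$2 * (jac x *v w)$2 = - X$3 * (jac x *v w)$3"
    if t: "X$1 * w$1 + X$2 * w$2 = (a - C * X$3) * w$3" for w
  proof -
    have "X$1 * (jac x *v w)$1 + X$2 * (jac x *v w)$2 + X$3 * (jac x *v w)$3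
      = ((X$1 * w$1 + X$2 * w$2 + C * X$3 * w$3) / a - ((X$1)^2 + (X$2)^2 + (X$3)^2) * w$3) / x$3"
      unfolding jac_apply X_def[symmetric]
      by (simp add: power2_eq_square add_divide_distrib diff_divide_distrib algebra_simps)
    also have "\<dots> = 0" unfolding t X1 using a by (simp add: field_simps)
    finally show ?thesis by linarith
  qed
  have "norm X \<le> 1" using chart_sphere[OF xs] by (simp add: X_def)
  note dom = unit_ball_domain[OF this]
  have GL: "(GG (axis_dist2 X))^2 * LL (a^2) (X$3) = 1 - (X$3)^2 * mm (a^2) (axis_dist2 X)"
    unfolding LL_def ud[symmetric] using GG_pos[OF dom(1)] by simp
  have "metric_inner g x u v = a^2 * (U$1 * V$1 + U$2 * V$2
     + mm (a^2) (axis_dist2 X) * (- X$3 * U$3) * (- X$3 * V$3)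
     + (1 - (X$3)^2 * mm (a^2) (axis_dist2 X)) * (U$3 * V$3))"
    unfolding g_def metric_inner_pullback model.metric_inner_metric m_eq
    unfolding X_def[symmetric] U_def V_def GL tangent[OF tu] tangent[OF tv] ..
  also have "\<dots> = a^2 * (U$1 * V$1 + U$2 * V$2 + U$3 * V$3)"
    by (simp add: power2_eq_square algebra_simps)
  also have "\<dots> = (u \<bullet> v) / (x$3)^2"
  proof -
    have "a * (jac x *v w)$c = ((if c = 3 then C else 1) * w$c - a * X$c * w$3) / x$3" for w c
      unfolding jac_apply X_def using a x3 by (simp add: field_simps)
    note j = this[folded X_def]
    have "a^2 * (U$1 * V$1 + U$2 * V$2 + U$3 * V$3)
       = (a * U$1) * (a * V$1) + (a * U$2) * (a * V$2) + (a * U$3) * (a * V$3)"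
      by (simp add: power2_eq_square algebra_simps)
    also have "\<dots> = ((u$1 - a * X$1 * u$3) * (v$1 - a * X$1 * v$3)
        + (u$2 - a * X$2 * u$3) * (v$2 - a * X$2 * v$3)
        + (C * u$3 - a * X$3 * u$3) * (C * v$3 - a * X$3 * v$3)) / (x$3)^2"
      unfolding U_def V_def j by (simp add: power2_eq_square add_divide_distrib)
    also have "(u$1 - a * X$1 * u$3) * (v$1 - a * X$1 * v$3)
        + (u$2 - a * X$2 * u$3) * (v$2 - a * X$2 * v$3)
        + (C * u$3 - a * X$3 * u$3) * (C * v$3 - a * X$3 * v$3)
      = u$1 * v$1 + u$2 * v$2 - a * u$3 * (X$1 * v$1 + X$2 * v$2) - a * v$3 * (X$1 * u$1 + X$2 * u$2)
        + a^2 * ((X$1)^2 + (X$2)^2 + (X$3)^2) * u$3 * v$3 + (C^2 - 2 * a * C * X$3) * u$3 * v$3"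
      by (simp add: power2_eq_square algebra_simps)
    also have "\<dots> = u$1 * v$1 + u$2 * v$2 + u$3 * v$3"
      unfolding tu tv X1 C_sq by (simp add: power2_eq_square algebra_simps)
    finally show ?thesis by (simp add: inner_vec_def sum_3)
  qed
  finally show "metric_inner g x u v = metric_inner hyp_metric x u v"
    by (simp add: metric_inner_hyp)
qed

lemma sqrt_det_g:
  assumes "x \<in> geo_ball"
  defines "X \<equiv> chart x"
  shows "sqrt (det (g x)) = p$3 / (x$3)^4 * sqrt ((GG (axis_dist2 X))^2 * LL (a^2) (X$3)
     / (1 - axis_dist2 X * nn (a^2) (axis_dist2 X)))"
proof -
  define S where "S = (GG (axis_dist2 X))^2 * LL (a^2) (X$3)
     / (1 - axis_dist2 X * nn (a^2) (axis_dist2 X))"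
  have x3: "0 < x$3" by (rule geo_ball_pos[OF assms(1)])
  have u: "axis_dist2 X \<in> II" unfolding X_def using assms geo_ball_subset by (auto simp: chart_U_def)
  have "det (g x) = (det (jac x))^2 * det (model.metric X)"
    unfolding g_def pullback_def X_def by (simp add: det_mul power2_eq_square)
  also have "\<dots> = (p$3 / (x$3)^4)^2 * S"
    unfolding det_jac[OF x3] model.det_metric[OF u] model.Q_def S_def[symmetric]
    using a by (simp add: power_divide field_simps)
  finally have "sqrt (det (g x)) = sqrt ((p$3 / (x$3)^4)^2) * sqrt S"
    by (simp only: real_sqrt_mult)
  then show ?thesis using p3 by (simp add: S_def)
qed

end

lemma sqrt_det_hyp:
  assumes "0 < x$3"
  shows "sqrt (det (hyp_metric x)) = 1 / (x$3)^3"
proof -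
  have "det (hyp_metric x) = (1 / (x$3)^3)^2"
    unfolding det_3 hyp_metric_def mat_def by (simp add: power2_eq_square power3_eq_cube)
  then show ?thesis using assms by simp
qed

section \<open>Integrals over the unit ball\<close>

lemma compact_absolutely_integrable:
  fixes f :: "'a::euclidean_space \<Rightarrow> 'b::euclidean_space"
  assumes "compact S" "continuous_on S f"
  shows "f absolutely_integrable_on S"
proof -
  have "integrable lborel (\<lambda>x. indicator S x *\<^sub>R f x)"
    by (rule borel_integrable_compact[OF assms])
  then have "integrable lebesgue (\<lambda>x. indicator S x *\<^sub>R f x)"
    by (rule integrable_completion[THEN iffD2, rotated]) (use assms in \<open>auto intro!: borel_measurable_continuous_on_indicator borel_compact\<close>)
  then show ?thesis by (simp add: set_integrable_def)
qed

lemma compact_integrable: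
  fixes f :: "'a::euclidean_space \<Rightarrow> 'b::euclidean_space"
  shows "compact S \<Longrightarrow> continuous_on S f \<Longrightarrow> f integrable_on S"
  using compact_absolutely_integrable set_lebesgue_integral_eq_integral(1) by blast

lemma integral_affine_image:
  fixes f :: "real^3 \<Rightarrow> real" and M :: "real^3^3"
  assumes S: "compact S" and f: "continuous_on ((\<lambda>y. c + M *v y) ` S) f" and M: "det M \<noteq> 0"
  shows "integral ((\<lambda>y. c + M *v y) ` S) f = \<bar>det M\<bar> * integral S (\<lambda>y. f (c + M *v y))"
proof -
  let ?T = "\<lambda>y. c + M *v y"
  define F where "F = (\<lambda>x. (vec (f x) :: real^1))"
  have contT: "continuous_on S ?T" by (intro continuous_intros)
  have cT: "compact (?T ` S)" by (rule compact_continuous_image[OF contT S])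
  have contF: "continuous_on (?T ` S) F"
    unfolding F_def vec_def by (intro continuous_on_vec_lambda f)
  have aiF: "F absolutely_integrable_on ?T ` S" by (rule compact_absolutely_integrable[OF cT contF])
  have "inj ((*v) M)" using M by (simp add: inj_matrix_vector_mult invertible_det_nz)
  then have inj: "inj_on ?T S" by (auto simp: inj_on_def)
  have "(\<lambda>y. \<bar>det (matrix ((*v) M))\<bar> *\<^sub>R F (?T y)) absolutely_integrable_on S \<and>
     integral S (\<lambda>y. \<bar>det (matrix ((*v) M))\<bar> *\<^sub>R F (?T y)) = integral (?T ` S) F"
    by (subst has_absolute_integral_change_of_variables[OF _ _ inj])
      (use S aiF in \<open>auto intro!: derivative_eq_intros lmeasurable_compact fmeasurableD
         bounded_linear_imp_has_derivative matrix_vector_mul_bounded_linear\<close>)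
  then have 1: "(\<lambda>y. \<bar>det M\<bar> *\<^sub>R F (?T y)) integrable_on S"
    and 2: "integral S (\<lambda>y. \<bar>det M\<bar> *\<^sub>R F (?T y)) = integral (?T ` S) F"
    using set_lebesgue_integral_eq_integral(1) by (auto simp: matrix_of_matrix_vector_mul)
  have "integral (?T ` S) F $ 1 = integral (?T ` S) f"
    using integral_linear[OF compact_integrable[OF cT contF] bounded_linear_vec_nth, of 1]
    by (auto simp: F_def o_def vec_def)
  moreover have "integral S (\<lambda>y. \<bar>det M\<bar> *\<^sub>R F (?T y)) $ 1 = integral S (\<lambda>y. \<bar>det M\<bar> * f (?T y))"
    using integral_linear[OF 1 bounded_linear_vec_nth, of 1]
    by (auto simp: F_def o_def vec_def)
  ultimately show ?thesis
    using arg_cong[OF 2, of "\<lambda>v. v $ 1"] unfolding integral_mult_right by linarith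
qed

lemma integral_cball_affine:
  fixes f :: "real^3 \<Rightarrow> real"
  assumes r: "0 < r" and f: "continuous_on (cball c r) f"
  shows "integral (cball c r) f = r^3 * integral (cball 0 1) (\<lambda>y. f (c + r *\<^sub>R y))"
proof -
  have mat: "mat r *v y = r *\<^sub>R y" for y :: "real^3"
    unfolding vec_eq_iff forall_3 by (simp add: mat_def matrix_vector_mult_def sum_3)
  have "cball c r = (\<lambda>y. c + mat r *v y) ` cball 0 1"
  proof -
    have "(\<lambda>y. c + mat r *v y) ` cball 0 1 = (+) c ` ((*\<^sub>R) r ` cball 0 1)"
      by (simp add: mat image_image)
    also have "(*\<^sub>R) r ` cball 0 1 = cball (0::real^3) r" using cball_scale[of r 0 1] r by simp
    also have "(+) c ` \<dots> = cball c r" using cball_translation[of c 0 r] by simp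
    finally show ?thesis by simp
  qed
  moreover have "det (mat r :: real^3^3) = r^3"
    unfolding det_3 by (simp add: mat_def power3_eq_cube)
  ultimately show ?thesis
    using integral_affine_image[of "cball 0 1" c "mat r" f] f r by (simp add: mat)
qed

lemma integral_cball_orthogonal:
  fixes f :: "real^3 \<Rightarrow> real" and M :: "real^3^3"
  assumes M: "orthogonal_matrix M" and f: "continuous_on (cball 0 1) f"
  shows "integral (cball 0 1) f = integral (cball 0 1) (\<lambda>y. f (M *v y))"
proof -
  have n: "norm (M *v y) = norm y" "norm (transpose M *v y) = norm y" for y
    using M orthogonal_transformation_matrix[of "(*v) M"] orthogonal_transformation_matrix[of "(*v) (transpose M)"]
    by (auto simp: orthogonal_matrix_transpose orthogonal_transformation_norm simp del: transpose_matrix_vector)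
  have "cball 0 1 = (\<lambda>y. 0 + M *v y) ` cball 0 1"
  proof (intro equalityI subsetI)
    fix y :: "real^3" assume "y \<in> cball 0 1"
    moreover have "y = 0 + M *v (transpose M *v y)"
      using M by (simp add: matrix_vector_mul_assoc orthogonal_matrix_def del: transpose_matrix_vector)
    ultimately show "y \<in> (\<lambda>y. 0 + M *v y) ` cball 0 1" using n by (intro image_eqI[of _ _ "transpose M *v y"]) auto
  qed (use n in auto)
  moreover have "\<bar>det M\<bar> = 1" using det_orthogonal_matrix[OF M] by auto
  ultimately show ?thesis
    using integral_affine_image[of "cball 0 1" 0 M f] f by auto
qed

abbreviation ball_integral :: "(real^3 \<Rightarrow> real) \<Rightarrow> real" where
  "ball_integral f \<equiv> integral (cball 0 1) f"

lemma ball_integral_const: "ball_integral (\<lambda>_. c) = c * (4 / 3 * pi)"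
proof -
  have "measure lebesgue (cball (0::real^3) 1) = 4 / 3 * pi"
    using content_cball[of 1 "0::real^3"] by (simp add: unit_ball_vol_3)
  then have "ball_integral (\<lambda>_. 1) = 4 / 3 * pi"
    by (simp add: lmeasure_integral[symmetric] lmeasurable_compact)
  moreover have "ball_integral (\<lambda>_. c * 1) = c * ball_integral (\<lambda>_. 1)"
    by (rule integral_mult_right)
  ultimately show ?thesis by simp
qed

text \<open>By scaling, the integral over the ball of radius \<open>r\<close> is \<open>r\<close> to the power \<open>3 + j\<close> times the integral \<open>N\<close> over
  the unit ball. On the shell between the two spheres the integrand lies between \<open>r\<close> to the power \<open>j\<close> and 1. Comparing the two
  and letting \<open>r\<close> tend to 1 gives \<open>(3 + j) N = 3 V\<close>, with \<open>V\<close> the volume of the unit ball.\<close>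

lemma ball_integral_norm_power:
  "ball_integral (\<lambda>y. norm y ^ j) = 4 * pi / (3 + real j)"
proof -
  define V where "V = 4 / 3 * pi"
  define N where "N = ball_integral (\<lambda>y. norm y ^ j)"
  have cont: "continuous_on S (\<lambda>y::real^3. norm y ^ j)" for S by (intro continuous_intros)
  have *: "V * r^j * (1 + r + r^2) \<le> N * (\<Sum>i<3+j. r^i) \<and> N * (\<Sum>i<3+j. r^i) \<le> V * (1 + r + r^2)"
    if r: "0 < r" "r < 1" for r
  proof -
    let ?B = "cball (0::real^3) 1" and ?b = "cball (0::real^3) r"
    have sub: "?b \<subseteq> ?B" using r by auto
    have inner: "integral ?b (\<lambda>y. norm y ^ j) = r^(3+j) * N"
      using integral_cball_affine[OF r(1) cont] r
      by (simp add: N_def power_mult_distrib power_add integral_mult_right)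
    have inner1: "integral ?b (\<lambda>y. 1) = r^3 * V"
      using integral_cball_affine[OF r(1) continuous_on_const, of 0 1] ball_integral_const[of 1]
      by (simp add: V_def)
    have d: "integral (?B - ?b) f = integral ?B f - integral ?b f" "f integrable_on (?B - ?b)"
      if "continuous_on UNIV f" for f :: "real^3 \<Rightarrow> real"
    proof -
      have i: "f integrable_on ?B" "f integrable_on ?b"
        using that by (auto intro!: compact_integrable continuous_on_subset[OF that])
      have neg: "negligible (?b - ?B)" using sub by (simp add: Diff_eq_empty_iff[THEN iffD2])
      show "integral (?B - ?b) f = integral ?B f - integral ?b f"
        using integral_setdiff[OF i neg] .
      show "f integrable_on (?B - ?b)" using integrable_setdiff[OF i(1)[THEN integrable_integral] i(2)[THEN integrable_integral]] sub
        by (metis has_integral_integrable has_integral_setdiff i integrable_integral neg)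
    qed
    have c1: "integral (?B - ?b) (\<lambda>y. c) = c * (V - r^3 * V)" for c
    proof -
      have "integral (?B - ?b) (\<lambda>y. c * 1) = c * integral (?B - ?b) (\<lambda>y. 1)" by (rule integral_mult_right)
      then show ?thesis using d(1)[of "\<lambda>_. 1"] inner1 ball_integral_const[of 1] by (simp add: V_def)
    qed
    have cN: "integral (?B - ?b) (\<lambda>y. norm y ^ j) = N - r^(3+j) * N"
      using d(1)[OF cont] inner by (simp add: N_def)
    have "integral (?B - ?b) (\<lambda>y. r^j) \<le> integral (?B - ?b) (\<lambda>y. norm y ^ j)"
      using r by (intro integral_le d cont continuous_on_const) (auto intro!: power_mono)
    moreover have "integral (?B - ?b) (\<lambda>y. norm y ^ j) \<le> integral (?B - ?b) (\<lambda>y. 1)"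
      by (intro integral_le d cont continuous_on_const) (auto intro!: power_le_one)
    ultimately have "r^j * (V - r^3 * V) \<le> N - r^(3+j) * N" "N - r^(3+j) * N \<le> V - r^3 * V"
      using c1[of "r^j"] c1[of 1] cN by auto
    moreover have "V - r^3 * V = (1 - r) * (V * (1 + r + r^2))"
      by (simp add: power2_eq_square power3_eq_cube algebra_simps)
    moreover have "N - r^(3+j) * N = (1 - r) * (N * (\<Sum>i<3+j. r^i))"
    proof -
      have "N - r^(3+j) * N = N * (1 - r^(3+j))" by (simp add: algebra_simps)
      then show ?thesis unfolding one_diff_power_eq[of r "3 + j"] by (simp add: mult_ac)
    qed
    ultimately have "(1 - r) * (V * r^j * (1 + r + r^2)) \<le> (1 - r) * (N * (\<Sum>i<3+j. r^i))"
      "(1 - r) * (N * (\<Sum>i<3+j. r^i)) \<le> (1 - r) * (V * (1 + r + r^2))"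
      by (simp_all add: mult_ac)
    then show ?thesis using r by (simp add: mult_le_cancel_left_pos)
  qed
  have ev: "\<forall>\<^sub>F r::real in at_left 1. 0 < r \<and> r < 1"
    using eventually_at_left_real[of 0 "1::real"] by (auto elim: eventually_mono)
  have l: "((\<lambda>r. N * (\<Sum>i<3+j. r^i)) \<longlongrightarrow> N * (\<Sum>i<3+j. 1^i)) (at_left 1)"
    "((\<lambda>r. V * (1 + r + r^2)) \<longlongrightarrow> V * (1 + 1 + 1^2)) (at_left 1)"
    "((\<lambda>r. V * r^j * (1 + r + r^2)) \<longlongrightarrow> V * 1^j * (1 + 1 + 1^2)) (at_left 1)"
    by (intro tendsto_intros)+
  have "N * (\<Sum>i<3+j. 1^i) \<le> V * (1 + 1 + 1^2)"
    by (rule tendsto_le[OF _ l(2,1)]) (use ev * in \<open>auto elim: eventually_mono\<close>)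
  moreover have "V * 1^j * (1 + 1 + 1^2) \<le> N * (\<Sum>i<3+j. 1^i)"
    by (rule tendsto_le[OF _ l(1,3)]) (use ev * in \<open>auto elim: eventually_mono\<close>)
  ultimately have "N * (3 + real j) = 3 * V" by simp
  then show ?thesis by (simp add: N_def V_def field_simps)
qed

lemma ball_integral_add:
  "continuous_on UNIV f \<Longrightarrow> continuous_on UNIV g \<Longrightarrow>
    ball_integral (\<lambda>y. f y + g y) = ball_integral f + ball_integral g"
  by (intro integral_add compact_integrable) (auto intro: continuous_on_subset)

lemma ball_integral_mult: "ball_integral (\<lambda>y. c * f y) = c * ball_integral f"
  by (rule integral_mult_right)

text \<open>Permuting the axes shows that the moments do not depend on the indices, so that the integral of
  \<open>norm y\<close> squared determines the second moments. For the fourth moments the reflection \<open>R\<close>,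
  which mixes two axes at 45 degrees, supplies the second relation: the pure moment is three times the mixed one.\<close>

lemma ball_moments:
  shows "ball_integral (\<lambda>y. (y$i)^2) = 4 * pi / 15"
    and "ball_integral (\<lambda>y. (y$i)^4) = 4 * pi / 35"
    and "i \<noteq> j \<Longrightarrow> ball_integral (\<lambda>y. (y$i)^2 * (y$j)^2) = 4 * pi / 105"
proof -
  define P :: "real^3^3" where "P = vector [vector [0,1,0], vector [0,0,1], vector [1,0,0]]"
  define R :: "real^3^3" where "R = vector [vector [1/sqrt 2,1/sqrt 2,0], vector [1/sqrt 2,-1/sqrt 2,0], vector [0,0,1]]"
  have Pv: "(P *v y) $ 1 = y$2" "(P *v y) $ 2 = y$3" "(P *v y) $ 3 = y$1" for y
    by (simp_all add: P_def matrix_vector_mult_def sum_3)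
  have Rv: "(R *v y) $ 1 = (y$1 + y$2) / sqrt 2" "(R *v y) $ 2 = (y$1 - y$2) / sqrt 2" for y
    by (simp_all add: R_def matrix_vector_mult_def sum_3 add_divide_distrib diff_divide_distrib)
  have oP: "orthogonal_matrix P"
    unfolding orthogonal_matrix vec_eq_iff forall_3 matrix_matrix_mult_def sum_3 transpose_def
    by (simp add: P_def mat_def)
  have oR: "orthogonal_matrix R"
    unfolding orthogonal_matrix vec_eq_iff forall_3 matrix_matrix_mult_def sum_3 transpose_def
    by (simp add: R_def mat_def)
  note cyc = integral_cball_orthogonal[OF oP]
  have q2: "ball_integral (\<lambda>y. (y$1)^2) = ball_integral (\<lambda>y. (y$2)^2)" "ball_integral (\<lambda>y. (y$2)^2) = ball_integral (\<lambda>y. (y$3)^2)"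
    by (subst cyc, (intro continuous_intros), simp only: Pv)+
  have q4: "ball_integral (\<lambda>y. (y$1)^4) = ball_integral (\<lambda>y. (y$2)^4)" "ball_integral (\<lambda>y. (y$2)^4) = ball_integral (\<lambda>y. (y$3)^4)"
    by (subst cyc, (intro continuous_intros), simp only: Pv)+
  have q22: "ball_integral (\<lambda>y. (y$1)^2 * (y$2)^2) = ball_integral (\<lambda>y. (y$2)^2 * (y$3)^2)"
    "ball_integral (\<lambda>y. (y$2)^2 * (y$3)^2) = ball_integral (\<lambda>y. (y$3)^2 * (y$1)^2)"
    by (subst cyc, (intro continuous_intros), simp only: Pv)+
  have "ball_integral (\<lambda>y. norm y ^ 2) = ball_integral (\<lambda>y. (y$1)^2 + (y$2)^2 + (y$3)^2)"
    by (simp only: norm_sq_3)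
  also have "\<dots> = ball_integral (\<lambda>y. (y$1)^2) + ball_integral (\<lambda>y. (y$2)^2) + ball_integral (\<lambda>y. (y$3)^2)"
    by (subst ball_integral_add, (intro continuous_intros)+)+ simp
  finally have s2: "ball_integral (\<lambda>y. (y$1)^2) = 4 * pi / 15"
    using q2 ball_integral_norm_power[of 2] by simp
  have "ball_integral (\<lambda>y. norm y ^ 4) = ball_integral (\<lambda>y. (y$1)^4 + (y$2)^4 + (y$3)^4
     + 2 * ((y$1)^2 * (y$2)^2) + 2 * ((y$2)^2 * (y$3)^2) + 2 * ((y$3)^2 * (y$1)^2))"
  proof -
    have "norm y ^ 4 = (y$1)^4 + (y$2)^4 + (y$3)^4
     + 2 * ((y$1)^2 * (y$2)^2) + 2 * ((y$2)^2 * (y$3)^2) + 2 * ((y$3)^2 * (y$1)^2)" for y :: "real^3"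
    proof -
      have "norm y ^ 4 = (norm y ^ 2)^2" by simp
      also have "norm y ^ 2 = (y$1)^2 + (y$2)^2 + (y$3)^2"
        by (simp only: norm_sq_3)
      finally show ?thesis by (simp add: power2_eq_square power4_eq_xxxx algebra_simps)
    qed
    then show ?thesis by simp
  qed
  also have "\<dots> = ball_integral (\<lambda>y. (y$1)^4) + ball_integral (\<lambda>y. (y$2)^4) + ball_integral (\<lambda>y. (y$3)^4)
     + 2 * ball_integral (\<lambda>y. (y$1)^2 * (y$2)^2) + 2 * ball_integral (\<lambda>y. (y$2)^2 * (y$3)^2)
     + 2 * ball_integral (\<lambda>y. (y$3)^2 * (y$1)^2)"
    by (subst ball_integral_add, (intro continuous_intros)+)+ (simp add: ball_integral_mult)
  finally have s4: "3 * ball_integral (\<lambda>y. (y$1)^4) + 6 * ball_integral (\<lambda>y. (y$1)^2 * (y$2)^2) = 4 * pi / 7"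
    using q4 q22 ball_integral_norm_power[of 4] by simp
  have "ball_integral (\<lambda>y. (y$1)^4 + (y$2)^4) = ball_integral (\<lambda>y. ((R *v y)$1)^4 + ((R *v y)$2)^4)"
    by (rule integral_cball_orthogonal[OF oR]) (intro continuous_intros)
  also have "\<dots> = ball_integral (\<lambda>y. (1/2) * (y$1)^4 + (1/2) * (y$2)^4 + 3 * ((y$1)^2 * (y$2)^2))"
  proof -
    have "sqrt 2 ^ 4 = (4::real)" by (simp add: power4_eq_xxxx)
    then have "((R *v y)$1)^4 + ((R *v y)$2)^4 = (1/2) * (y$1)^4 + (1/2) * (y$2)^4 + 3 * ((y$1)^2 * (y$2)^2)" for y
      unfolding Rv by (simp add: power_divide) (simp add: power2_eq_square power4_eq_xxxx field_simps)
    then show ?thesis by simp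
  qed
  also have "\<dots> = (1/2) * ball_integral (\<lambda>y. (y$1)^4) + (1/2) * ball_integral (\<lambda>y. (y$2)^4)
      + 3 * ball_integral (\<lambda>y. (y$1)^2 * (y$2)^2)"
    by (subst ball_integral_add, (intro continuous_intros)+)+ (simp only: ball_integral_mult)
  also have "ball_integral (\<lambda>y. (y$1)^4 + (y$2)^4) = ball_integral (\<lambda>y. (y$1)^4) + ball_integral (\<lambda>y. (y$2)^4)"
    by (intro ball_integral_add continuous_intros)
  finally have r: "ball_integral (\<lambda>y. (y$1)^4) = 3 * ball_integral (\<lambda>y. (y$1)^2 * (y$2)^2)"
    using q4 by simp
  have a4: "ball_integral (\<lambda>y. (y$1)^4) = 4 * pi / 35" and a22: "ball_integral (\<lambda>y. (y$1)^2 * (y$2)^2) = 4 * pi / 105"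
    using r s4 by auto
  show "ball_integral (\<lambda>y. (y$i)^2) = 4 * pi / 15"
    using exhaust_3[of i] q2 s2 by auto
  show "ball_integral (\<lambda>y. (y$i)^4) = 4 * pi / 35"
    using exhaust_3[of i] q4 a4 by auto
  show "i \<noteq> j \<Longrightarrow> ball_integral (\<lambda>y. (y$i)^2 * (y$j)^2) = 4 * pi / 105"
    using exhaust_3[of i] exhaust_3[of j] q22 a22 by (auto simp: mult.commute)
qed

section \<open>Comparison of the volumes\<close>

text \<open>The square of the volume density of the model metric on the unit ball, up to the factor \<open>A^3\<close>.\<close>

definition density_sq :: "real \<Rightarrow> real \<Rightarrow> real \<Rightarrow> real" where
  "density_sq k s z = (GG s)^2 * LL k z / (1 - s * nn k s)"

text \<open>The Taylor polynomial of degree 2 of \<open>(1 - 3 w) powr (2/3)\<close>, an upper bound for \<open>w \<ge> 0\<close>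
  since the third derivative is negative. The proof compares cubes, which are polynomials.\<close>

lemma tau_sq_upper:
  assumes "0 \<le> s" "s \<le> 1"
  shows "(\<tau> s)^2 \<le> 1 - 2 * (s/1000) - (s/1000)^2"
proof (rule power_le_imp_le_base)
  define w where "w = s / 1000"
  have w: "0 \<le> w" "w \<le> 1/1000" using assms by (auto simp: w_def)
  have w2: "w^2 \<le> (1/1000)^2" "0 \<le> w^2" using w by (auto intro!: power_mono)
  show "0 \<le> 1 - 2 * (s/1000) - (s/1000)^2"
    using w w2 unfolding w_def[symmetric] by (simp add: power2_eq_square)
  have "0 \<le> w^3 * (4 - 9 * w - 6 * w^2 - w^3)"
  proof -
    have "w^3 \<le> (1/1000)^3" using w by (intro power_mono) auto
    then have "0 \<le> 4 - 9 * w - 6 * w^2 - w^3" using w w2 by (simp add: power2_eq_square power3_eq_cube)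
    then show ?thesis using w by simp
  qed
  also have "\<dots> = (1 - 2 * w - w^2)^3 - (1 - 3 * w)^2"
    by (simp add: power2_eq_square power3_eq_cube algebra_simps)
  finally have "(1 - 3 * w)^2 \<le> (1 - 2 * w - w^2)^3" by simp
  moreover have "((\<tau> s)^2)^3 = (1 - 3 * w)^2"
  proof -
    have "((\<tau> s)^2)^3 = ((\<tau> s)^3)^2" by (simp flip: power_mult)
    then show ?thesis by (simp add: tau_cube w_def)
  qed
  ultimately show "((\<tau> s)^2) ^ Suc 2 \<le> (1 - 2 * (s/1000) - (s/1000)^2) ^ Suc 2"
    by (simp add: w_def eval_nat_numeral)
qed

text \<open>Likewise for \<open>(1 - 3 w) powr (4/3)\<close>, whose third derivative is positive.\<close>

lemma tau_four_lower:
  assumes "0 \<le> s" "s \<le> 1"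
  shows "1 - 4 * (s/1000) + 2 * (s/1000)^2 \<le> (\<tau> s)^4"
proof (rule power_le_imp_le_base)
  define w where "w = s / 1000"
  have w: "0 \<le> w" "w \<le> 1/1000" using assms by (auto simp: w_def)
  show "0 \<le> (\<tau> s)^4" by simp
  have "0 \<le> w^3 * (4 - 27 * w + w^2 * (48 - 8 * w))"
  proof -
    have "0 \<le> w^2 * (48 - 8 * w)" using w by simp
    then have "0 \<le> 4 - 27 * w + w^2 * (48 - 8 * w)" using w by linarith
    then show ?thesis using w by simp
  qed
  also have "\<dots> = (1 - 3 * w)^4 - (1 - 4 * w + 2 * w^2)^3"
    by (simp add: power2_eq_square power3_eq_cube power4_eq_xxxx algebra_simps)
  finally have "(1 - 4 * w + 2 * w^2)^3 \<le> (1 - 3 * w)^4" by simp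
  moreover have "((\<tau> s)^4)^3 = (1 - 3 * w)^4"
  proof -
    have "((\<tau> s)^4)^3 = ((\<tau> s)^3)^4" by (simp flip: power_mult)
    then show ?thesis by (simp add: tau_cube w_def)
  qed
  ultimately show "(1 - 4 * (s/1000) + 2 * (s/1000)^2) ^ Suc 2 \<le> ((\<tau> s)^4) ^ Suc 2"
    by (simp add: w_def eval_nat_numeral)
qed

text \<open>For \<open>k = 0\<close> the definition gives \<open>u m = \<tau>\<close> to the power 4, minus 1, and the bound is that of the previous lemma
  divided by \<open>u\<close>. At \<open>u = 0\<close>, where this says nothing, both sides are \<open>- 4 / 1000\<close>.\<close>

lemma mm_lower:
  assumes "0 \<le> u" "u \<le> 1"
  shows "- 4/1000 + 2 * u / 1000^2 \<le> mm 0 u"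
proof (cases "u = 0")
  case True
  then show ?thesis by (simp add: mm_def nn_def \<tau>_def)
next
  case False
  then have u: "0 < u" using assms by simp
  have uI: "u \<in> II" using assms by (auto simp: II_def)
  have T: "0 < \<tau> u" using tau_bounds[OF uI] by simp
  have Q: "1 - u * nn 0 u = 1 / (\<tau> u)^4" using QQ_closed[OF uI, of 0] by simp
  have "u * mm 0 u = (1 - (1 - u * nn 0 u)) / (1 - u * nn 0 u)" by (simp add: mm_def)
  also have "\<dots> = (\<tau> u)^4 - 1" unfolding Q using T by (simp add: field_simps)
  finally have "u * (- 4/1000 + 2 * u / 1000^2) \<le> u * mm 0 u"
    using tau_four_lower[OF assms] by (simp add: power2_eq_square algebra_simps)
  then show ?thesis using u by simp
qed

lemma radial_factor_upper:
  assumes "0 \<le> s" "s \<le> 1"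
  shows "GG s * (\<tau> s)^2 \<le> 1 - 3 * s / 1000 + s^2 / 1000^2 + 1 / 1000^3"
proof -
  have "GG s * (\<tau> s)^2 \<le> (1 - s/1000) * (1 - 2 * (s/1000) - (s/1000)^2)"
    unfolding GG_def using tau_sq_upper[OF assms] assms by (intro mult_left_mono) auto
  also have "\<dots> = 1 - 3 * s / 1000 + s^2 / 1000^2 + s^3 / 1000^3"
    by (simp add: power2_eq_square power3_eq_cube field_simps)
  also have "s^3 \<le> 1" using assms by (simp add: power_le_one)
  finally show ?thesis by simp
qed

lemma axial_factor_upper:
  assumes "0 \<le> v" "v \<le> 1" "z^2 = v"
  shows "sqrt (LL 0 z) \<le> 1 + (1 + v) / 1000 + (1 - v - 2 * v^2) / 1000^2 + 20 / 1000^3"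
proof -
  define u where "u = 1 - v"
  have u: "0 \<le> u" "u \<le> 1" using assms by (auto simp: u_def)
  have vk: "0 \<le> v^2" "v^2 \<le> 1" "0 \<le> v^3" "v^3 \<le> 1" "0 \<le> v^4" "v^4 \<le> 1"
    using assms by (auto intro!: power_le_one)
  have uI: "u \<in> II" using u by (auto simp: II_def)
  have G: "0 < GG u" by (rule GG_pos[OF uI])
  \<comment> \<open>The expansion of \<open>sqrt (1 - v m)\<close> to second order; the last summand absorbs the remainder.\<close>
  define P where "P = 1 + 2 * v / 1000 - (v + v^2) / 1000^2 + 5 / 1000^3"
  have "v / 1000^2 \<le> 1 / 1000^2" "v^2 / 1000^2 \<le> 1 / 1000^2" "0 \<le> 2 * v / 1000"
    using vk assms by auto
  then have P0: "0 \<le> P" unfolding P_def by (simp add: add_divide_distrib)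
  have "v * (- 4/1000 + 2 * u / 1000^2) \<le> v * mm 0 u"
    using mm_lower[OF u] assms by (intro mult_left_mono) auto
  then have "1 - v * mm 0 u \<le> 1 + 4 * v / 1000 - 2 * (v - v^2) / 1000^2"
    unfolding u_def by (simp add: power2_eq_square field_simps)
  also have "\<dots> \<le> P^2"
  proof -
    have "1 + 4 * v / 1000 - 2 * (v - v^2) / 1000^2
       \<le> 1 + 4 * v / 1000 - 2 * (v - v^2) / 1000^2 + 2 / 1000^3 + 0 / 1000^4 - 20 / 1000^5 + 25 / 1000^6"
      by simp
    also have "\<dots> \<le> 1 + 4 * v / 1000 - 2 * (v - v^2) / 1000^2 + (10 - 4 * v^2 - 4 * v^3) / 1000^3
       + (20 * v + (v^2 + 2 * v^3 + v^4)) / 1000^4 - 10 * (v + v^2) / 1000^5 + 25 / 1000^6"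
      using vk assms by (intro add_mono diff_mono order_refl divide_right_mono) (linarith | simp)+
    also have "\<dots> = P^2"
      unfolding P_def by (simp add: power2_eq_square power3_eq_cube power4_eq_xxxx field_simps)
    finally show ?thesis .
  qed
  finally have "sqrt (1 - v * mm 0 u) \<le> P"
    using P0 real_le_lsqrt by simp
  moreover have "sqrt (LL 0 z) = sqrt (1 - v * mm 0 u) / GG u"
    unfolding LL_def assms(3) u_def[symmetric] using G by (simp add: real_sqrt_divide)
  ultimately have "sqrt (LL 0 z) \<le> P / GG u" using G by (simp add: divide_right_mono)
  also have "P / GG u \<le> P * (1 + u / 1000 + u^2 / 1000^2 + 2 / 1000^3)"
  proof -
    have u3: "u^3 \<le> 1" using u by (simp add: power_le_one)
    have "(1 + u / 1000 + u^2 / 1000^2 + 2 / 1000^3) * GG u = 1 + (2 - u^3) / 1000^3 - 2 * u / 1000^4"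
      unfolding GG_def by (simp add: power2_eq_square power3_eq_cube field_simps)
    also have "\<dots> \<ge> 1" using u3 u by simp
    finally have "1 / GG u \<le> 1 + u / 1000 + u^2 / 1000^2 + 2 / 1000^3"
      using G by (simp add: divide_le_eq)
    from mult_left_mono[OF this P0] show ?thesis by simp
  qed
  also have "\<dots> \<le> 1 + (1 + v) / 1000 + (1 - v - 2 * v^2) / 1000^2 + 20 / 1000^3"
  proof -
    have u2: "u^2 \<le> 1" using u by (simp add: power_le_one)
    have q: "0 \<le> (v + v^2) * u" "0 \<le> (v + v^2) * u^2" "0 \<le> v + v^2"
      using u assms(1) by simp_all
    have "v * u^2 \<le> 1 * 1" using u2 assms(1,2) by (intro mult_mono) simp_all
    moreover have "5 * u^2 - 2 * (v + v^2) \<le> 5"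
    proof -
      have "5 * u^2 \<le> 5" "0 \<le> 2 * (v + v^2)" using u2 q(3) by simp_all
      then show ?thesis by linarith
    qed
    ultimately have q': "v * u^2 \<le> 1 * 1" "5 * u^2 - 2 * (v + v^2) \<le> 5" .
    have "P * (1 + u / 1000 + u^2 / 1000^2 + 2 / 1000^3) =
       1 + (1 + v) / 1000 + (1 - v - 2 * v^2) / 1000^2
       + (7 + 2 * (v * u^2) - (v + v^2) * u) / 1000^3
       + (4 * v + 5 * u - (v + v^2) * u^2) / 1000^4
       + (5 * u^2 - 2 * (v + v^2)) / 1000^5 + 10 / 1000^6"
      unfolding P_def u_def by (simp add: power2_eq_square field_simps)
    also have "\<dots> \<le> 1 + (1 + v) / 1000 + (1 - v - 2 * v^2) / 1000^2
       + 9 / 1000^3 + 9 / 1000^4 + 5 / 1000^5 + 10 / 1000^6"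
      using q q' u assms by (intro add_mono order_refl divide_right_mono) (assumption | linarith | simp)+
    also have "\<dots> \<le> 1 + (1 + v) / 1000 + (1 - v - 2 * v^2) / 1000^2 + 20 / 1000^3"
      by simp
    finally show ?thesis .
  qed
  finally show ?thesis .
qed

text \<open>Put \<open>\<epsilon> = 1 / 1000\<close>. This is the expansion of the volume density of the scalar-flat model (\<open>k = 0\<close>) to second
  order in \<open>\<epsilon>\<close>, with \<open>s\<close> the squared distance from the axis and \<open>v = z\<^sup>2\<close>, plus a bound for the remainder.\<close>

definition density_bound :: "real \<Rightarrow> real \<Rightarrow> real" where
  "density_bound s v = 1 + (1 + v - 3 * s) / 1000 + (s^2 - 3 * s - 3 * (s * v) + 1 - v - 2 * v^2) / 1000^2 + 60 / 1000^3"

lemma flat_density_upper: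
  assumes "0 \<le> s" "s \<le> 1" "z^2 \<le> 1"
  shows "sqrt (density_sq 0 s z) \<le> density_bound s (z^2)"
proof -
  define v where "v = z^2"
  have v: "0 \<le> v" "v \<le> 1" using assms by (auto simp: v_def)
  have sI: "s \<in> II" using assms by (auto simp: II_def)
  have T: "0 < \<tau> s" using tau_bounds[OF sI] by simp
  have Q: "1 - s * nn 0 s = 1 / (\<tau> s)^4" using QQ_closed[OF sI, of 0] by simp
  have "density_sq 0 s z = (GG s * (\<tau> s)^2)^2 * LL 0 z"
    unfolding density_sq_def Q by (simp add: power_mult_distrib)
  then have "sqrt (density_sq 0 s z) = GG s * (\<tau> s)^2 * sqrt (LL 0 z)"
    using GG_pos[OF sI] by (simp add: real_sqrt_mult)
  define b where "b = 1 - v - 2 * v^2"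
  have v2: "0 \<le> v^2" "v^2 \<le> 1" using v by (auto simp: power_le_one)
  have b: "\<bar>b\<bar> \<le> 2" using v v2 unfolding b_def abs_le_iff by linarith
  have s2: "0 \<le> s^2" "s^2 \<le> 1" using assms by (auto simp: power_le_one)
  have prods: "\<bar>s * b\<bar> \<le> 1 * 2" "\<bar>s^2 * b\<bar> \<le> 1 * 2" "\<bar>s^2 * v\<bar> \<le> 1 * 1"
    unfolding abs_mult using b s2 assms v by (intro mult_mono; simp)+
  have "sqrt (density_sq 0 s z) = GG s * (\<tau> s)^2 * sqrt (LL 0 z)" by fact
  also have "\<dots> \<le> (1 - 3 * s / 1000 + s^2 / 1000^2 + 1 / 1000^3) * (1 + (1 + v) / 1000 + b / 1000^2 + 20 / 1000^3)"
  proof (rule mult_mono)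
    show "GG s * (\<tau> s)^2 \<le> 1 - 3 * s / 1000 + s^2 / 1000^2 + 1 / 1000^3"
      by (rule radial_factor_upper[OF assms(1,2)])
    show "sqrt (LL 0 z) \<le> 1 + (1 + v) / 1000 + b / 1000^2 + 20 / 1000^3"
      unfolding b_def by (rule axial_factor_upper[OF v]) (simp add: v_def)
    show "0 \<le> sqrt (LL 0 z)"
    proof -
      have "z \<in> ZZ" using assms by (auto simp: ZZ_def)
      then show ?thesis using LL_pos[of z 0] by simp
    qed
    have "0 \<le> s^2 / 1000^2" "3 * s / 1000 \<le> 1" using assms by auto
    then show "0 \<le> 1 - 3 * s / 1000 + s^2 / 1000^2 + 1 / 1000^3"
      by (intro add_nonneg_nonneg) auto
  qed
  also have "\<dots> = 1 + (1 + v - 3 * s) / 1000 + (s^2 - 3 * s - 3 * (s * v) + b) / 1000^2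
     + (21 - 3 * (s * b) + s^2 + s^2 * v) / 1000^3 + (1 + v + s^2 * b - 60 * s) / 1000^4
     + (b + 20 * s^2) / 1000^5 + 20 / 1000^6"
    by (simp add: field_simps)
  also have "\<dots> \<le> 1 + (1 + v - 3 * s) / 1000 + (s^2 - 3 * s - 3 * (s * v) + b) / 1000^2
     + 29 / 1000^3 + 4 / 1000^4 + 22 / 1000^5 + 20 / 1000^6"
    using prods s2 b v assms(1,2) unfolding abs_le_iff
    by (intro add_mono order_refl divide_right_mono) (linarith | simp)+
  also have "\<dots> \<le> 1 + (1 + v - 3 * s) / 1000 + (s^2 - 3 * s - 3 * (s * v) + b) / 1000^2 + 60 / 1000^3"
    by simp
  also have "\<dots> = density_bound s v"
    unfolding density_bound_def b_def by (simp add: algebra_simps)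
  finally show ?thesis by (simp add: v_def)
qed

text \<open>Integrated over the unit ball, the term of first order in \<open>\<epsilon>\<close> vanishes: flat balls are
  critical for the volume among scalar-flat metrics with the given boundary metric. The term of second order
  is \<open>- 18 / 35 \<epsilon>\<^sup>2\<close> times the volume, and outweighs the remainder \<open>60 \<epsilon>\<^sup>3\<close>.\<close>

lemma density_bound_integral:
  "ball_integral (\<lambda>y. density_bound (axis_dist2 y) ((y$3)^2)) < ball_integral (\<lambda>y. 1 - 1 / 10^8)"
proof -
  have "density_bound (axis_dist2 y) ((y$3)^2) = (1 + 1/1000 + 1/1000^2 + 60/1000^3)
      + (1/1000 - 1/1000^2) * (y$3)^2 + (- 3/1000 - 3/1000^2) * (y$1)^2 + (- 3/1000 - 3/1000^2) * (y$2)^2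
      + (1/1000^2) * (y$1)^4 + (1/1000^2) * (y$2)^4 + (- 2/1000^2) * (y$3)^4
      + (2/1000^2) * ((y$1)^2 * (y$2)^2) + (- 3/1000^2) * ((y$1)^2 * (y$3)^2)
      + (- 3/1000^2) * ((y$2)^2 * (y$3)^2)" for y :: "real^3"
    unfolding density_bound_def axis_dist2_def by (simp add: power2_eq_square power4_eq_xxxx field_simps)
  then have "ball_integral (\<lambda>y. density_bound (axis_dist2 y) ((y$3)^2)) =
     (1 + 1/1000 + 1/1000^2 + 60/1000^3) * (4 / 3 * pi)
      + (1/1000 - 1/1000^2) * (4 * pi / 15) + (- 3/1000 - 3/1000^2) * (4 * pi / 15) + (- 3/1000 - 3/1000^2) * (4 * pi / 15)
      + (1/1000^2) * (4 * pi / 35) + (1/1000^2) * (4 * pi / 35) + (- 2/1000^2) * (4 * pi / 35)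
      + (2/1000^2) * (4 * pi / 105) + (- 3/1000^2) * (4 * pi / 105) + (- 3/1000^2) * (4 * pi / 105)"
    by (simp only:) ((subst ball_integral_add, (intro continuous_intros)+)+, simp only: ball_integral_mult,
      simp add: ball_moments ball_integral_const[unfolded mult.commute[of _ "4 / 3 * pi"]])
  then have "ball_integral (\<lambda>y. density_bound (axis_dist2 y) ((y$3)^2)) * 262500000 = 349999841 * pi"
    by simp
  moreover have "ball_integral (\<lambda>y. 1 - 1 / 10^8) * 25000000 = 33333333 * pi"
    unfolding ball_integral_const by simp
  ultimately show ?thesis using pi_gt_zero by linarith
qed

lemma continuous_on_tau [continuous_intros]:
  "continuous_on S f \<Longrightarrow> continuous_on S (\<lambda>x. \<tau> (f x))"
  unfolding \<tau>_def by (intro continuous_intros) auto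

lemma continuous_on_nn:
  assumes "continuous_on S k" "continuous_on S f" "f ` S \<subseteq> II"
  shows "continuous_on S (\<lambda>x. nn (k x) (f x))"
proof -
  have "(\<tau> (f x))^4 * (1 + \<tau> (f x) + (\<tau> (f x))^2) \<noteq> 0" if "x \<in> S" for x
  proof -
    have "f x \<in> II" using assms(3) that by auto
    from tau_bounds[OF this] have "0 < (\<tau> (f x))^4 * (1 + \<tau> (f x) + (\<tau> (f x))^2)"
      by (intro mult_pos_pos add_pos_pos) auto
    then show ?thesis by (metis less_irrefl)
  qed
  then show ?thesis unfolding nn_def by (intro continuous_intros assms) auto
qed

lemma continuous_on_density_sq:
  assumes k: "continuous_on S k" "\<And>x. x \<in> S \<Longrightarrow> 0 \<le> k x" "\<And>x. x \<in> S \<Longrightarrow> k x \<le> 1/1000"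
    and s: "continuous_on S s" "s ` S \<subseteq> II" and z: "continuous_on S z" "z ` S \<subseteq> ZZ"
  shows "continuous_on S (\<lambda>x. density_sq (k x) (s x) (z x))"
proof -
  have u: "continuous_on S (\<lambda>x. 1 - (z x)^2)" "(\<lambda>x. 1 - (z x)^2) ` S \<subseteq> II"
    using z ZZ_II by (auto intro!: continuous_intros)
  have Q: "1 - t * nn (k x) t \<noteq> 0" if "x \<in> S" "t \<in> II" for x t
    using QQ_bound[OF that(2) k(2,3)[OF that(1)]] by linarith
  have G: "GG (1 - (z x)^2) \<noteq> 0" if "x \<in> S" for x
    using GG_pos[of "1 - (z x)^2"] u(2) that by force
  have cG: "continuous_on S (\<lambda>x. GG (f x))" if "continuous_on S f" for f
    unfolding GG_def by (intro continuous_intros that) auto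
  have "continuous_on S (\<lambda>x. mm (k x) (1 - (z x)^2))"
    unfolding mm_def using u(2)
    by (intro continuous_intros continuous_on_nn k u ballI Q) auto
  then have "continuous_on S (\<lambda>x. LL (k x) (z x))"
    unfolding LL_def using G by (intro continuous_intros z cG u) auto
  then show ?thesis
    unfolding density_sq_def using s(2) by (intro continuous_intros cG continuous_on_nn k s ballI Q) auto
qed

text \<open>In coordinates \<open>y\<close> of the unit ball that rescale the geodesic ball affinely, \<open>p$3 * height a y\<close> is the third
  coordinate of the half-space.\<close>

definition height :: "real \<Rightarrow> real^3 \<Rightarrow> real" where
  "height a y = sqrt (1 + a^2) + a * y$3"

text \<open>The difference of the two volume densities in the coordinates \<open>y\<close>, up to a constant factor.
  It extends continuously to \<open>a = 0\<close>, where the chart becomes the identity and the difference becomes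
  that between the scalar-flat model and the Euclidean metric.\<close>

definition density_difference :: "real \<Rightarrow> real^3 \<Rightarrow> real" where
  "density_difference a y = sqrt (density_sq (a^2) (axis_dist2 y / (height a y)^2)
      ((a + sqrt (1 + a^2) * y$3) / height a y)) / (height a y)^4 - 1 / (height a y)^3"

lemma height_pos:
  assumes "norm y \<le> 1"
  shows "0 < height a y"
proof -
  have "\<bar>y$3\<bar> \<le> 1" using component_le_norm_cart[of y 3] assms by linarith
  then have "\<bar>a * y$3\<bar> \<le> \<bar>a\<bar>" unfolding abs_mult by (rule mult_left_le) simp
  moreover have "\<bar>a\<bar> < sqrt (1 + a^2)" by (rule real_less_rsqrt) simp
  ultimately show ?thesis unfolding height_def by linarith
qed

lemma rescaled_chart_domain:
  assumes y: "norm y \<le> 1"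
  shows "axis_dist2 y / (height a y)^2 + ((a + sqrt (1 + a^2) * y$3) / height a y)^2 \<le> 1"
proof -
  define c where "c = sqrt (1 + a^2)"
  have c2: "c^2 = 1 + a^2" unfolding c_def by (simp add: add_nonneg_nonneg)
  have h: "0 < height a y" by (rule height_pos[OF y])
  have "(norm y)^2 \<le> 1" using y by (simp add: power_le_one)
  then have n: "axis_dist2 y + (y$3)^2 \<le> 1" by (simp add: norm_sq_3 axis_dist2_def)
  have "(height a y)^2 - (a + c * y$3)^2 = (c^2 - a^2) * (1 - (y$3)^2)"
    unfolding height_def c_def[symmetric] by (simp add: power2_eq_square algebra_simps)
  also have "\<dots> = 1 - (y$3)^2" by (simp add: c2)
  finally have "axis_dist2 y + (a + c * y$3)^2 \<le> (height a y)^2" using n by linarith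
  then show ?thesis
    using h unfolding c_def[symmetric] by (simp add: power_divide add_divide_distrib[symmetric])
qed

lemma sum_le_one_domain:
  assumes "s + z^2 \<le> 1" "0 \<le> s"
  shows "s \<in> II" "z \<in> ZZ"
proof -
  have "0 \<le> z^2" by simp
  then show "s \<in> II" "z \<in> ZZ"
    using assms unfolding II_def ZZ_def greaterThanLessThan_iff mem_Collect_eq by linarith+
qed

lemma continuous_on_density_difference:
  "continuous_on ({0..1/40} \<times> cball 0 1) (\<lambda>(a, y). density_difference a y)"
proof -
  let ?S = "{0..1/40::real} \<times> cball (0::real^3) 1"
  have h: "continuous_on ?S (\<lambda>x. height (fst x) (snd x))"
    unfolding height_def by (intro continuous_intros)
  have h0: "\<forall>x\<in>?S. height (fst x) (snd x) \<noteq> 0"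
    using height_pos by (auto simp: order_less_imp_not_eq2)
  have dom: "axis_dist2 (snd x) / (height (fst x) (snd x))^2 \<in> II"
    "(fst x + sqrt (1 + (fst x)^2) * snd x$3) / height (fst x) (snd x) \<in> ZZ" if "x \<in> ?S" for x
    using sum_le_one_domain[OF rescaled_chart_domain[of "snd x" "fst x"]] that
    by (auto simp: axis_dist2_def)
  have "(fst x)^2 \<le> 1/1000" if "x \<in> ?S" for x
  proof -
    have "(fst x)^2 \<le> (1/40)^2" using that by (intro power_mono) auto
    then show ?thesis by (simp add: power2_eq_square)
  qed
  then have "continuous_on ?S (\<lambda>x. density_sq ((fst x)^2) (axis_dist2 (snd x) / (height (fst x) (snd x))^2)
      ((fst x + sqrt (1 + (fst x)^2) * snd x$3) / height (fst x) (snd x)))"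
    using dom h0 by (intro continuous_on_density_sq) (auto intro!: continuous_intros h simp: axis_dist2_def)
  then show ?thesis
    unfolding density_difference_def case_prod_unfold using h0 by (intro continuous_intros h) auto
qed

text \<open>Uniform continuity on the compact set \<open>{0..1/40} \<times> cball 0 1\<close> transfers the strict inequality from the limit
  \<open>a = 0\<close> to small positive \<open>a\<close>; the constant \<open>1 / 10^8\<close> is below the gap in
  \<open>density_bound_integral\<close>.\<close>

lemma ball_integral_density_difference_neg:
  obtains \<delta> where "0 < \<delta>" "\<delta> \<le> 1/40"
    "\<And>a. 0 < a \<Longrightarrow> a < \<delta> \<Longrightarrow> ball_integral (density_difference a) < 0"
proof -
  have "uniformly_continuous_on ({0..1/40} \<times> cball 0 1) (\<lambda>(a, y). density_difference a y)"
    by (intro compact_uniformly_continuous continuous_on_density_difference compact_Times) auto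
  then obtain d where d: "0 < d" and ud: "\<And>x x'. x \<in> {0..1/40} \<times> cball 0 1 \<Longrightarrow> x' \<in> {0..1/40} \<times> cball 0 1 \<Longrightarrow>
      dist x' x < d \<Longrightarrow> dist ((\<lambda>(a, y). density_difference a y) x') ((\<lambda>(a, y). density_difference a y) x) < 1 / 10^8"
    unfolding uniformly_continuous_on_def by (metis zero_less_divide_1_iff zero_less_power zero_less_numeral)
  have "ball_integral (density_difference a) < 0" if a: "0 < a" "a < min d (1/40)" for a
  proof -
    have cont: "continuous_on (cball 0 1) (density_difference a)"
    proof -
      have "continuous_on (cball 0 1) (\<lambda>y. (\<lambda>(a, y). density_difference a y) (a, y))"
        by (rule continuous_on_compose2[OF continuous_on_density_difference])
          (use a in \<open>auto intro!: continuous_intros\<close>)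
      then show ?thesis by simp
    qed
    have "density_difference a y \<le> density_bound (axis_dist2 y) ((y$3)^2) - (1 - 1 / 10^8)" if y: "y \<in> cball 0 1" for y
    proof -
      have n: "norm y \<le> 1" using y by simp
      have "dist (a, y) (0, y) < d" using a by (simp add: dist_Pair_Pair)
      then have "\<bar>density_difference a y - density_difference 0 y\<bar> < 1 / 10^8"
        using ud[of "(0, y)" "(a, y)"] a y by (auto simp: dist_real_def)
      moreover have "density_difference 0 y = sqrt (density_sq 0 (axis_dist2 y) (y$3)) - 1"
        by (simp add: density_difference_def height_def)
      moreover have "sqrt (density_sq 0 (axis_dist2 y) (y$3)) \<le> density_bound (axis_dist2 y) ((y$3)^2)"
      proof (rule flat_density_upper)
        have "(norm y)^2 \<le> 1" using n by (simp add: power_le_one)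
        then have *: "axis_dist2 y + (y$3)^2 \<le> 1" by (simp add: norm_sq_3 axis_dist2_def)
        have **: "0 \<le> axis_dist2 y" "0 \<le> (y$3)^2" by (auto simp: axis_dist2_def)
        show "0 \<le> axis_dist2 y" "axis_dist2 y \<le> 1" "(y$3)^2 \<le> 1" using * ** by linarith+
      qed
      ultimately show ?thesis by linarith
    qed
    moreover have cv: "continuous_on UNIV (\<lambda>y. density_bound (axis_dist2 y) ((y$3)^2))"
      unfolding density_bound_def axis_dist2_def by (intro continuous_intros) auto
    ultimately have "ball_integral (density_difference a) \<le>
        ball_integral (\<lambda>y. density_bound (axis_dist2 y) ((y$3)^2) - (1 - 1 / 10^8))"
      by (intro integral_le compact_integrable cont) (auto intro!: continuous_intros continuous_on_subset[OF cv])
    also have "\<dots> = ball_integral (\<lambda>y. density_bound (axis_dist2 y) ((y$3)^2)) - ball_integral (\<lambda>y. 1 - 1 / 10^8)"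
      by (intro integral_diff compact_integrable) (auto intro!: continuous_intros continuous_on_subset[OF cv])
    also have "\<dots> < 0" using density_bound_integral by simp
    finally show ?thesis .
  qed
  with d show thesis by (intro that[of "min d (1/40)"]) auto
qed

context small_ball
begin

lemma volume_g_less:
  assumes "ball_integral (density_difference a) < 0" "a \<le> 1/40"
  shows "riemannian_volume g geo_ball < riemannian_volume hyp_metric geo_ball"
proof -
  let ?s = "\<lambda>x. sqrt (density_sq (a^2) (axis_dist2 (chart x)) (chart x $ 3))"
  have cB: "compact geo_ball" by (simp add: geo_ball_def)
  have C: "C = sqrt (1 + a^2)" by (simp add: C_def)
  have x3: "\<forall>x\<in>geo_ball. x$3 \<noteq> 0" using geo_ball_pos by force
  have cchart: "continuous_on geo_ball (\<lambda>x. chart x $ c)" for c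
    unfolding chart_def using x3 a by (cases "c = 3") (auto intro!: continuous_intros)
  have dom: "(\<lambda>x. axis_dist2 (chart x)) ` geo_ball \<subseteq> II" "(\<lambda>x. chart x $ 3) ` geo_ball \<subseteq> ZZ"
    using geo_ball_subset by (auto simp: chart_U_def)
  have c1: "continuous_on geo_ball (\<lambda>x. p$3 / (x$3)^4 * ?s x)"
    using x3 a2 a_small dom
    by (intro continuous_intros continuous_on_density_sq cchart) (auto simp: axis_dist2_def intro!: continuous_intros cchart)
  have c2: "continuous_on geo_ball (\<lambda>x. 1 / (x$3)^3)"
    using x3 by (intro continuous_intros) auto
  have "riemannian_volume g geo_ball = integral geo_ball (\<lambda>x. p$3 / (x$3)^4 * ?s x)"
    unfolding riemannian_volume_def by (rule integral_cong) (simp add: sqrt_det_g density_sq_def)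
  moreover have "riemannian_volume hyp_metric geo_ball = integral geo_ball (\<lambda>x. 1 / (x$3)^3)"
    unfolding riemannian_volume_def by (rule integral_cong) (simp add: sqrt_det_hyp geo_ball_pos)
  ultimately have "riemannian_volume g geo_ball - riemannian_volume hyp_metric geo_ball
      = integral geo_ball (\<lambda>x. p$3 / (x$3)^4 * ?s x - 1 / (x$3)^3)"
    using cB c1 c2 by (simp add: integral_diff compact_integrable)
  also have "\<dots> = (p$3 * a)^3 * ball_integral (\<lambda>y. p$3 / ((center + (p$3 * a) *\<^sub>R y)$3)^4 * ?s (center + (p$3 * a) *\<^sub>R y)
      - 1 / ((center + (p$3 * a) *\<^sub>R y)$3)^3)"
    unfolding geo_ball_def using p3 a c1 c2 by (intro integral_cball_affine) (auto simp: geo_ball_def intro!: continuous_on_diff)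
  also have "ball_integral (\<lambda>y. p$3 / ((center + (p$3 * a) *\<^sub>R y)$3)^4 * ?s (center + (p$3 * a) *\<^sub>R y)
      - 1 / ((center + (p$3 * a) *\<^sub>R y)$3)^3) = ball_integral (\<lambda>y. (1 / (p$3)^3) * density_difference a y)"
  proof (rule integral_cong)
    fix y :: "real^3" assume "y \<in> cball 0 1"
    then have h: "0 < height a y" by (intro height_pos) simp
    define x where "x = center + (p$3 * a) *\<^sub>R y"
    have x3: "x $ 3 = p$3 * height a y"
      by (simp add: x_def center_def height_def C algebra_simps)
    have "chart x $ 3 = (C * height a y - 1) / (a * height a y)"
      using h p3 a by (simp add: chart_def x3 field_simps)
    also have "C * height a y - 1 = a * (a + C * y$3)"
    proof -
      have "C * height a y = C^2 + a * (C * y$3)"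
        unfolding height_def C[symmetric] by (simp add: power2_eq_square algebra_simps)
      also have "\<dots> = 1 + a^2 + a * (C * y$3)" by (simp only: C_sq)
      finally show ?thesis by (simp add: power2_eq_square algebra_simps)
    qed
    finally have z: "chart x $ 3 = (a + C * y$3) / height a y" using a by simp
    have xi: "x$i = p$i + p$3 * a * y$i" if "i \<noteq> 3" for i
      using that by (simp add: x_def center_def)
    have "chart x $ i = y$i / height a y" if "i \<noteq> 3" for i
      using that p3 a h by (simp add: chart_def x3 xi)
    then have u: "axis_dist2 (chart x) = axis_dist2 y / (height a y)^2"
      by (simp add: axis_dist2_def power_divide add_divide_distrib)
    show "p$3 / ((center + (p$3 * a) *\<^sub>R y)$3)^4 * ?s (center + (p$3 * a) *\<^sub>R y)
      - 1 / ((center + (p$3 * a) *\<^sub>R y)$3)^3 = (1 / (p$3)^3) * density_difference a y"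
      unfolding x_def[symmetric] z u x3 density_difference_def C[symmetric] using p3 h
      by (simp add: power_mult_distrib field_simps power3_eq_cube power4_eq_xxxx)
  qed
  also have "\<dots> = (1 / (p$3)^3) * ball_integral (density_difference a)"
    by (rule integral_mult_right)
  finally have "riemannian_volume g geo_ball - riemannian_volume hyp_metric geo_ball
      = (p$3 * a)^3 * ((1 / (p$3)^3) * ball_integral (density_difference a))" .
  also have "\<dots> < 0"
    using p3 a assms(1) by (intro mult_pos_neg) auto
  finally show ?thesis by simp
qed

end

theorem theorem1p4:
  shows "\<exists>\<delta>>0. \<forall>p\<in>hyp_space. \<forall>r. 0 < r \<and> r < \<delta> \<longrightarrow>
    (let B = hyp_geodesic_ball p r in
      \<exists>g :: 3 metric_field.
        riemannian_metric_on B g \<and>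
        same_boundary_metric B g hyp_metric \<and>
        (\<forall>x\<in>B. scalar_curvature g x = scalar_curvature hyp_metric x) \<and>
        riemannian_volume g B < riemannian_volume hyp_metric B)"
proof -
  obtain \<delta> where \<delta>: "0 < \<delta>" "\<delta> \<le> 1/40"
    and neg: "\<And>a. 0 < a \<Longrightarrow> a < \<delta> \<Longrightarrow> ball_integral (density_difference a) < 0"
    using ball_integral_density_difference_neg by blast
  show ?thesis
  proof (intro exI[of _ "arsinh \<delta>"] conjI ballI allI impI)
    show "0 < arsinh \<delta>" using \<delta>(1) by simp
    fix p :: "real^3" and r assume p: "p \<in> hyp_space" and r: "0 < r \<and> r < arsinh \<delta>"
    define a where "a = sinh r"
    have ha: "0 < a" "a < \<delta>"
      using r sinh_real_less_iff[of r "arsinh \<delta>"] by (auto simp: a_def sinh_arsinh_real)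
    have "a^2 \<le> (1/40)^2" using ha \<delta> by (intro power_mono) auto
    then interpret small_ball p a
      using p ha by unfold_locales (auto simp: hyp_space_def power2_eq_square)
    have p3': "0 < p$3" using p by (simp add: hyp_space_def)
    have "C = cosh r"
      unfolding C_def unfolding a_def by (rule real_sqrt_unique) (simp_all add: cosh_square_eq)
    then have B: "hyp_geodesic_ball p r = geo_ball"
      unfolding geo_ball_def center_def \<open>C = cosh r\<close> unfolding a_def
      using hyp_geodesic_ball_eq_cball[OF p3'] r by (simp add: ball_center_def)
    show "let B = hyp_geodesic_ball p r in
      \<exists>g :: 3 metric_field. riemannian_metric_on B g \<and> same_boundary_metric B g hyp_metric \<and>
        (\<forall>x\<in>B. scalar_curvature g x = scalar_curvature hyp_metric x) \<and>
        riemannian_volume g B < riemannian_volume hyp_metric B"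
      unfolding Let_def B
    proof (intro exI[of _ g] conjI ballI)
      show "riemannian_metric_on geo_ball g" by (rule riemannian_g)
      show "same_boundary_metric geo_ball g hyp_metric" by (rule boundary_g)
      show "riemannian_volume g geo_ball < riemannian_volume hyp_metric geo_ball"
        using volume_g_less neg ha \<delta> by simp
      fix x assume x: "x \<in> geo_ball"
      then have "x \<in> hyp_space" using geo_ball_pos by (simp add: hyp_space_def)
      then show "scalar_curvature g x = scalar_curvature hyp_metric x"
        using scalar_curvature_g[OF x] scalar_curvature_hyp_metric by simp
    qed
  qed
qed

end
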